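(* Assume $b=0$ and that $\bar\pi(u):=\pi((u,\infty))$ satisfies $\bar\pi(u)\sim-\frac{1}{\Gamma(-\alpha)}u^{-1-\alpha}\ell(u)$ as $u\to\infty$, for some $0<\alpha<1$ and some $\ell$ slowly varying at $\infty$. Let $(Y_t,t\ge0)$ be a CBI$(\Psi,\Phi)$ process (under $\mathbb P_x$ for some $x\ge0$). (i) If Condition (S) holds, let $m(x):=\exp\big(\int_{1/x}^1\frac{\Phi(u)}{\Psi(u)}\mathrm{d}u\big)$ for $x>0$. Then $m(Y_t)/m(1/g(t))\to V$ in law as $t\to\infty$, where $V$ is uniformly distributed on $[0,1]$. (ii) If Condition (L) holds with constant $a>0$, then $g(t)Y_t\to V_L$ in law as $t\to\infty$, where $\mathbb E[e^{-\lambda V_L}]=(1+\lambda^\alpha)^{-a}$ for all $\lambda\ge0$. (iii) If Condition (F) holds with $\delta>0$, then $\varrho_tY_t\to V_F$ in law as $t\to\infty$, where $\mathbb E[e^{-\theta V_F}]=\exp(-\theta^{\delta\alpha})$ for all $\theta\ge0$, with $\varrho_t=\Phi^{-1}(1/t)=t^{-1/(\delta\alpha)}\bar\ell(t)$ (for large $t$) for some function $\bar\ell$ slowly varying at $\infty$. If Condition (F) holds with $\delta=0$, then $t\,\Phi(1/Y_t)\to\mathrm{e}_1$ in law as $t\to\infty$, where $\mathrm{e}_1$ is standard exponential.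
   Context: Let $\sigma\ge 0$, $b\in\mathbb R$, $\beta\ge 0$, and let $\pi,\nu$ be $\sigma$-finite measures on $(0,\infty)$ with $\int_0^\infty (z\wedge z^2)\pi(\mathrm{d}z)<\infty$ and $\int_0^\infty(1\wedge z)\nu(\mathrm{d}z)<\infty$. The branching mechanism is $\Psi(q)=bq+\frac12\sigma^2q^2+\int_0^\infty(e^{-qu}-1+qu)\pi(\mathrm{d}u)$ and the immigration mechanism is $\Phi(q)=\beta q+\int_0^\infty(1-e^{-qu})\nu(\mathrm{d}u)$, $q\ge 0$; it is assumed that $\Phi(q)>0$ for all $q>0$; $\Phi^{-1}$ is the inverse function of $\Phi$. For $\lambda\ge 0$, $t\mapsto v_t(\lambda)$ solves $\frac{\partial}{\partial t}v_t(\lambda)=-\Psi(v_t(\lambda))$, $v_0(\lambda)=\lambda$. A CBI$(\Psi,\Phi)$ process is a $[0,\infty)$-valued Markov process $(Y_t)$ with $\mathbb E_x[e^{-\lambda Y_t}]=\exp\big(-xv_t(\lambda)-\int_0^t\Phi(v_s(\lambda))\mathrm{d}s\big)$, where $\mathbb E_x$ refers to the process started at $x$. Fix $\lambda_0\in(0,\infty)$ and set $\varphi(\lambda)=\int_\lambda^{\lambda_0}\frac{\mathrm{d}u}{|\Psi(u)|}$ for $0<\lambda<\lambda_0$, a strictly decreasing bijection $(0,\lambda_0)\to(0,\infty)$; let $g$ be its inverse. Define $H(x)=\int_{g(x)}^{\lambda_0}\frac{\Phi(u)}{|\Psi(u)|}\mathrm{d}u$ for $x>0$, $H(0)=0$.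 Conditions: (S) $xH'(x)\to0$ and $H(x)\to\infty$ as $x\to\infty$; (L) $xH'(x)\to a$ for some constant $a>0$ as $x\to\infty$; (F) $xH'(x)\to\infty$ as $x\to\infty$ and $H'$ is regularly varying at $\infty$, i.e. $H'(x)=x^{-\delta}/L(x)$ with $L$ slowly varying at $\infty$ and $0\le\delta\le1$ (if $\delta=0$ then $L(x)\to\infty$, if $\delta=1$ then $L(x)\to0$). *)

theory Defs
  imports "HOL-Probability.Probability" "HOL-Library.Landau_Symbols"
begin

text \<open>Branching mechanism (on q >= 0); pi is a measure on the reals concentrated on (0,oo).\<close>
definition Psi :: "real \<Rightarrow> real \<Rightarrow> real measure \<Rightarrow> real \<Rightarrow> real" where
  "Psi b \<sigma> \<pi> q = b * q + (1/2) * \<sigma>\<^sup>2 * q\<^sup>2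
      + (\<integral>u. (exp (- q * u) - 1 + q * u) \<partial>\<pi>)"

text \<open>Immigration mechanism (on q >= 0); nu is a measure on the reals concentrated on (0,oo).\<close>
definition Phi :: "real \<Rightarrow> real measure \<Rightarrow> real \<Rightarrow> real" where
  "Phi \<beta> \<nu> q = \<beta> * q + (\<integral>u. (1 - exp (- q * u)) \<partial>\<nu>)"

definition inv_nonneg :: "(real \<Rightarrow> real) \<Rightarrow> real \<Rightarrow> real" where
  "inv_nonneg F y = (THE q. q \<ge> 0 \<and> F q = y)"

definition oint :: "(real \<Rightarrow> real) \<Rightarrow> real \<Rightarrow> real \<Rightarrow> real" where
  "oint f a b = (if a \<le> b then integral {a..b} f else - integral {b..a} f)"

definition varphi :: "(real \<Rightarrow> real) \<Rightarrow> real \<Rightarrow> real \<Rightarrow> real" where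
  "varphi Ps l0 lam = integral {lam..l0} (\<lambda>u. 1 / \<bar>Ps u\<bar>)"

definition ginv :: "(real \<Rightarrow> real) \<Rightarrow> real \<Rightarrow> real \<Rightarrow> real" where
  "ginv Ps l0 x = (THE lam. 0 < lam \<and> lam < l0 \<and> varphi Ps l0 lam = x)"

definition Hfun :: "(real \<Rightarrow> real) \<Rightarrow> (real \<Rightarrow> real) \<Rightarrow> real \<Rightarrow> real \<Rightarrow> real" where
  "Hfun Ps Ph l0 x = (if x > 0 then
      integral {ginv Ps l0 x..l0} (\<lambda>u. Ph u / \<bar>Ps u\<bar>) else 0)"

definition slowly_varying :: "(real \<Rightarrow> real) \<Rightarrow> bool" where
  "slowly_varying L \<longleftrightarrow> L \<in> borel_measurable borel \<and> (\<forall>\<^sub>F x in at_top. L x > 0) \<and>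
     (\<forall>c>0. ((\<lambda>x. L (c * x) / L x) \<longlongrightarrow> 1) at_top)"

definition conv_law_at_top :: "'a measure \<Rightarrow> (real \<Rightarrow> 'a \<Rightarrow> real) \<Rightarrow> real measure \<Rightarrow> bool" where
  "conv_law_at_top M X \<mu> \<longleftrightarrow>
     (\<forall>f :: real \<Rightarrow> real. continuous_on UNIV f \<and> bounded (range f) \<longrightarrow>
        ((\<lambda>t. \<integral>\<omega>. f (X t \<omega>) \<partial>M) \<longlongrightarrow> (\<integral>y. f y \<partial>\<mu>)) at_top)"

definition condS :: "(real \<Rightarrow> real) \<Rightarrow> bool" where
  "condS H \<longleftrightarrow> ((\<lambda>x. x * deriv H x) \<longlongrightarrow> 0) at_top \<and> filterlim H at_top at_top"

definition condL :: "(real \<Rightarrow> real) \<Rightarrow> real \<Rightarrow> bool" where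
  "condL H a \<longleftrightarrow> a > 0 \<and> ((\<lambda>x. x * deriv H x) \<longlongrightarrow> a) at_top"

definition condF :: "(real \<Rightarrow> real) \<Rightarrow> real \<Rightarrow> (real \<Rightarrow> real) \<Rightarrow> bool" where
  "condF H \<delta> L \<longleftrightarrow> filterlim (\<lambda>x. x * deriv H x) at_top at_top \<and>
     0 \<le> \<delta> \<and> \<delta> \<le> 1 \<and> slowly_varying L \<and>
     (\<forall>x>0. deriv H x = x powr (- \<delta>) / L x) \<and>
     (\<delta> = 0 \<longrightarrow> filterlim L at_top at_top) \<and>
     (\<delta> = 1 \<longrightarrow> (L \<longlongrightarrow> 0) at_top)"

end

theory Submission
  imports Defs
begin

text \<open>
  Write \<open>\<phi>\<close> for \<open>varphi\<close>, \<open>g\<close> for its inverse and \<open>H\<close> for \<open>Hfun\<close>. Since \<open>g' = - \<Psi> \<circ> g\<close>, the flow is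
  \<open>v t \<lambda> = g (\<phi> \<lambda> + t)\<close> for \<open>0 < \<lambda> < l0\<close>, and \<open>H' = \<Phi> \<circ> g\<close>; hence the Laplace transform of \<open>Y t\<close> at
  \<open>\<lambda>\<close> is \<open>exp (- x g (\<phi> \<lambda> + t) - (H (\<phi> \<lambda> + t) - H (\<phi> \<lambda>)))\<close>. The tail assumption makes \<open>\<Psi>\<close> regularly
  varying at \<open>0\<close> with index \<open>1 + \<alpha>\<close>, so by l'Hopital's rule \<open>\<phi>\<close> is regularly varying with index
  \<open>- \<alpha>\<close>, and everything reduces to the increment of \<open>H\<close> for a suitable \<open>\<lambda> = \<lambda>\<^sub>t \<rightarrow> 0\<close>:

  \<^item> under (L), \<open>H\<close> behaves like \<open>a ln\<close>, and \<open>\<phi> (\<lambda> g t) / t \<rightarrow> \<lambda> powr (- \<alpha>)\<close>;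
  \<^item> under (F), \<open>\<Phi> = H' \<circ> \<phi>\<close> is regularly varying with index \<open>\<delta> \<alpha>\<close>, while
    \<open>t / \<phi> (\<theta> \<rho>\<^sub>t) \<rightarrow> 0\<close> for the solution \<open>\<rho>\<^sub>t\<close> of \<open>\<Phi> \<rho>\<^sub>t = 1 / t\<close>, so the increment is asymptotic to \<open>t \<Phi> (\<theta> \<rho>\<^sub>t)\<close>;
  \<^item> under (S), and under (F) with \<open>\<delta> = 0\<close>, the limit does not depend on the scale \<open>\<theta>\<close> of
    \<open>\<theta> \<lambda>\<^sub>t Y t\<close>, so that it is the limit of the probability of \<open>\<lambda>\<^sub>t Y t \<le> 1\<close>.
\<close>

section \<open>Convergence in law\<close>

text \<open>The limit variables in (L) and in (F) with \<delta> > 0 are not constructed by hand: the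
  existence of a law with the required Laplace transform comes out of the continuity theorem
  together with the convergence. The closed form of the transform of \<open>Y t\<close> holds only
  below \<open>l0\<close>, which suffices because its arguments tend to 0; the flow then tends to 0
  too, so the starting point \<open>x\<close> drops out and only the immigration integral survives.
  The recurring obstacle: regular variation gives the limit of f(c x)/f(x) for fixed c, while the
  arguments here move with t. Uniformity comes from monotonicity where f is monotone, and from the
  mean value theorem in the variable ln x where x f'(x) converges. In (S) the argument is g(s) with
  H(s) = H(t) + ln u, so the increment of H tends to - ln u and the transform to u, the uniform
  distribution function. In (F) it is a multiple of the solution of \<Phi>(q) = \<kappa>/t: \<kappa>
  = 1 is the normalisation for \<delta> > 0, and a free \<kappa> produces the exponential
  distribution function for \<delta> = 0.\<close>

lemma conv_law_at_top_cdfI: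
  fixes X :: "real \<Rightarrow> 'a \<Rightarrow> real"
  assumes M: "prob_space M" and \<mu>: "real_distribution \<mu>"
    and X: "\<And>t. t \<ge> T \<Longrightarrow> X t \<in> borel_measurable M"
    and lim: "\<And>y. ((\<lambda>t. measure M {\<omega> \<in> space M. X t \<omega> \<le> y}) \<longlongrightarrow> cdf \<mu> y) at_top"
  shows "conv_law_at_top M X \<mu>"
  unfolding conv_law_at_top_def
proof (intro allI impI, elim conjE)
  fix f :: "real \<Rightarrow> real" assume f: "continuous_on UNIV f" "bounded (range f)"
  interpret M: prob_space M by fact
  have [measurable]: "f \<in> borel_measurable borel" by (rule borel_measurable_continuous_onI[OF f(1)])
  obtain B where B: "\<And>y. norm (f y) \<le> B" using f(2) by (auto simp: bounded_iff)
  show "((\<lambda>t. \<integral>\<omega>. f (X t \<omega>) \<partial>M) \<longlongrightarrow> (\<integral>y. f y \<partial>\<mu>)) at_top"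
  proof (rule tendsto_at_topI_sequentially)
    fix S :: "nat \<Rightarrow> real" assume S: "filterlim S at_top sequentially"
    \<comment> \<open>\<open>X t\<close> is known to be measurable only from \<open>T\<close> on;
      clipping the sequence at \<open>T\<close> changes finitely many terms.\<close>
    define S' where "S' n = max T (S n)" for n
    have ev: "eventually (\<lambda>n. S' n = S n) sequentially"
      using S unfolding filterlim_at_top S'_def by (auto elim!: allE[of _ T] eventually_mono)
    have S': "filterlim S' at_top sequentially"
      using S by (rule filterlim_at_top_mono) (auto simp: S'_def)
    have [measurable]: "X (S' n) \<in> borel_measurable M" for n by (rule X) (simp add: S'_def)
    have "weak_conv_m (\<lambda>n. distr M borel (X (S' n))) \<mu>"
      unfolding weak_conv_m_def weak_conv_def
    proof safe
      fix y
      have "cdf (distr M borel (X (S' n))) y = measure M {\<omega> \<in> space M. X (S' n) \<omega> \<le> y}" for n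
        unfolding cdf_def
        by (subst measure_distr) (auto intro!: arg_cong[where f="measure M"])
      then show "(\<lambda>n. cdf (distr M borel (X (S' n))) y) \<longlonglongrightarrow> cdf \<mu> y"
        using filterlim_compose[OF lim S', of y] by simp
    qed
    then have "(\<lambda>n. integral\<^sup>L (distr M borel (X (S' n))) f) \<longlonglongrightarrow> integral\<^sup>L \<mu> f"
      using B f(1) \<mu>
      by (intro weak_conv_imp_integral_bdd_continuous_conv) (auto simp: continuous_on_eq_continuous_at)
    then have "(\<lambda>n. \<integral>\<omega>. f (X (S' n) \<omega>) \<partial>M) \<longlonglongrightarrow> integral\<^sup>L \<mu> f"
      by (subst (asm) integral_distr) auto
    then show "(\<lambda>n. \<integral>\<omega>. f (X (S n) \<omega>) \<partial>M) \<longlonglongrightarrow> integral\<^sup>L \<mu> f"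
      by (rule Lim_transform_eventually) (use ev in \<open>auto elim: eventually_mono\<close>)
  qed
qed

text \<open>If the Laplace transform of \<open>Z t\<close> converges to a constant, the mass of \<open>Z t\<close> splits into
  a part collapsing to \<open>0\<close> and a part escaping to infinity.\<close>

lemma measure_tendsto_of_constant_laplace_limit:
  fixes Z :: "real \<Rightarrow> 'a \<Rightarrow> real"
  assumes M: "prob_space M"
    and Z: "\<And>t. t \<ge> T \<Longrightarrow> Z t \<in> borel_measurable M"
    and nonneg: "\<And>t \<omega>. t \<ge> T \<Longrightarrow> \<omega> \<in> space M \<Longrightarrow> Z t \<omega> \<ge> 0"
    and A: "\<And>t. t \<ge> T \<Longrightarrow> A t \<in> sets M"
    and less: "\<And>t \<omega>. t \<ge> T \<Longrightarrow> \<omega> \<in> space M \<Longrightarrow> Z t \<omega> < 1 \<Longrightarrow> \<omega> \<in> A t"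
    and le: "\<And>t \<omega>. t \<ge> T \<Longrightarrow> \<omega> \<in> A t \<Longrightarrow> Z t \<omega> \<le> 1"
    and lim: "\<And>\<theta>. \<theta> > 0 \<Longrightarrow> ((\<lambda>t. \<integral>\<omega>. exp (- \<theta> * Z t \<omega>) \<partial>M) \<longlongrightarrow> p) at_top"
  shows "((\<lambda>t. measure M (A t)) \<longlongrightarrow> p) at_top"
proof -
  interpret M: prob_space M by fact
  have int: "integrable M (\<lambda>\<omega>. exp (- \<theta> * Z t \<omega>))" if "\<theta> > 0" "t \<ge> T" for \<theta> t
    using that nonneg Z[OF that(2)] by (intro M.integrable_const_bound[of _ 1] AE_I2) auto
  \<comment> \<open>Outside \<open>A t\<close> one has \<open>Z t \<ge> 1\<close>, so the
    exponential is at most \<open>exp (- \<theta>)\<close> there.\<close>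
  have lower: "(\<integral>\<omega>. exp (- \<theta> * Z t \<omega>) \<partial>M) - exp (- \<theta>) \<le> measure M (A t)"
    if "\<theta> > 0" "t \<ge> T" for \<theta> t
  proof -
    have "(\<integral>\<omega>. exp (- \<theta> * Z t \<omega>) \<partial>M) \<le> (\<integral>\<omega>. indicator (A t) \<omega> + exp (- \<theta>) \<partial>M)"
    proof (rule integral_mono)
      fix \<omega> assume w: "\<omega> \<in> space M"
      show "exp (- \<theta> * Z t \<omega>) \<le> indicator (A t) \<omega> + exp (- \<theta>)"
      proof (cases "Z t \<omega> < 1")
        case True
        have "exp (- \<theta> * Z t \<omega>) \<le> 1" using nonneg[OF that(2) w] that by auto
        then show ?thesis using less[OF that(2) w True] by (simp add: add_increasing2)
      next
        case False
        then have "exp (- \<theta> * Z t \<omega>) \<le> exp (- \<theta>)" using that by auto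
        then show ?thesis by (rule order_trans) (simp add: indicator_def)
      qed
    qed (use int that A in \<open>auto simp: M.emeasure_eq_measure\<close>)
    also have "\<dots> = measure M (A t) + exp (- \<theta>)" using A[OF that(2)] by (subst Bochner_Integration.integral_add) (auto simp: M.prob_space M.emeasure_eq_measure)
    finally show ?thesis by simp
  qed
  \<comment> \<open>Markov's inequality: on \<open>A t\<close> one has \<open>Z t \<le> 1\<close>,
    hence \<open>1 \<le> exp \<theta> * exp (- \<theta> * Z t)\<close>.\<close>
  have upper: "measure M (A t) \<le> exp \<theta> * (\<integral>\<omega>. exp (- \<theta> * Z t \<omega>) \<partial>M)"
    if "\<theta> > 0" "t \<ge> T" for \<theta> t
  proof -
    have "(\<integral>\<omega>. indicator (A t) \<omega> \<partial>M) \<le> (\<integral>\<omega>. exp \<theta> * exp (- \<theta> * Z t \<omega>) \<partial>M)"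
    proof (rule integral_mono)
      fix \<omega> assume w: "\<omega> \<in> space M"
      show "indicator (A t) \<omega> \<le> exp \<theta> * exp (- \<theta> * Z t \<omega>)"
      proof (cases "\<omega> \<in> A t")
        case True
        then have "\<theta> * Z t \<omega> \<le> \<theta>" using le[OF that(2) True] that by simp
        then show ?thesis using True by (simp add: exp_add[symmetric])
      qed simp
    qed (use int that A in \<open>auto simp: M.emeasure_eq_measure\<close>)
    then show ?thesis using A[OF that(2)] by (simp add: M.emeasure_eq_measure)
  qed
  \<comment> \<open>The limit in t is taken at fixed \<theta>; afterwards \<theta> is taken large in
    \<open>lower\<close> and close to 0 in \<open>upper\<close>, where both bounds approach
    \<open>p\<close>.\<close>
  show ?thesis
  proof (rule order_tendstoI)
    fix a assume "a < p"
    have "((\<lambda>\<theta>::real. p - exp (- \<theta>)) \<longlongrightarrow> p - 0) at_top"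
      by (intro tendsto_intros filterlim_compose[OF exp_at_bot] filterlim_uminus_at_bot_at_top)
    then have "eventually (\<lambda>\<theta>. a < p - exp (- \<theta>)) at_top" using \<open>a < p\<close> by (auto dest: order_tendstoD)
    then obtain \<theta> where \<theta>: "\<theta> > 0" "a < p - exp (- \<theta>)"
      using eventually_happens[OF eventually_conj[OF eventually_gt_at_top[of 0]]] by auto
    have "eventually (\<lambda>t. a < (\<integral>\<omega>. exp (- \<theta> * Z t \<omega>) \<partial>M) - exp (- \<theta>)) at_top"
      using tendsto_diff[OF lim[OF \<theta>(1)] tendsto_const[of "exp (-\<theta>)"]] \<theta>(2) by (rule order_tendstoD)
    then show "eventually (\<lambda>t. a < measure M (A t)) at_top"
      using eventually_ge_at_top[of T] by eventually_elim (use lower[OF \<theta>(1)] in fastforce)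
  next
    fix a assume "p < a"
    have "((\<lambda>\<theta>::real. exp \<theta> * p) \<longlongrightarrow> exp 0 * p) (at_right 0)" by (intro tendsto_intros)
    then have "eventually (\<lambda>\<theta>. exp \<theta> * p < a) (at_right 0)" using \<open>p < a\<close> by (auto dest: order_tendstoD)
    then obtain \<theta> where \<theta>: "\<theta> > 0" "exp \<theta> * p < a"
      using eventually_happens[OF eventually_conj[OF eventually_at_right_less[of "0::real"]]] by auto
    have "eventually (\<lambda>t. exp \<theta> * (\<integral>\<omega>. exp (- \<theta> * Z t \<omega>) \<partial>M) < a) at_top"
      using tendsto_mult[OF tendsto_const[of "exp \<theta>"] lim[OF \<theta>(1)]] \<theta>(2) by (rule order_tendstoD)
    then show "eventually (\<lambda>t. measure M (A t) < a) at_top"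
      using eventually_ge_at_top[of T] by eventually_elim (use upper[OF \<theta>(1)] in fastforce)
  qed
qed

text \<open>The moments of \<open>exp (- X t)\<close> converge, so by Helly's and Weierstrass' theorems its law converges
  on \<open>[0, 1]\<close>; the assumption on \<open>L\<close> near \<open>0\<close> says that no mass of \<open>X t\<close> escapes to infinity.\<close>

lemma laplace_continuity:
  fixes X :: "real \<Rightarrow> 'a \<Rightarrow> real"
  assumes M: "prob_space M"
    and X: "\<And>t. t \<ge> T \<Longrightarrow> X t \<in> borel_measurable M"
    and nonneg: "\<And>t \<omega>. t \<ge> T \<Longrightarrow> \<omega> \<in> space M \<Longrightarrow> X t \<omega> \<ge> 0"
    and lim: "\<And>l. l > 0 \<Longrightarrow> ((\<lambda>t. \<integral>\<omega>. exp (- l * X t \<omega>) \<partial>M) \<longlongrightarrow> L l) at_top"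
    and L0: "(L \<longlongrightarrow> 1) (at_right 0)"
  shows "\<exists>\<mu>. prob_space \<mu> \<and> sets \<mu> = sets borel \<and> (AE y in \<mu>. y \<ge> 0) \<and>
           (\<forall>l>0. (\<integral>y. exp (- l * y) \<partial>\<mu>) = L l) \<and> conv_law_at_top M X \<mu>"
proof -
  interpret M: prob_space M by fact
  define U where "U t \<omega> = exp (- X t \<omega>)" for t \<omega>
  have U_meas[measurable]: "U t \<in> borel_measurable M" if "t \<ge> T" for t
    using X[OF that] unfolding U_def[abs_def] by measurable
  have U01: "U t \<omega> \<in> {0..1}" if "t \<ge> T" "\<omega> \<in> space M" for t \<omega>
    using nonneg[OF that] by (simp add: U_def)
  \<comment> \<open>Clamping to [0, 1] turns functions continuous on [0, 1] into globally continuous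
    ones without changing them on the range of \<open>U t\<close>.\<close>
  define c where "c u = max 0 (min 1 u)" for u :: real
  have cont_c: "continuous_on UNIV c" unfolding c_def[abs_def] by (intro continuous_intros)
  have c_meas[measurable]: "c \<in> borel_measurable borel"
    by (rule borel_measurable_continuous_onI[OF cont_c])
  have c01: "c u \<in> {0..1}" for u by (simp add: c_def)
  have cU: "c (U t \<omega>) = U t \<omega>" if "t \<ge> T" "\<omega> \<in> space M" for t \<omega>
    using U01[OF that] by (simp add: c_def)
  have cont_hc: "continuous_on UNIV (\<lambda>u. h (c u))" if "continuous_on {0..1} h" for h :: "real \<Rightarrow> real"
    by (rule continuous_on_compose2[OF that cont_c]) (use c01 in auto)

  have distU: "real_distribution (distr M borel (U t))" if "t \<ge> T" for t
    using M.prob_space_distr[OF U_meas[OF that]] by (simp add: real_distribution_def real_distribution_axioms_def)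
  have "tight (\<lambda>n. distr M borel (U (T + real n)))"
    unfolding tight_def
  proof (intro conjI allI impI)
    fix \<epsilon> :: real assume "\<epsilon> > 0"
    have "measure (distr M borel (U (T + real n))) {-1<..1} = 1" for n
    proof -
      have "U (T + real n) -` {-1<..1} \<inter> space M = space M"
        using U01[of "T + real n"] by fastforce
      then show ?thesis
        by (subst measure_distr) (auto simp: U_meas M.prob_space)
    qed
    then show "\<exists>a b. a < b \<and> (\<forall>n. 1 - \<epsilon> < measure (distr M borel (U (T + real n))) {a<..b})"
      using \<open>\<epsilon> > 0\<close> by (intro exI[of _ "-1"] exI[of _ 1]) auto
  qed (simp add: distU)
  \<comment> \<open>The subsequence only produces a candidate limit \<open>\<nu>\<close>;
    \<open>identify\<close> then computes its integrals from limits along the whole real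
    parameter.\<close>
  from tight_imp_convergent_subsubsequence[OF this strict_mono_id]
  obtain r \<nu> where r: "strict_mono (r :: nat \<Rightarrow> nat)" and \<nu>: "real_distribution \<nu>"
    and wc: "weak_conv_m (\<lambda>n. distr M borel (U (T + real (r n)))) \<nu>"
    by (auto simp: comp_def)
  interpret \<nu>: real_distribution \<nu> by fact

  have r_top: "filterlim (\<lambda>n. T + real (r n)) at_top sequentially"
    by (intro filterlim_tendsto_add_at_top[OF tendsto_const]
        filterlim_compose[OF filterlim_real_sequentially] filterlim_subseq r)
  have identify: "(\<integral>u. h u \<partial>\<nu>) = l"
    if h: "continuous_on UNIV h" "\<And>u. \<bar>h u\<bar> \<le> B"
      and l: "((\<lambda>t. \<integral>\<omega>. h (U t \<omega>) \<partial>M) \<longlongrightarrow> l) at_top" for h :: "real \<Rightarrow> real" and B l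
  proof -
    have [measurable]: "h \<in> borel_measurable borel" by (rule borel_measurable_continuous_onI[OF h(1)])
    have "(\<lambda>n. integral\<^sup>L (distr M borel (U (T + real (r n)))) h) \<longlonglongrightarrow> integral\<^sup>L \<nu> h"
      using h \<nu> wc distU
      by (intro weak_conv_imp_integral_bdd_continuous_conv) (auto simp: continuous_on_eq_continuous_at)
    then have "(\<lambda>n. \<integral>\<omega>. h (U (T + real (r n)) \<omega>) \<partial>M) \<longlonglongrightarrow> integral\<^sup>L \<nu> h"
      by (subst (asm) integral_distr) (auto simp: U_meas)
    moreover have "(\<lambda>n. \<integral>\<omega>. h (U (T + real (r n)) \<omega>) \<partial>M) \<longlonglongrightarrow> l"
      by (rule filterlim_compose[OF l r_top])
    ultimately show ?thesis by (rule LIMSEQ_unique)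
  qed

  \<comment> \<open>\<open>\<nu>\<close> lives on [0, 1]: a bounded continuous function vanishing
    exactly there has integral 0 against \<open>\<nu>\<close>.\<close>
  have c_id: "AE u in \<nu>. c u = u"
  proof -
    define h where "h u = min 1 \<bar>u - c u\<bar>" for u
    have ch: "continuous_on UNIV h"
      unfolding h_def[abs_def] by (intro continuous_intros cont_c)
    have [measurable]: "h \<in> borel_measurable borel" by (rule borel_measurable_continuous_onI[OF ch])
    have "eventually (\<lambda>t. 0 = (\<integral>\<omega>. h (U t \<omega>) \<partial>M)) at_top"
      using eventually_ge_at_top[of T]
    proof eventually_elim
      case (elim t)
      have "(\<integral>\<omega>. h (U t \<omega>) \<partial>M) = (\<integral>\<omega>. 0 \<partial>M)"
        by (rule Bochner_Integration.integral_cong) (auto simp: h_def cU[OF elim])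
      then show ?case by simp
    qed
    then have "((\<lambda>t. \<integral>\<omega>. h (U t \<omega>) \<partial>M) \<longlongrightarrow> 0) at_top"
      by (rule Lim_transform_eventually[OF tendsto_const])
    then have "(\<integral>u. h u \<partial>\<nu>) = 0"
      by (intro identify[OF ch, of 1]) (auto simp: h_def)
    moreover have "integrable \<nu> h"
      by (rule \<nu>.integrable_const_bound[of _ 1]) (auto simp: h_def)
    ultimately have "AE u in \<nu>. h u = 0"
      by (subst (asm) integral_nonneg_eq_0_iff_AE) (auto simp: h_def)
    then show ?thesis by eventually_elim (auto simp: h_def min_def split: if_splits)
  qed

  \<comment> \<open>The k-th moment of \<open>exp (- X t)\<close> is the Laplace transform at the
    integer k, covered by \<open>lim\<close> for k > 0.\<close>
  have pow_lim: "((\<lambda>t. \<integral>\<omega>. U t \<omega> ^ k \<partial>M) \<longlongrightarrow> (\<integral>u. c u ^ k \<partial>\<nu>)) at_top" for k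
  proof -
    have "\<exists>l. ((\<lambda>t. \<integral>\<omega>. U t \<omega> ^ k \<partial>M) \<longlongrightarrow> l) at_top"
    proof (cases k)
      case 0 then show ?thesis by (auto simp: M.prob_space)
    next
      case (Suc j)
      then have "((\<lambda>t. \<integral>\<omega>. U t \<omega> ^ k \<partial>M) \<longlongrightarrow> L (real k)) at_top"
        using lim[of "real k"] unfolding U_def exp_of_nat_mult[symmetric] by (simp add: algebra_simps)
      then show ?thesis by blast
    qed
    then obtain l where l: "((\<lambda>t. \<integral>\<omega>. U t \<omega> ^ k \<partial>M) \<longlongrightarrow> l) at_top" by blast
    have "(\<integral>u. c u ^ k \<partial>\<nu>) = l"
    proof (rule identify[of _ 1])
      show "continuous_on UNIV (\<lambda>u. c u ^ k)" by (intro continuous_intros cont_c)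
      show "\<bar>c u ^ k\<bar> \<le> 1" for u using c01[of u] by (auto simp: power_le_one)
      show "((\<lambda>t. \<integral>\<omega>. c (U t \<omega>) ^ k \<partial>M) \<longlongrightarrow> l) at_top"
      proof (rule Lim_transform_eventually[OF l])
        show "eventually (\<lambda>t. (\<integral>\<omega>. U t \<omega> ^ k \<partial>M) = (\<integral>\<omega>. c (U t \<omega>) ^ k \<partial>M)) at_top"
          using eventually_ge_at_top[of T]
          by eventually_elim (intro Bochner_Integration.integral_cong, auto simp: cU)
      qed
    qed
    with l show ?thesis by simp
  qed

  \<comment> \<open>Three errors of size \<open>e / 4\<close>: polynomial against \<open>h\<close>
    under \<open>M\<close>, polynomial against \<open>h\<close> under \<open>\<nu>\<close>, and the
    convergence of finitely many moments.\<close>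
  have cont_lim: "((\<lambda>t. \<integral>\<omega>. h (U t \<omega>) \<partial>M) \<longlongrightarrow> (\<integral>u. h (c u) \<partial>\<nu>)) at_top"
    if h: "continuous_on {0..1} h" for h :: "real \<Rightarrow> real"
  proof (rule tendstoI)
    fix e :: real assume "e > 0"
    obtain p where "real_polynomial_function p" and p: "\<And>u. u \<in> {0..1} \<Longrightarrow> \<bar>h u - p u\<bar> < e / 4"
      using Stone_Weierstrass_real_polynomial_function[OF _ h, of "e / 4"] \<open>e > 0\<close> by auto
    then obtain a n where pa: "p = (\<lambda>x. \<Sum>i\<le>n. a i * x ^ i)"
      by (auto simp: real_polynomial_function_iff_sum)
    have hc[measurable]: "(\<lambda>u. h (c u)) \<in> borel_measurable borel"
      by (rule borel_measurable_continuous_onI[OF cont_hc[OF h]])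
    have pc: "continuous_on {0..1} p" unfolding pa by (intro continuous_intros)
    have [measurable]: "p \<in> borel_measurable borel" unfolding pa by measurable
    obtain B where B: "\<And>u. u \<in> {0..1} \<Longrightarrow> norm (h u) \<le> B"
      using compact_imp_bounded[OF compact_continuous_image[OF h]] by (force simp: bounded_iff)
    obtain B' where B': "\<And>u. u \<in> {0..1} \<Longrightarrow> norm (p u) \<le> B'"
      using compact_imp_bounded[OF compact_continuous_image[OF pc]] by (force simp: bounded_iff)
    have powint: "integrable M (\<lambda>\<omega>. U t \<omega> ^ i)" if "t \<ge> T" for t i
      using U01[OF that] U_meas[OF that]
      by (intro M.integrable_const_bound[of _ 1] AE_I2) (auto simp: power_le_one)
    have powint': "integrable \<nu> (\<lambda>u. c u ^ i)" for i
      using c01 by (intro \<nu>.integrable_const_bound[of _ 1] AE_I2) (auto simp: power_le_one)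
    have "((\<lambda>t. \<Sum>i\<le>n. a i * (\<integral>\<omega>. U t \<omega> ^ i \<partial>M)) \<longlongrightarrow> (\<Sum>i\<le>n. a i * (\<integral>u. c u ^ i \<partial>\<nu>))) at_top"
      by (intro tendsto_intros pow_lim)
    also have "(\<Sum>i\<le>n. a i * (\<integral>u. c u ^ i \<partial>\<nu>)) = (\<integral>u. p (c u) \<partial>\<nu>)"
      unfolding pa by (subst Bochner_Integration.integral_sum) (auto intro!: powint')
    finally have "((\<lambda>t. \<Sum>i\<le>n. a i * (\<integral>\<omega>. U t \<omega> ^ i \<partial>M)) \<longlongrightarrow> (\<integral>u. p (c u) \<partial>\<nu>)) at_top" .
    then have ev: "eventually (\<lambda>t. dist (\<Sum>i\<le>n. a i * (\<integral>\<omega>. U t \<omega> ^ i \<partial>M)) (\<integral>u. p (c u) \<partial>\<nu>) < e / 4) at_top"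
      using \<open>e > 0\<close> by (intro tendstoD) auto
    have near: "\<bar>(\<integral>u. h (c u) \<partial>\<nu>) - (\<integral>u. p (c u) \<partial>\<nu>)\<bar> \<le> e / 4"
    proof -
      have ih: "integrable \<nu> (\<lambda>u. h (c u))"
        by (rule \<nu>.integrable_const_bound[of _ B]) (use B[OF c01] in auto)
      have ip: "integrable \<nu> (\<lambda>u. p (c u))"
        by (rule \<nu>.integrable_const_bound[of _ B']) (use B'[OF c01] in auto)
      have "\<bar>(\<integral>u. h (c u) \<partial>\<nu>) - (\<integral>u. p (c u) \<partial>\<nu>)\<bar> = \<bar>\<integral>u. h (c u) - p (c u) \<partial>\<nu>\<bar>"
        by (subst Bochner_Integration.integral_diff) (auto intro!: ih ip)
      also have "\<dots> \<le> (\<integral>u. e / 4 \<partial>\<nu>)"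
        using p[OF c01]
        by (intro order_trans[OF integral_abs_bound] integral_mono Bochner_Integration.integrable_abs
              Bochner_Integration.integrable_diff ih ip) (auto intro: less_imp_le)
      finally show ?thesis using \<nu>.prob_space by simp
    qed
    have "eventually (\<lambda>t. \<bar>(\<integral>\<omega>. h (U t \<omega>) \<partial>M) - (\<Sum>i\<le>n. a i * (\<integral>\<omega>. U t \<omega> ^ i \<partial>M))\<bar> \<le> e / 4) at_top"
      using eventually_ge_at_top[of T]
    proof eventually_elim
      case (elim t)
      note [measurable] = U_meas[OF elim]
      have ih: "integrable M (\<lambda>\<omega>. h (c (U t \<omega>)))"
        by (rule M.integrable_const_bound[of _ B]) (use B[OF c01] in auto)
      have ip: "integrable M (\<lambda>\<omega>. p (c (U t \<omega>)))"
        by (rule M.integrable_const_bound[of _ B']) (use B'[OF c01] in auto)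
      have hU: "(\<integral>\<omega>. h (U t \<omega>) \<partial>M) = (\<integral>\<omega>. h (c (U t \<omega>)) \<partial>M)"
        by (rule Bochner_Integration.integral_cong) (auto simp: cU[OF elim])
      have pU: "(\<Sum>i\<le>n. a i * (\<integral>\<omega>. U t \<omega> ^ i \<partial>M)) = (\<integral>\<omega>. p (U t \<omega>) \<partial>M)"
        unfolding pa by (subst Bochner_Integration.integral_sum) (auto intro!: powint elim)
      have pU': "(\<integral>\<omega>. p (U t \<omega>) \<partial>M) = (\<integral>\<omega>. p (c (U t \<omega>)) \<partial>M)"
        by (rule Bochner_Integration.integral_cong) (auto simp: cU[OF elim])
      have "\<bar>(\<integral>\<omega>. h (c (U t \<omega>)) \<partial>M) - (\<integral>\<omega>. p (c (U t \<omega>)) \<partial>M)\<bar> = \<bar>\<integral>\<omega>. h (c (U t \<omega>)) - p (c (U t \<omega>)) \<partial>M\<bar>"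
        by (subst Bochner_Integration.integral_diff) (auto intro!: ih ip)
      also have "\<dots> \<le> (\<integral>\<omega>. e / 4 \<partial>M)"
        using p[OF c01]
        by (intro order_trans[OF integral_abs_bound] integral_mono Bochner_Integration.integrable_abs
              Bochner_Integration.integrable_diff ih ip) (auto intro: less_imp_le simp: M.emeasure_eq_measure)
      finally show ?case unfolding hU pU pU' by (simp add: M.prob_space)
    qed
    then show "eventually (\<lambda>t. dist (\<integral>\<omega>. h (U t \<omega>) \<partial>M) (\<integral>u. h (c u) \<partial>\<nu>) < e) at_top"
      using ev
      unfolding dist_real_def by eventually_elim (use near \<open>e > 0\<close> in linarith)
  qed

  \<comment> \<open>For l > 0 the power is continuous up to 0, so \<open>cont_lim\<close> also
    covers non-integer exponents.\<close>
  have powr_int: "(\<integral>u. c u powr l \<partial>\<nu>) = L l" if "l > 0" for l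
  proof -
    have "((\<lambda>t. \<integral>\<omega>. U t \<omega> powr l \<partial>M) \<longlongrightarrow> (\<integral>u. c u powr l \<partial>\<nu>)) at_top"
      using that by (intro cont_lim continuous_on_powr') (auto intro!: continuous_intros)
    moreover have "((\<lambda>t. \<integral>\<omega>. U t \<omega> powr l \<partial>M) \<longlongrightarrow> L l) at_top"
      using lim[OF that] by (simp add: U_def powr_def)
    ultimately show ?thesis by (intro tendsto_unique) auto
  qed

  \<comment> \<open>The point 0 stands for X at infinity. As l decreases to 0 the powers tend to the
    indicator of (0, 1], and their integrals \<open>L l\<close> tend to 1.\<close>
  have c_pos: "AE u in \<nu>. c u > 0"
  proof -
    have "(\<lambda>n. \<integral>u. c u powr (1 / real (Suc n)) \<partial>\<nu>) \<longlonglongrightarrow> (\<integral>u. indicator {0<..} (c u) \<partial>\<nu>)"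
    proof (rule integral_dominated_convergence[where w="\<lambda>_. 1"])
      show "AE u in \<nu>. (\<lambda>n. c u powr (1 / real (Suc n))) \<longlonglongrightarrow> indicator {0<..} (c u)"
      proof (rule AE_I2)
        fix u
        show "(\<lambda>n. c u powr (1 / real (Suc n))) \<longlonglongrightarrow> indicator {0<..} (c u)"
        proof (cases "c u = 0")
          case False
          then have "(\<lambda>n. c u powr (1 / real (Suc n))) \<longlonglongrightarrow> c u powr 0"
            by (intro tendsto_intros LIMSEQ_Suc[OF lim_1_over_n]) auto
          then show ?thesis using False c01[of u] by simp
        qed simp
      qed
      show "AE u in \<nu>. norm (c u powr (1 / real (Suc n))) \<le> 1" for n
        using c01 by (intro AE_I2) (auto intro!: powr_le1)
    qed auto
    moreover have "(\<lambda>n. \<integral>u. c u powr (1 / real (Suc n)) \<partial>\<nu>) \<longlonglongrightarrow> 1"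
    proof -
      have "filterlim (\<lambda>n. 1 / real (Suc n)) (at_right 0) sequentially"
        by (rule tendsto_imp_filterlim_at_right[OF LIMSEQ_Suc[OF lim_1_over_n]]) auto
      from filterlim_compose[OF L0 this] show ?thesis by (simp add: powr_int)
    qed
    ultimately have "(\<integral>u. indicator {0<..} (c u) \<partial>\<nu>) = (1 :: real)" by (rule LIMSEQ_unique)
    also have "(\<integral>u. indicator {0<..} (c u) \<partial>\<nu>) = (\<integral>u. indicator {u \<in> space \<nu>. c u > 0} u \<partial>\<nu>)"
      by (rule Bochner_Integration.integral_cong) (auto simp: indicator_def)
    also have "\<dots> = measure \<nu> {u \<in> space \<nu>. c u > 0}" by simp
    finally show ?thesis by (subst \<nu>.prob_Collect_eq_1[symmetric]) auto
  qed

  define \<mu> where "\<mu> = distr \<nu> borel (\<lambda>u. - ln (c u))"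
  have "prob_space \<mu>" unfolding \<mu>_def by (rule \<nu>.prob_space_distr) simp
  moreover have "sets \<mu> = sets borel" by (simp add: \<mu>_def)
  moreover have "AE y in \<mu>. y \<ge> 0"
    unfolding \<mu>_def
  proof (subst AE_distr_iff)
    show "AE u in \<nu>. 0 \<le> - ln (c u)"
      using c_pos by eventually_elim (use c01 in auto)
  qed auto
  moreover have "(\<integral>y. exp (- l * y) \<partial>\<mu>) = L l" if "l > 0" for l
  proof -
    have "(\<integral>y. exp (- l * y) \<partial>\<mu>) = (\<integral>u. exp (l * ln (c u)) \<partial>\<nu>)"
      unfolding \<mu>_def by (subst integral_distr) auto
    also have "\<dots> = (\<integral>u. c u powr l \<partial>\<nu>)"
    proof (rule integral_cong_AE)
      show "AE u in \<nu>. exp (l * ln (c u)) = c u powr l"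
        using c_pos by eventually_elim (simp add: powr_def)
    qed auto
    finally show ?thesis by (simp add: powr_int that)
  qed
  moreover have "conv_law_at_top M X \<mu>"
    unfolding conv_law_at_top_def
  proof (intro allI impI, elim conjE)
    fix f :: "real \<Rightarrow> real" assume f: "continuous_on UNIV f" "bounded (range f)"
    have [measurable]: "f \<in> borel_measurable borel" by (rule borel_measurable_continuous_onI[OF f(1)])
    obtain B where B: "\<And>y. norm (f y) \<le> B" using f(2) by (auto simp: bounded_iff)
    show "((\<lambda>t. \<integral>\<omega>. f (X t \<omega>) \<partial>M) \<longlongrightarrow> (\<integral>y. f y \<partial>\<mu>)) at_top"
    proof (rule tendsto_at_topI_sequentially)
      fix S :: "nat \<Rightarrow> real" assume S: "filterlim S at_top sequentially"
      define S' where "S' n = max T (S n)" for n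
      have ev: "eventually (\<lambda>n. S' n = S n) sequentially"
        using S unfolding filterlim_at_top S'_def by (auto elim!: allE[of _ T] eventually_mono)
      have S'T: "S' n \<ge> T" for n by (simp add: S'_def)
      have S': "filterlim S' at_top sequentially"
        using S by (rule filterlim_at_top_mono) (auto simp: S'_def)
      have [measurable]: "U (S' n) \<in> borel_measurable M" for n by (rule U_meas[OF S'T])
      have "weak_conv_m (\<lambda>n. distr M borel (U (S' n))) \<nu>"
      proof (rule integral_bdd_continuous_conv_imp_weak_conv)
        fix h :: "real \<Rightarrow> real" assume h: "\<And>x. isCont h x" "\<And>x. \<bar>h x\<bar> \<le> 1"
        have hc: "continuous_on A h" for A by (rule continuous_at_imp_continuous_on) (use h in auto)
        have [measurable]: "h \<in> borel_measurable borel" by (rule borel_measurable_continuous_onI[OF hc])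
        have "(\<lambda>n. \<integral>\<omega>. h (U (S' n) \<omega>) \<partial>M) \<longlonglongrightarrow> (\<integral>u. h (c u) \<partial>\<nu>)"
          by (rule filterlim_compose[OF cont_lim[OF hc] S'])
        also have "(\<integral>u. h (c u) \<partial>\<nu>) = (\<integral>u. h u \<partial>\<nu>)"
          using c_id by (intro integral_cong_AE) (auto elim: eventually_mono)
        finally show "(\<lambda>n. integral\<^sup>L (distr M borel (U (S' n))) h) \<longlonglongrightarrow> integral\<^sup>L \<nu> h"
          by (subst integral_distr) auto
      qed (auto simp: distU S'T \<nu>)
      then have "(\<lambda>n. integral\<^sup>L (distr M borel (U (S' n))) (\<lambda>u. f (- ln (c u)))) \<longlonglongrightarrow> integral\<^sup>L \<nu> (\<lambda>u. f (- ln (c u)))"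
      proof (intro weak_conv_imp_bdd_ae_continuous_conv[where B=B])
        \<comment> \<open>The test function transported by \<open>- ln\<close> can be discontinuous
          only where \<open>c u = 0\<close>, a \<open>\<nu>\<close>-null set, so the almost
          everywhere continuous version of weak convergence applies.\<close>
        have cont: "isCont (\<lambda>u. f (- ln (c u))) u" if "c u > 0" for u
        proof -
          have "isCont c u" using cont_c by (simp add: continuous_on_eq_continuous_at)
          then have "isCont (\<lambda>u. - ln (c u)) u"
            by (intro isCont_minus isCont_ln') (use that in auto)
          moreover have "isCont f (- ln (c u))" using f(1) by (simp add: continuous_on_eq_continuous_at)
          ultimately show ?thesis by (rule isCont_o2)
        qed
        have "emeasure \<nu> {u. \<not> isCont (\<lambda>u. f (- ln (c u))) u} \<le> emeasure \<nu> {u \<in> space \<nu>. \<not> c u > 0}"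
          using cont by (intro emeasure_mono) auto
        also have "\<dots> = 0"
          using c_pos by (subst (asm) AE_iff_measurable[OF _ refl]) auto
        finally show "emeasure \<nu> {u. \<not> isCont (\<lambda>u. f (- ln (c u))) u} = 0" by simp
      qed (use B in \<open>auto simp: distU S'T \<nu>\<close>)
      then have "(\<lambda>n. \<integral>\<omega>. f (- ln (c (U (S' n) \<omega>))) \<partial>M) \<longlonglongrightarrow> integral\<^sup>L \<mu> f"
        unfolding \<mu>_def by (subst integral_distr, simp, simp, subst (asm) integral_distr) auto
      moreover have "(\<integral>\<omega>. f (- ln (c (U (S' n) \<omega>))) \<partial>M) = (\<integral>\<omega>. f (X (S' n) \<omega>) \<partial>M)" for n
        by (rule Bochner_Integration.integral_cong) (simp_all only: cU[OF S'T], simp add: U_def)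
      ultimately have "(\<lambda>n. \<integral>\<omega>. f (X (S' n) \<omega>) \<partial>M) \<longlonglongrightarrow> integral\<^sup>L \<mu> f" by simp
      then show "(\<lambda>n. \<integral>\<omega>. f (X (S n) \<omega>) \<partial>M) \<longlonglongrightarrow> integral\<^sup>L \<mu> f"
        by (rule Lim_transform_eventually) (use ev in \<open>auto elim: eventually_mono\<close>)
    qed
  qed
  ultimately show ?thesis by blast
qed

section \<open>Regular variation\<close>

text \<open>In the variable ln x the derivative of \<open>f\<close> is \<open>x * f' x\<close>,
  which tends to 0; by the mean value inequality a bounded distance of logarithms contributes
  nothing in the limit.\<close>

lemma log_slope_zero_diff:
  fixes f :: "real \<Rightarrow> real"
  assumes der: "\<And>x. x > 0 \<Longrightarrow> (f has_real_derivative f' x) (at x)"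
    and lim: "((\<lambda>x. x * f' x) \<longlongrightarrow> 0) at_top"
    and A: "filterlim A at_top F" and B: "filterlim B at_top F"
    and bnd: "eventually (\<lambda>t. \<bar>ln (A t) - ln (B t)\<bar> \<le> K) F"
  shows "((\<lambda>t. f (A t) - f (B t)) \<longlongrightarrow> 0) F"
proof (rule tendstoI)
  fix e :: real assume "e > 0"
  define e' where "e' = e / (\<bar>K\<bar> + 1)"
  have e': "e' > 0" using \<open>e > 0\<close> by (simp add: e'_def)
  have "eventually (\<lambda>x. \<bar>x * f' x\<bar> < e') at_top"
    using tendstoD[OF lim e'] by (simp add: dist_real_def)
  then obtain X where X: "X > 0" "\<And>x. x \<ge> X \<Longrightarrow> \<bar>x * f' x\<bar> < e'"
    unfolding eventually_at_top_linorder by (metis gt_ex max.bounded_iff max.strict_coboundedI1)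
  have bound: "\<bar>f a - f b\<bar> \<le> e' * \<bar>ln a - ln b\<bar>" if "a \<ge> X" "b \<ge> X" for a b
  proof -
    have "norm ((\<lambda>y. f (exp y)) (ln a) - (\<lambda>y. f (exp y)) (ln b)) \<le> e' * norm (ln a - ln b)"
    proof (rule field_differentiable_bound)
      show "convex {ln X..}" by simp
      show "((\<lambda>y. f (exp y)) has_field_derivative f' (exp z) * exp z) (at z within {ln X..})"
        if "z \<in> {ln X..}" for z
        by (rule DERIV_subset[OF DERIV_chain2[OF der]]) (auto intro: DERIV_exp)
      show "norm (f' (exp z) * exp z) \<le> e'" if "z \<in> {ln X..}" for z
      proof -
        have "X \<le> exp z" using that X(1) by (metis atLeast_iff exp_le_cancel_iff exp_ln)
        from X(2)[OF this] show ?thesis by (simp add: mult.commute)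
      qed
    qed (use that X(1) in auto)
    then show ?thesis using that X(1) by (simp add: dist_real_def)
  qed
  have "eventually (\<lambda>t. A t \<ge> X) F" "eventually (\<lambda>t. B t \<ge> X) F"
    using A B by (auto simp: filterlim_at_top)
  then show "eventually (\<lambda>t. dist (f (A t) - f (B t)) 0 < e) F"
    using bnd
  proof eventually_elim
    case (elim t)
    have "\<bar>f (A t) - f (B t)\<bar> \<le> e' * \<bar>ln (A t) - ln (B t)\<bar>" by (rule bound) (use elim in auto)
    also have "\<dots> \<le> e' * \<bar>K\<bar>" using elim e' by (intro mult_left_mono) auto
    also have "\<dots> < e" using \<open>e > 0\<close> by (simp add: e'_def field_simps)
    finally show ?case by simp
  qed
qed

text \<open>Subtracting \<open>a * ln\<close> reduces the claim to logarithmic slope 0, and the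
  logarithm contributes \<open>a * ln r\<close>.\<close>

lemma log_slope_diff:
  fixes f :: "real \<Rightarrow> real"
  assumes der: "\<And>x. x > 0 \<Longrightarrow> (f has_real_derivative f' x) (at x)"
    and lim: "((\<lambda>x. x * f' x) \<longlongrightarrow> a) at_top"
    and A: "filterlim A at_top F" and B: "filterlim B at_top F"
    and r: "((\<lambda>t. A t / B t) \<longlongrightarrow> r) F" "r > 0"
  shows "((\<lambda>t. f (A t) - f (B t)) \<longlongrightarrow> a * ln r) F"
proof -
  have evpos: "eventually (\<lambda>t. A t > 0 \<and> B t > 0) F"
    using A B by (auto simp: filterlim_at_top_dense eventually_conj_iff)
  have "((\<lambda>t. ln (A t / B t)) \<longlongrightarrow> ln r) F" using r by (intro tendsto_intros) auto
  moreover have "eventually (\<lambda>t. ln (A t / B t) = ln (A t) - ln (B t)) F"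
    using evpos by eventually_elim (simp add: ln_div)
  ultimately have ln: "((\<lambda>t. ln (A t) - ln (B t)) \<longlongrightarrow> ln r) F"
    by (rule Lim_transform_eventually)
  have bnd: "eventually (\<lambda>t. \<bar>ln (A t) - ln (B t)\<bar> \<le> \<bar>ln r\<bar> + 1) F"
    using tendstoD[OF ln zero_less_one] by eventually_elim (simp add: dist_real_def)
  have "((\<lambda>t. (f (A t) - a * ln (A t)) - (f (B t) - a * ln (B t))) \<longlongrightarrow> 0) F"
  proof (rule log_slope_zero_diff[OF _ _ A B bnd])
    show "((\<lambda>x. f x - a * ln x) has_real_derivative f' x - a * (1 / x)) (at x)" if "x > 0" for x
      using that by (auto intro!: derivative_eq_intros der)
    have "((\<lambda>x. x * f' x - a) \<longlongrightarrow> a - a) at_top" by (intro tendsto_intros lim)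
    then have "((\<lambda>x. x * f' x - a) \<longlongrightarrow> 0) at_top" by simp
    then show "((\<lambda>x. x * (f' x - a * (1 / x))) \<longlongrightarrow> 0) at_top"
      by (rule Lim_transform_eventually)
         (rule eventually_mono[OF eventually_gt_at_top[of 0]], simp add: field_simps)
  qed
  from tendsto_add[OF this tendsto_mult[OF tendsto_const[of a] ln]]
  show ?thesis by (simp add: algebra_simps)
qed

text \<open>Monotonicity replaces uniform convergence: \<open>A t\<close> eventually lies on the
  right side of \<open>c * B t\<close> for each fixed \<open>c\<close> above or below
  \<open>r\<close>, and \<open>c\<close> can be taken close to \<open>r\<close>.\<close>

lemma antimono_regular_variation_ratio:
  fixes f :: "real \<Rightarrow> real"
  assumes anti: "\<And>x y. 0 < x \<Longrightarrow> x \<le> y \<Longrightarrow> f y \<le> f x"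
    and pos: "\<And>x. 0 < x \<Longrightarrow> f x > 0"
    and rv: "\<And>c. c > 0 \<Longrightarrow> ((\<lambda>x. f (c * x) / f x) \<longlongrightarrow> c powr \<rho>) at_top"
    and B: "filterlim B at_top F" and r: "((\<lambda>t. A t / B t) \<longlongrightarrow> r) F" "r > 0"
  shows "((\<lambda>t. f (A t) / f (B t)) \<longlongrightarrow> r powr \<rho>) F"
proof -
  have Bpos: "eventually (\<lambda>t. B t > 0) F" using B by (auto simp: filterlim_at_top_dense)
  have Apos: "eventually (\<lambda>t. A t > 0) F"
    using order_tendstoD(1)[OF r] Bpos by eventually_elim (auto simp: zero_less_divide_iff)
  have cont: "((\<lambda>c. c powr \<rho>) \<longlongrightarrow> r powr \<rho>) (at r within S)" for S
    using r(2) by (intro tendsto_intros) auto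
  have rvB: "((\<lambda>t. f (c * B t) / f (B t)) \<longlongrightarrow> c powr \<rho>) F" if "c > 0" for c
    by (rule filterlim_compose[OF rv[OF that] B])
  show ?thesis
  proof (rule order_tendstoI)
    fix a assume "a < r powr \<rho>"
    then have "eventually (\<lambda>c. a < c powr \<rho>) (at_right r)" using cont by (rule order_tendstoD(1)[rotated])
    then obtain c where c: "c > r" "a < c powr \<rho>"
      using eventually_happens[OF eventually_conj[OF eventually_at_right_less[of r]]] by auto
    have "c > 0" using c r by simp
    show "eventually (\<lambda>t. a < f (A t) / f (B t)) F"
      using order_tendstoD(1)[OF rvB[OF \<open>c > 0\<close>] c(2)] order_tendstoD(2)[OF r(1) c(1)] Apos Bpos
    proof eventually_elim
      case (elim t)
      then have "A t \<le> c * B t" by (simp add: field_simps)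
      then have "f (c * B t) \<le> f (A t)" using elim by (intro anti) auto
      then have "f (c * B t) / f (B t) \<le> f (A t) / f (B t)"
        using pos[of "B t"] elim by (intro divide_right_mono) auto
      then show ?case using elim by simp
    qed
  next
    fix a assume "r powr \<rho> < a"
    then have "eventually (\<lambda>c. c powr \<rho> < a) (at_left r)" using cont by (rule order_tendstoD(2)[rotated])
    moreover have "eventually (\<lambda>c. c \<in> {0<..<r}) (at_left r)"
      using r(2) by (rule eventually_at_leftI[rotated]) auto
    ultimately have "eventually (\<lambda>c. c powr \<rho> < a \<and> c \<in> {0<..<r}) (at_left r)"
      by (rule eventually_conj)
    then obtain c where c: "c < r" "c powr \<rho> < a" "c > 0"
      using eventually_happens[of _ "at_left r"] by fastforce
    show "eventually (\<lambda>t. f (A t) / f (B t) < a) F"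
      using order_tendstoD(2)[OF rvB[OF \<open>c > 0\<close>] c(2)] order_tendstoD(1)[OF r(1) c(1)] Apos Bpos
    proof eventually_elim
      case (elim t)
      then have "c * B t \<le> A t" by (simp add: field_simps)
      then have "f (A t) \<le> f (c * B t)" using elim c by (intro anti) auto
      then have "f (A t) / f (B t) \<le> f (c * B t) / f (B t)"
        using pos[of "B t"] elim by (intro divide_right_mono) auto
      then show ?case using elim by simp
    qed
  qed
qed

lemma filterlim_mult_at_right_0:
  fixes f :: "'b \<Rightarrow> real"
  assumes "filterlim f (at_right 0) F" "c > 0"
  shows "filterlim (\<lambda>t. c * f t) (at_right 0) F"
proof (rule tendsto_imp_filterlim_at_right)
  show "((\<lambda>t. c * f t) \<longlongrightarrow> 0) F"
    using tendsto_mult_right_zero assms(1) filterlim_at by blast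
  show "eventually (\<lambda>t. 0 < c * f t) F"
    using assms by (auto simp: filterlim_at elim: eventually_mono)
qed

text \<open>A lower bound on one dyadic block propagates by halving to all larger arguments; every
  doubling beyond \<open>X\<close> then gains a factor \<open>\<rho> > 1\<close>. This gives
  divergence of a regularly varying function of positive index without a representation
  theorem.\<close>

lemma filterlim_at_top_of_doubling:
  fixes h :: "real \<Rightarrow> real"
  assumes "X > 0" "\<rho> > 1" "m > 0"
    and base: "\<And>u. X \<le> u \<Longrightarrow> u \<le> 2 * X \<Longrightarrow> m \<le> h u"
    and dbl: "\<And>u. X \<le> u \<Longrightarrow> \<rho> * h u \<le> h (2 * u)"
  shows "filterlim h at_top at_top"
proof -
  have step: "\<rho> * c \<le> h u" if "c > 0" "c \<le> h (u / 2)" "2 * X \<le> u" for c u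
  proof -
    have "\<rho> * c \<le> \<rho> * h (u / 2)" using that assms by (intro mult_left_mono) auto
    also have "\<dots> \<le> h (2 * (u / 2))" using that by (intro dbl) auto
    finally show ?thesis by simp
  qed
  have "m \<le> h u" if "X \<le> u" "u \<le> 2 ^ k * (2 * X)" for u k
    using that
  proof (induction k arbitrary: u)
    case 0 then show ?case by (auto intro: base)
  next
    case (Suc k)
    show ?case
    proof (cases "u \<le> 2 * X")
      case False
      then have "m \<le> h (u / 2)" using Suc.prems by (intro Suc.IH) auto
      then have "\<rho> * m \<le> h u" using False by (intro step \<open>m > 0\<close>) auto
      moreover have "m \<le> \<rho> * m" using assms by auto
      ultimately show ?thesis by simp
    qed (use Suc.prems base in auto)
  qed
  moreover have "\<exists>k. u \<le> 2 ^ k * (2 * X)" for u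
  proof -
    obtain k where "u / (2 * X) < 2 ^ k" using real_arch_pow[of 2 "u / (2 * X)"] by auto
    then show ?thesis using \<open>X > 0\<close> by (intro exI[of _ k]) (auto simp: field_simps)
  qed
  ultimately have m: "m \<le> h u" if "X \<le> u" for u using that by blast
  have pow: "\<rho> ^ n * m \<le> h u" if "2 ^ n * X \<le> u" for u n
    using that
  proof (induction n arbitrary: u)
    case 0 then show ?case using m by simp
  next
    case (Suc n)
    have "\<rho> * (\<rho> ^ n * m) \<le> h u"
    proof (rule step)
      show "\<rho> ^ n * m \<le> h (u / 2)" using Suc.prems by (intro Suc.IH) auto
      have "2 * X \<le> 2 * (2 ^ n * X)" using \<open>X > 0\<close> by simp
      also have "\<dots> \<le> u" using Suc.prems by simp
      finally show "2 * X \<le> u" .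
    qed (use assms in auto)
    then show ?case by (simp add: mult_ac)
  qed
  show ?thesis
    unfolding filterlim_at_top
  proof
    fix Z :: real
    obtain n where "Z / m < \<rho> ^ n" using real_arch_pow[OF \<open>\<rho> > 1\<close>] by auto
    then have "Z \<le> \<rho> ^ n * m" using \<open>m > 0\<close> by (simp add: field_simps)
    then have "\<forall>u\<ge>2 ^ n * X. Z \<le> h u" using pow[of n] by force
    then show "eventually (\<lambda>u. Z \<le> h u) at_top"
      unfolding eventually_at_top_linorder by blast
  qed
qed

section \<open>Branching and immigration mechanisms\<close>

lemma exp_kernel_bounds:
  fixes y :: real assumes "y \<ge> 0"
  shows "0 \<le> exp (- y) - 1 + y" "exp (- y) - 1 + y \<le> y" "exp (- y) - 1 + y \<le> y\<^sup>2"
    "0 \<le> 1 - exp (- y)" "1 - exp (- y) \<le> y" "y \<le> (1 + y) * (1 - exp (- y))"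
proof -
  have *: "1 + y \<le> exp y" by (rule exp_ge_add_one_self)
  show "0 \<le> exp (- y) - 1 + y" using exp_ge_add_one_self[of "- y"] by simp
  show "exp (- y) - 1 + y \<le> y" "0 \<le> 1 - exp (- y)" using assms by auto
  show "1 - exp (- y) \<le> y" using exp_ge_add_one_self[of "- y"] by simp
  have i: "exp (- y) * (1 + y) \<le> 1"
    using * assms by (simp add: exp_minus field_simps)
  then show "y \<le> (1 + y) * (1 - exp (- y))" by (simp add: algebra_simps)
  \<comment> \<open>The product equals \<open>1 + y ^ 3\<close>.\<close>
  have "1 \<le> (1 - y + y\<^sup>2) * (1 + y)" using assms by (simp add: algebra_simps power2_eq_square)
  then have "exp (- y) * (1 + y) \<le> (1 - y + y\<^sup>2) * (1 + y)" using i by simp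
  then show "exp (- y) - 1 + y \<le> y\<^sup>2" using assms by simp
qed

text \<open>The constant is the value of the kernel at 1; the estimate follows from the tangent of
  exp(-y) at that point.\<close>

lemma exp_kernel_ge:
  fixes y :: real assumes "y \<ge> 1"
  shows "exp (- 1) \<le> exp (- y) - 1 + y"
proof -
  have "exp (- 1) * (1 - (y - 1)) \<le> exp (- 1) * exp (- (y - 1))"
    using exp_ge_add_one_self[of "- (y - 1)"] by (intro mult_left_mono) auto
  also have "\<dots> = exp (- y)" by (simp add: exp_add[symmetric])
  finally have "exp (- 1) - exp (- 1) * (y - 1) \<le> exp (- y)" by (simp add: algebra_simps)
  moreover have "exp (- 1) * (y - 1) \<le> 1 * (y - 1)" using assms by (intro mult_right_mono) auto
  ultimately show ?thesis by simp
qed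

text \<open>The kernels in question have no majorant uniform in all q, so it may depend on a bound
  \<open>Q\<close>; a convergent sequence of parameters is bounded and fits under one such
  \<open>Q\<close>.\<close>

lemma integral_dominated_continuous_on:
  fixes f :: "real \<Rightarrow> 'a \<Rightarrow> real"
  assumes meas: "\<And>q. f q \<in> borel_measurable M"
    and cont: "\<And>u. continuous_on {0..} (\<lambda>q. f q u)"
    and w: "\<And>Q. integrable M (w Q)" "\<And>Q. AE u in M. \<forall>q\<in>{0..Q}. \<bar>f q u\<bar> \<le> w Q u"
  shows "continuous_on {0..} (\<lambda>q. \<integral>u. f q u \<partial>M)"
  unfolding continuous_on_def
proof
  fix q :: real assume q: "q \<in> {0..}"
  show "((\<lambda>q. \<integral>u. f q u \<partial>M) \<longlongrightarrow> (\<integral>u. f q u \<partial>M)) (at q within {0..})"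
    unfolding tendsto_at_iff_sequentially
  proof (intro allI impI)
    fix S :: "nat \<Rightarrow> real" assume S: "\<forall>i. S i \<in> {0..} - {q}" "S \<longlonglongrightarrow> q"
    obtain Q where Q: "\<And>n. norm (S n) \<le> Q"
      using convergent_imp_Bseq[of S] S(2) by (auto simp: Bseq_def convergent_def)
    have "(\<lambda>n. \<integral>u. f (S n) u \<partial>M) \<longlonglongrightarrow> (\<integral>u. f q u \<partial>M)"
    proof (rule integral_dominated_convergence[where w="w Q"])
      show "AE u in M. (\<lambda>n. f (S n) u) \<longlonglongrightarrow> f q u"
        using cont q S
        by (intro AE_I2 continuous_on_tendsto_compose[OF cont S(2)]) auto
      show "AE u in M. norm (f (S n) u) \<le> w Q u" for n
        using w(2)[of Q] by eventually_elim (use S(1) Q[of n] in auto)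
    qed (use meas w in auto)
    then show "((\<lambda>q. \<integral>u. f q u \<partial>M) \<circ> S) \<longlonglongrightarrow> (\<integral>u. f q u \<partial>M)" by (simp add: comp_def)
  qed
qed

section \<open>Branching measure: integrability and the tail representation of its mechanism\<close>

locale branching_measure =
  fixes \<pi> :: "real measure"
  assumes sets_pi[measurable_cong, simp]: "sets \<pi> = sets borel"
    and sigma_finite_pi: "sigma_finite_measure \<pi>"
    and supp_pi: "emeasure \<pi> {..0} = 0"
    and int_pi: "(\<integral>\<^sup>+ z. ennreal (min z (z\<^sup>2)) \<partial>\<pi>) < \<infinity>"
begin

lemma AE_pos: "AE u in \<pi>. u > 0"
  by (rule AE_I[where N="{..0}"]) (auto simp: supp_pi)

lemma integrable_min: "integrable \<pi> (\<lambda>u. min u (u\<^sup>2))"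
proof (rule integrableI_nonneg)
  show "AE u in \<pi>. 0 \<le> min u (u\<^sup>2)" using AE_pos by eventually_elim auto
qed (use int_pi in auto)

definition psi :: "real \<Rightarrow> real" where
  "psi q = (\<integral>u. (exp (- q * u) - 1 + q * u) \<partial>\<pi>)"

definition tail :: "real \<Rightarrow> real" where "tail u = measure \<pi> {u<..}"

lemma kernel_le_min:
  fixes q u :: real
  assumes "0 \<le> q" "0 \<le> u"
  shows "exp (- q * u) - 1 + q * u \<le> max q (q\<^sup>2) * min u (u\<^sup>2)"
proof -
  have "0 \<le> q * u" using assms by (rule mult_nonneg_nonneg)
  note b = exp_kernel_bounds[OF this]
  have "q * u \<le> max q (q\<^sup>2) * u" "(q * u)\<^sup>2 \<le> max q (q\<^sup>2) * u\<^sup>2"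
    using assms by (auto intro!: mult_right_mono simp: power_mult_distrib)
  then have "exp (- (q * u)) - 1 + q * u \<le> max q (q\<^sup>2) * u"
    "exp (- (q * u)) - 1 + q * u \<le> max q (q\<^sup>2) * u\<^sup>2"
    using b(2,3) by linarith+
  then show ?thesis by (simp add: min_def)
qed

lemma integrable_kernel:
  assumes "0 \<le> q"
  shows "integrable \<pi> (\<lambda>u. exp (- q * u) - 1 + q * u)"
proof (rule Bochner_Integration.integrable_bound[OF integrable_mult_right[OF integrable_min, of "max q (q\<^sup>2)"]])
  show "AE u in \<pi>. norm (exp (- q * u) - 1 + q * u) \<le> norm (max q (q\<^sup>2) * min u (u\<^sup>2))"
    using AE_pos
  proof eventually_elim
    case (elim u)
    then show ?case
      using kernel_le_min[OF assms, of u] exp_kernel_bounds(1)[of "q * u"] assms by auto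
  qed
qed auto

text \<open>Source of the linear bound \<open>Ps_le\<close>, since \<open>max q (q\<^sup>2)\<close>
  is at most \<open>max 1 l0 * q\<close> on [0, l0].\<close>

lemma psi_le: "0 \<le> q \<Longrightarrow> psi q \<le> max q (q\<^sup>2) * (\<integral>u. min u (u\<^sup>2) \<partial>\<pi>)"
  unfolding psi_def integral_mult_right_zero[symmetric]
  by (intro integral_mono_AE integrable_kernel integrable_mult_right integrable_min
      eventually_mono[OF AE_pos] kernel_le_min) auto

lemma continuous_psi: "continuous_on {0..} psi"
  unfolding psi_def[abs_def]
proof (rule integral_dominated_continuous_on[where w="\<lambda>Q u. max Q (Q\<^sup>2) * min u (u\<^sup>2)"])
  show "AE u in \<pi>. \<forall>q\<in>{0..Q}. \<bar>exp (- q * u) - 1 + q * u\<bar> \<le> max Q (Q\<^sup>2) * min u (u\<^sup>2)" for Q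
    using AE_pos
  proof eventually_elim
    case (elim u)
    show ?case
    proof
      fix q assume q: "q \<in> {0..Q}"
      have "max q (q\<^sup>2) \<le> max Q (Q\<^sup>2)" using q by (intro max.mono power_mono) auto
      then have "max q (q\<^sup>2) * min u (u\<^sup>2) \<le> max Q (Q\<^sup>2) * min u (u\<^sup>2)"
        using elim by (intro mult_right_mono) auto
      then show "\<bar>exp (- q * u) - 1 + q * u\<bar> \<le> max Q (Q\<^sup>2) * min u (u\<^sup>2)"
        using order_trans[OF kernel_le_min[of q u]] exp_kernel_bounds(1)[of "q * u"] q elim by auto
    qed
  qed
qed (auto intro!: continuous_intros integrable_min)

text \<open>Markov's inequality for the increasing function
  \<open>min z (z\<^sup>2)\<close>.\<close>

lemma tail_finite:
  assumes "u > 0" shows "emeasure \<pi> {u<..} < \<infinity>"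
proof -
  have m: "min u (u\<^sup>2) > 0" using assms by auto
  have "emeasure \<pi> {u<..} = (\<integral>\<^sup>+ z. indicator {u<..} z \<partial>\<pi>)" by simp
  also have "\<dots> \<le> (\<integral>\<^sup>+ z. ennreal (1 / min u (u\<^sup>2)) * ennreal (min z (z\<^sup>2)) \<partial>\<pi>)"
  proof (rule nn_integral_mono)
    fix z
    show "indicator {u<..} z \<le> ennreal (1 / min u (u\<^sup>2)) * ennreal (min z (z\<^sup>2))"
    proof (cases "z > u")
      case True
      then have "min u (u\<^sup>2) \<le> min z (z\<^sup>2)" using assms by (intro min.mono power_mono) auto
      then have "1 \<le> 1 / min u (u\<^sup>2) * min z (z\<^sup>2)" using m by (simp add: pos_le_divide_eq)
      then have "ennreal 1 \<le> ennreal (1 / min u (u\<^sup>2) * min z (z\<^sup>2))" by (rule ennreal_leI)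
      also have "\<dots> = ennreal (1 / min u (u\<^sup>2)) * ennreal (min z (z\<^sup>2))"
        using m by (intro ennreal_mult') auto
      finally show ?thesis using True by simp
    qed simp
  qed
  also have "\<dots> = ennreal (1 / min u (u\<^sup>2)) * (\<integral>\<^sup>+ z. ennreal (min z (z\<^sup>2)) \<partial>\<pi>)"
    by (rule nn_integral_cmult) simp
  also have "\<dots> < \<infinity>" using int_pi by (simp add: ennreal_mult_less_top)
  finally show ?thesis .
qed

lemma emeasure_tail: "u > 0 \<Longrightarrow> emeasure \<pi> {u<..} = ennreal (tail u)"
  unfolding tail_def using tail_finite[of u] by (intro emeasure_eq_ennreal_measure) auto

lemma tail_nonneg: "0 \<le> tail u" by (simp add: tail_def)

lemma tail_antimono: "0 < u \<Longrightarrow> u \<le> w \<Longrightarrow> tail w \<le> tail u"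
  unfolding tail_def using tail_finite[of u] by (intro measure_mono_fmeasurable) (auto simp: fmeasurable_def)

text \<open>Keep only u > 1/q, where q u > 1 and the kernel is at least
  \<open>exp (- 1)\<close>.\<close>

lemma psi_ge_tail:
  assumes "q > 0" shows "exp (- 1) * tail (1 / q) \<le> psi q"
proof -
  have "(\<integral>u. exp (- 1) * indicator {1 / q<..} u \<partial>\<pi>) \<le> psi q"
    unfolding psi_def
  proof (rule integral_mono_AE)
    show "integrable \<pi> (\<lambda>u. exp (- 1) * indicator {1 / q<..} u :: real)"
      using tail_finite[of "1 / q"] assms by (intro integrable_mult_right integrable_real_indicator) auto
    show "AE u in \<pi>. exp (- 1) * indicator {1 / q<..} u \<le> exp (- q * u) - 1 + q * u"
      using AE_pos
    proof eventually_elim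
      case (elim u)
      then show ?case
        using exp_kernel_ge[of "q * u"] exp_kernel_bounds(1)[of "q * u"] assms
        by (auto simp: indicator_def field_simps)
    qed
  qed (use integrable_kernel assms in auto)
  then show ?thesis by (simp add: tail_def)
qed

text \<open>The kernel is the integral of its own derivative. The strict \<open>s < u\<close> makes
  the exchange of integrals produce the mass of \<open>{s<..}\<close>, which is
  \<open>tail s\<close>.\<close>

lemma nn_integral_kernel:
  assumes "q > 0" "u > 0"
  shows "(\<integral>\<^sup>+ s. (if 0 \<le> s \<and> s < u then ennreal (q * (1 - exp (- q * s))) else 0) \<partial>lborel)
    = ennreal (exp (- q * u) - 1 + q * u)"
proof -
  have "(\<integral>\<^sup>+ s. (if 0 \<le> s \<and> s < u then ennreal (q * (1 - exp (- q * s))) else 0) \<partial>lborel)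
      = (\<integral>\<^sup>+ s. ennreal (q * (1 - exp (- q * s))) * indicator {0..u} s \<partial>lborel)"
    using AE_lborel_singleton[of u]
    by (intro nn_integral_cong_AE) (auto elim!: eventually_mono simp: indicator_def)
  also have "\<dots> = ennreal ((exp (- q * u) - 1 + q * u) - (exp (- q * 0) - 1 + q * 0))"
  proof (rule nn_integral_FTC_Icc)
    show "((\<lambda>u. exp (- q * u) - 1 + q * u) has_real_derivative q * (1 - exp (- q * s))) (at s)" for s
      by (auto intro!: derivative_eq_intros simp: algebra_simps)
    show "0 \<le> q * (1 - exp (- q * s))" if "s \<in> {0..u}" for s
      using exp_kernel_bounds(4)[of "q * s"] that assms by simp
  qed (use assms in auto)
  finally show ?thesis by simp
qed

text \<open>Measurability comes from monotonicity. The guard removes s \<le> 0, where the mass of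
  \<open>{s<..}\<close> may be infinite and \<open>measure\<close> would then return 0.\<close>

lemma borel_measurable_tail[measurable]:
  "(\<lambda>s. if 0 < s then tail s else 0) \<in> borel_measurable borel"
proof -
  have "(\<lambda>s. tail s) \<in> borel_measurable (restrict_space borel {0<..})"
  proof -
    have "mono_on {0<..} (\<lambda>s. - tail s)" by (auto simp: mono_on_def intro: tail_antimono)
    from borel_measurable_uminus[OF borel_measurable_mono_on_fnc[OF this]] show ?thesis by simp
  qed
  then show ?thesis
    by (subst (asm) borel_measurable_restrict_space_iff)
       (auto simp: indicator_def of_bool_def if_distrib[of "\<lambda>x. x * _"] cong: if_cong)
qed

text \<open>Integration by parts in the form of Tonelli's theorem; \<sigma>-finiteness of
  \<open>\<pi>\<close> enters here.\<close>

lemma psi_eq_tail: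
  assumes q: "q > 0"
  defines "k \<equiv> \<lambda>s. q * (1 - exp (- q * s)) * (if 0 < s then tail s else 0)"
  shows "integrable lborel k" "psi q = (\<integral>s. k s \<partial>lborel)"
proof -
  interpret P: sigma_finite_measure \<pi> by (rule sigma_finite_pi)
  interpret PL: pair_sigma_finite \<pi> lborel ..
  have k_nonneg: "0 \<le> k s" for s using q tail_nonneg by (auto simp: k_def)
  have [measurable]: "k \<in> borel_measurable borel" unfolding k_def by measurable
  have eq: "(\<integral>\<^sup>+ u. ennreal (exp (- q * u) - 1 + q * u) \<partial>\<pi>) = (\<integral>\<^sup>+ s. ennreal (k s) \<partial>lborel)"
  proof -
    let ?f = "\<lambda>u s. if 0 \<le> s \<and> s < u then ennreal (q * (1 - exp (- q * s))) else 0"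
    have "(\<integral>\<^sup>+ u. ennreal (exp (- q * u) - 1 + q * u) \<partial>\<pi>) = (\<integral>\<^sup>+ u. (\<integral>\<^sup>+ s. ?f u s \<partial>lborel) \<partial>\<pi>)"
      using AE_pos by (intro nn_integral_cong_AE) (auto elim!: eventually_mono simp: nn_integral_kernel q)
    also have "\<dots> = (\<integral>\<^sup>+ s. (\<integral>\<^sup>+ u. ?f u s \<partial>\<pi>) \<partial>lborel)"
      by (rule PL.Fubini'[symmetric]) measurable
    also have "\<dots> = (\<integral>\<^sup>+ s. ennreal (k s) \<partial>lborel)"
    proof (rule nn_integral_cong)
      fix s :: real
      show "(\<integral>\<^sup>+ u. ?f u s \<partial>\<pi>) = ennreal (k s)"
      proof (cases "s > 0")
        case True
        have "(\<integral>\<^sup>+ u. ?f u s \<partial>\<pi>) = (\<integral>\<^sup>+ u. ennreal (q * (1 - exp (- q * s))) * indicator {s<..} u \<partial>\<pi>)"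
          using True by (intro nn_integral_cong) (auto simp: indicator_def)
        also have "\<dots> = ennreal (q * (1 - exp (- q * s))) * ennreal (tail s)"
          using True by (subst nn_integral_cmult_indicator) (auto simp: emeasure_tail)
        also have "\<dots> = ennreal (k s)"
          using True q tail_nonneg by (simp add: k_def ennreal_mult)
        finally show ?thesis .
      next
        case False
        then have "?f u s = 0" for u using q by auto
        then show ?thesis using False by (simp add: k_def)
      qed
    qed
    finally show ?thesis .
  qed
  have nonneg: "AE u in \<pi>. 0 \<le> exp (- q * u) - 1 + q * u"
    using AE_pos by eventually_elim (use q exp_kernel_bounds(1)[of "q * _"] in auto)
  have "(\<integral>\<^sup>+ u. ennreal (exp (- q * u) - 1 + q * u) \<partial>\<pi>) < \<infinity>"
    using integrable_kernel[of q] q nonneg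
    by (subst nn_integral_eq_integral) auto
  then show "integrable lborel k"
    unfolding eq by (intro integrableI_nonneg) (auto simp: k_nonneg)
  show "psi q = (\<integral>s. k s \<partial>lborel)"
    unfolding psi_def
    using integral_eq_nn_integral[OF _ nonneg] integral_eq_nn_integral[of k lborel] eq
    by (simp add: k_nonneg)
qed

text \<open>Substituting s/c moves the factor \<open>c\<close> from the kernel into the tail, so
  \<open>psi (c * q)\<close> and \<open>psi q\<close> share one kernel and can be compared
  pointwise.\<close>

lemma psi_scale:
  assumes q: "q > 0" and c: "c > 0"
  shows "integrable lborel (\<lambda>s. q * (1 - exp (- q * s)) * (if 0 < s then tail (s / c) else 0))"
    "psi (c * q) = (\<integral>s. q * (1 - exp (- q * s)) * (if 0 < s then tail (s / c) else 0) \<partial>lborel)"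
proof -
  let ?k = "\<lambda>s. c * q * (1 - exp (- (c * q) * s)) * (if 0 < s then tail s else 0)"
  have cq: "c * q > 0" using q c by simp
  have eq: "?k (0 + 1 / c * s) = c * (q * (1 - exp (- q * s)) * (if 0 < s then tail (s / c) else 0))" for s
    using c by (simp add: zero_less_divide_iff)
  have "integrable lborel (\<lambda>s. ?k (0 + 1 / c * s))"
    using psi_eq_tail(1)[OF cq] c by (intro lborel_integrable_real_affine) auto
  then show "integrable lborel (\<lambda>s. q * (1 - exp (- q * s)) * (if 0 < s then tail (s / c) else 0))"
    unfolding eq using c integrable_mult_left_iff[of lborel c] by blast
  have "psi (c * q) = (\<integral>s. ?k s \<partial>lborel)" by (rule psi_eq_tail(2)[OF cq])
  also have "\<dots> = \<bar>1 / c\<bar> *\<^sub>R (\<integral>s. ?k (0 + 1 / c * s) \<partial>lborel)"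
    by (rule lborel_integral_real_affine) (use c in auto)
  also have "\<dots> = (\<integral>s. q * (1 - exp (- q * s)) * (if 0 < s then tail (s / c) else 0) \<partial>lborel)"
    unfolding eq using c by (subst integral_mult_right_zero) auto
  finally show "psi (c * q) = (\<integral>s. q * (1 - exp (- q * s)) * (if 0 < s then tail (s / c) else 0) \<partial>lborel)" .
qed

text \<open>Comparing the two integrands pointwise beyond \<open>X\<close>, where the tail is almost homogeneous,
  costs only an error of order \<open>q\<^sup>2\<close>; no uniform convergence theorem is needed.\<close>

lemma psi_scale_approx:
  assumes q: "q > 0" and c: "c > 0" and X: "X > 0" and e: "e \<ge> 0" and d: "d \<ge> 0"
    and approx: "\<And>s. s \<ge> X \<Longrightarrow> \<bar>tail (s / c) - d * tail s\<bar> \<le> e * tail s"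
  shows "\<bar>psi (c * q) - d * psi q\<bar> \<le> e * psi q + (1 + X) * (psi c + d * psi 1) * q\<^sup>2"
proof -
  let ?T = "\<lambda>s. if 0 < s then tail s else 0"
  let ?Tc = "\<lambda>s. if 0 < s then tail (s / c) else 0"
  let ?k = "\<lambda>q s. q * (1 - exp (- q * s))"
  note i1 = psi_eq_tail[OF q] and i2 = psi_scale[OF q c]
  note i3 = psi_eq_tail[OF zero_less_one] and i4 = psi_scale[OF zero_less_one c]
  have "\<bar>psi (c * q) - d * psi q\<bar> = \<bar>\<integral>s. ?k q s * ?Tc s - d * (?k q s * ?T s) \<partial>lborel\<bar>"
    using i1 i2 by (subst Bochner_Integration.integral_diff) auto
  also have "\<dots> \<le> (\<integral>s. e * (?k q s * ?T s) + (1 + X) * q\<^sup>2 * (?k 1 s * ?Tc s + d * (?k 1 s * ?T s)) \<partial>lborel)"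
  proof (rule order_trans[OF integral_abs_bound], rule integral_mono)
    fix s :: real
    show "\<bar>?k q s * ?Tc s - d * (?k q s * ?T s)\<bar>
        \<le> e * (?k q s * ?T s) + (1 + X) * q\<^sup>2 * (?k 1 s * ?Tc s + d * (?k 1 s * ?T s))"
    proof (cases "s > 0")
      case True
      define D where "D = tail (s / c) - d * tail s"
      define S where "S = tail (s / c) + d * tail s"
      have S: "\<bar>D\<bar> \<le> S" "0 \<le> S" using tail_nonneg d by (auto simp: D_def S_def abs_le_iff)
      have qs: "0 \<le> q * s" using q True by simp
      have kq: "0 \<le> ?k q s" using exp_kernel_bounds(4)[OF qs] q by simp
      have k1: "0 \<le> ?k 1 s" using True by simp
      have "?k q s * \<bar>D\<bar> \<le> e * (?k q s * tail s) + (1 + X) * q\<^sup>2 * (?k 1 s * S)"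
      proof (cases "s \<ge> X")
        case True
        have "?k q s * \<bar>D\<bar> \<le> ?k q s * (e * tail s)"
          using approx[OF True] kq by (intro mult_left_mono) (auto simp: D_def)
        moreover have "0 \<le> (1 + X) * q\<^sup>2 * (?k 1 s * S)"
          using X k1 S(2) by (intro mult_nonneg_nonneg) auto
        ultimately show ?thesis by (simp add: mult_ac)
      next
        case False
        \<comment> \<open>Below \<open>X\<close> nothing is known about the tail ratio. There the
          kernel at q is at most q^2 s, which is at most q^2 (1 + X) times the kernel at 1; that one
          is integrable against both tails by \<open>i3\<close> and \<open>i4\<close>.\<close>
        have "s \<le> (1 + s) * (1 - exp (- s))" using exp_kernel_bounds(6)[of s] \<open>s > 0\<close> by simp
        also have "\<dots> \<le> (1 + X) * (1 - exp (- s))"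
          using False \<open>s > 0\<close> by (intro mult_right_mono) auto
        finally have "q\<^sup>2 * s \<le> q\<^sup>2 * ((1 + X) * ?k 1 s)" by (intro mult_left_mono) auto
        moreover have "?k q s \<le> q\<^sup>2 * s"
          using exp_kernel_bounds(5)[OF qs] q by (simp add: power2_eq_square mult.assoc)
        ultimately have "?k q s \<le> q\<^sup>2 * ((1 + X) * ?k 1 s)" by simp
        then have "?k q s * \<bar>D\<bar> \<le> (q\<^sup>2 * ((1 + X) * ?k 1 s)) * S"
          by (rule mult_mono) (use S kq X k1 in auto)
        moreover have "0 \<le> e * (?k q s * tail s)"
          by (rule mult_nonneg_nonneg[OF e mult_nonneg_nonneg[OF kq tail_nonneg]])
        ultimately show ?thesis by (simp add: mult_ac)
      qed
      moreover have "\<bar>?k q s * ?Tc s - d * (?k q s * ?T s)\<bar> = ?k q s * \<bar>D\<bar>"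
      proof -
        have "?k q s * ?Tc s - d * (?k q s * ?T s) = ?k q s * D"
          using True by (simp add: D_def algebra_simps)
        then show ?thesis using abs_mult[of "?k q s" D] abs_of_nonneg[OF kq] by simp
      qed
      ultimately show ?thesis using True by (simp add: S_def algebra_simps)
    qed simp
  next
    show "integrable lborel (\<lambda>s. \<bar>?k q s * ?Tc s - d * (?k q s * ?T s)\<bar>)"
      using i1(1) i2(1) by (intro Bochner_Integration.integrable_abs Bochner_Integration.integrable_diff
          integrable_mult_right) auto
    show "integrable lborel (\<lambda>s. e * (?k q s * ?T s) + (1 + X) * q\<^sup>2 * (?k 1 s * ?Tc s + d * (?k 1 s * ?T s)))"
      using i1(1) i3(1) i4(1)
      by (intro Bochner_Integration.integrable_add integrable_mult_right) auto
  qed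
  also have "\<dots> = e * psi q + (1 + X) * q\<^sup>2 * (psi c + d * psi 1)"
  proof -
    have "(\<integral>s. e * (?k q s * ?T s) + (1 + X) * q\<^sup>2 * (?k 1 s * ?Tc s + d * (?k 1 s * ?T s)) \<partial>lborel)
        = e * (\<integral>s. ?k q s * ?T s \<partial>lborel) + (1 + X) * q\<^sup>2 *
            ((\<integral>s. ?k 1 s * ?Tc s \<partial>lborel) + d * (\<integral>s. ?k 1 s * ?T s \<partial>lborel))"
      using i1(1) i3(1) i4(1)
      by (simp only: Bochner_Integration.integral_add integral_mult_right_zero
          integrable_mult_right Bochner_Integration.integrable_add)
    then show ?thesis unfolding i1(2)[symmetric] i3(2)[symmetric] i4(2)[symmetric] by simp
  qed
  finally show ?thesis by (simp add: mult_ac)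
qed

end

section \<open>Regular variation of the branching mechanism at 0\<close>

text \<open>Passes from the asymptotic equivalence to a ratio limit, in which \<open>K\<close>
  cancels. The ratio limit and eventual positivity are the form in which the tail hypothesis enters
  \<open>stable_tail\<close>.\<close>

lemma tendsto_ratio_of_equivalent_powr_slowly_varying:
  fixes f :: "real \<Rightarrow> real"
  assumes equiv: "f \<sim>[at_top] (\<lambda>u. K * u powr \<rho> * l u)" and K: "K > 0" and l: "slowly_varying l"
    and c: "c > 0"
  shows "((\<lambda>u. f (c * u) / f u) \<longlongrightarrow> c powr \<rho>) at_top" "eventually (\<lambda>u. f u > 0) at_top"
proof -
  define g where "g u = K * u powr \<rho> * l u" for u
  have lpos: "eventually (\<lambda>u. l u > 0) at_top" using l by (simp add: slowly_varying_def)
  have gpos: "eventually (\<lambda>u. g u > 0) at_top"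
    using lpos eventually_gt_at_top[of 0] by eventually_elim (use K in \<open>simp add: g_def\<close>)
  have fg: "((\<lambda>u. f u / g u) \<longlongrightarrow> 1) at_top"
    using equiv gpos unfolding g_def[symmetric]
    by (intro asymp_equivD_strong) (auto elim!: eventually_mono)
  have top: "filterlim (\<lambda>u. c * u) at_top at_top"
    using c by (intro filterlim_tendsto_pos_mult_at_top[OF tendsto_const] filterlim_ident) auto
  show fpos: "eventually (\<lambda>u. f u > 0) at_top"
    using order_tendstoD(1)[OF fg zero_less_one] gpos
    by eventually_elim (auto simp: zero_less_divide_iff)
  have "((\<lambda>u. (f (c * u) / g (c * u)) / (f u / g u) * (c powr \<rho> * (l (c * u) / l u))) \<longlongrightarrow> 1 / 1 * (c powr \<rho> * 1)) at_top"
    using l c by (intro tendsto_intros filterlim_compose[OF fg top] fg) (auto simp: slowly_varying_def)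
  moreover have "eventually (\<lambda>u. (f (c * u) / g (c * u)) / (f u / g u) * (c powr \<rho> * (l (c * u) / l u))
      = f (c * u) / f u) at_top"
    using gpos fpos lpos eventually_compose_filterlim[OF gpos top] eventually_compose_filterlim[OF lpos top]
      eventually_gt_at_top[of 0]
  proof eventually_elim
    case (elim u)
    have "g (c * u) = c powr \<rho> * (l (c * u) / l u) * g u"
      using elim c by (simp add: g_def powr_mult)
    then show ?case using elim c by (simp add: field_simps)
  qed
  ultimately show "((\<lambda>u. f (c * u) / f u) \<longlongrightarrow> c powr \<rho>) at_top"
    by (auto intro: Lim_transform_eventually)
qed

locale stable_tail = branching_measure +
  fixes \<alpha> :: real
  assumes \<alpha>: "0 < \<alpha>" "\<alpha> < 1"
    and tail_ratio: "\<And>c. c > 0 \<Longrightarrow> ((\<lambda>u. tail (c * u) / tail u) \<longlongrightarrow> c powr (- 1 - \<alpha>)) at_top"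
    and tail_ev_pos: "eventually (\<lambda>u. tail u > 0) at_top"
begin

lemma tail_pos: "u > 0 \<Longrightarrow> tail u > 0"
proof -
  assume "u > 0"
  obtain w where "w \<ge> u" "tail w > 0"
    using eventually_happens[OF eventually_conj[OF eventually_ge_at_top[of u] tail_ev_pos]] by auto
  then show "tail u > 0" using tail_antimono[OF \<open>u > 0\<close>, of w] by simp
qed

lemma psi_pos: "q > 0 \<Longrightarrow> psi q > 0"
  using psi_ge_tail[of q] tail_pos[of "1 / q"] by (auto intro: less_le_trans[rotated])

text \<open>Doubling u multiplies the function asymptotically by 4 * 2^(-1-\<alpha>) =
  2^(1-\<alpha>), which exceeds 1 because \<alpha> < 1; \<open>\<rho>\<close> is the square root of
  this factor, leaving room for the limit.\<close>

lemma square_tail_at_top: "filterlim (\<lambda>u. u\<^sup>2 * tail u) at_top at_top"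
proof -
  define \<rho> :: real where "\<rho> = 2 powr ((1 - \<alpha>) / 2)"
  have \<rho>: "\<rho> > 1" using \<alpha> powr_less_mono[of 0 "(1 - \<alpha>) / 2" 2] by (simp add: \<rho>_def)
  have "\<rho> < 2 powr (1 - \<alpha>)" using \<alpha> unfolding \<rho>_def by (intro powr_less_mono) auto
  moreover have "(2::real) powr (1 - \<alpha>) = 4 * 2 powr (- 1 - \<alpha>)"
  proof -
    have "(2::real) powr (1 - \<alpha>) = 2 powr (2 + (- 1 - \<alpha>))" by simp
    also have "\<dots> = 2 powr 2 * 2 powr (- 1 - \<alpha>)" by (rule powr_add)
    finally show ?thesis by simp
  qed
  ultimately have "\<rho> / 4 < 2 powr (- 1 - \<alpha>)" by simp
  then have "eventually (\<lambda>u. \<rho> / 4 < tail (2 * u) / tail u) at_top"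
    by (intro order_tendstoD(1)[OF tail_ratio[of 2]]) auto
  then obtain X0 where X0: "\<And>u. u \<ge> X0 \<Longrightarrow> \<rho> / 4 < tail (2 * u) / tail u"
    by (auto simp: eventually_at_top_linorder)
  define X where "X = max X0 1"
  have X: "X > 0" by (simp add: X_def)
  show ?thesis
  proof (rule filterlim_at_top_of_doubling[OF X \<rho>, of "X\<^sup>2 * tail (2 * X)"])
    show "0 < X\<^sup>2 * tail (2 * X)" using X tail_pos[of "2 * X"] by simp
    show "X\<^sup>2 * tail (2 * X) \<le> u\<^sup>2 * tail u" if "X \<le> u" "u \<le> 2 * X" for u
      using that X tail_nonneg by (intro mult_mono tail_antimono power_mono) auto
    show "\<rho> * (u\<^sup>2 * tail u) \<le> (2 * u)\<^sup>2 * tail (2 * u)" if "X \<le> u" for u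
    proof -
      have "\<rho> / 4 < tail (2 * u) / tail u" using that by (intro X0) (simp add: X_def)
      moreover have "tail u > 0" using that X by (intro tail_pos) auto
      ultimately have "\<rho> * tail u \<le> 4 * tail (2 * u)" by (simp add: field_simps)
      then have "u\<^sup>2 * (\<rho> * tail u) \<le> u\<^sup>2 * (4 * tail (2 * u))" by (intro mult_left_mono) auto
      then show ?thesis by (simp add: power_mult_distrib mult_ac)
    qed
  qed
qed

text \<open>Makes negligible both the Gaussian part of the mechanism and the quadratic error in
  \<open>psi_scale_approx\<close>. It follows from \<open>psi_ge_tail\<close> and
  \<open>square_tail_at_top\<close> at u = 1/q.\<close>

lemma square_over_psi: "((\<lambda>q. q\<^sup>2 / psi q) \<longlongrightarrow> 0) (at_right 0)"
proof (rule tendsto_sandwich[OF _ _ tendsto_const])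
  have "((\<lambda>u. exp 1 / (u\<^sup>2 * tail u)) \<longlongrightarrow> 0) at_top"
    by (intro real_tendsto_divide_at_top[OF tendsto_const] square_tail_at_top)
  from filterlim_compose[OF this filterlim_inverse_at_top_right]
  show "((\<lambda>q. exp 1 / ((inverse q)\<^sup>2 * tail (inverse q))) \<longlongrightarrow> 0) (at_right 0)" .
  show "eventually (\<lambda>q. 0 \<le> q\<^sup>2 / psi q) (at_right 0)"
    using eventually_at_right_less[of 0] by eventually_elim (use psi_pos in \<open>simp add: less_imp_le\<close>)
  show "eventually (\<lambda>q. q\<^sup>2 / psi q \<le> exp 1 / ((inverse q)\<^sup>2 * tail (inverse q))) (at_right 0)"
    using eventually_at_right_less[of 0]
  proof eventually_elim
    case (elim q)
    have t: "tail (inverse q) > 0" using elim by (intro tail_pos) auto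
    have "q\<^sup>2 / psi q \<le> q\<^sup>2 / (exp (- 1) * tail (1 / q))"
      using psi_ge_tail[OF elim] t psi_pos[OF elim] elim by (intro divide_left_mono) (auto simp: inverse_eq_divide)
    also have "\<dots> = exp 1 / ((inverse q)\<^sup>2 * tail (inverse q))"
      using elim t by (simp add: exp_minus field_simps)
    finally show ?case .
  qed
qed

text \<open>The factor \<open>d\<close> is the limit of tail(u/c)/tail(u). The relative error of the
  tails beyond \<open>X\<close> takes half of \<open>e\<close>, and all terms of order q^2 take the
  other half.\<close>

lemma Psi_regularly_varying:
  assumes c: "c > 0"
  shows "((\<lambda>q. Psi 0 \<sigma> \<pi> (c * q) / Psi 0 \<sigma> \<pi> q) \<longlongrightarrow> c powr (1 + \<alpha>)) (at_right 0)"
proof (rule tendstoI)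
  fix e :: real assume e: "e > 0"
  define d where "d = c powr (1 + \<alpha>)"
  define a where "a = \<sigma>\<^sup>2 / 2"
  have a: "a \<ge> 0" by (simp add: a_def)
  have Psi: "Psi 0 \<sigma> \<pi> q = a * q\<^sup>2 + psi q" for q by (simp add: Psi_def psi_def a_def)
  have d: "d > 0" using c by (simp add: d_def)
  have "((\<lambda>u. tail (1 / c * u) / tail u) \<longlongrightarrow> (1 / c) powr (- 1 - \<alpha>)) at_top"
    using c by (intro tail_ratio) auto
  also have "(1 / c) powr (- 1 - \<alpha>) = d" using c
    by (simp add: d_def powr_divide powr_minus_divide[symmetric] add.commute)
  finally have "eventually (\<lambda>u. dist (tail (1 / c * u) / tail u) d < e / 2) at_top"
    using e by (intro tendstoD) auto
  then obtain X0 where X0: "\<And>u. u \<ge> X0 \<Longrightarrow> \<bar>tail (u / c) / tail u - d\<bar> < e / 2"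
    by (auto simp: eventually_at_top_linorder dist_real_def)
  define X where "X = max X0 1"
  have X: "X > 0" by (simp add: X_def)
  have approx: "\<bar>tail (s / c) - d * tail s\<bar> \<le> e / 2 * tail s" if "s \<ge> X" for s
  proof -
    have t: "tail s > 0" using that X by (intro tail_pos) auto
    have "tail (s / c) - d * tail s = (tail (s / c) / tail s - d) * tail s"
      using t by (simp add: field_simps)
    then have "\<bar>tail (s / c) - d * tail s\<bar> = \<bar>tail (s / c) / tail s - d\<bar> * tail s"
      using t by (simp add: abs_mult)
    also have "\<dots> \<le> e / 2 * tail s"
      using X0[of s] that t by (intro mult_right_mono) (auto simp: X_def)
    finally show ?thesis .
  qed
  \<comment> \<open>\<open>K\<close> collects the coefficients of q^2: the error from below
    \<open>X\<close> and the failure of the Gaussian term to scale by \<open>d\<close>.\<close>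
  define K where "K = (1 + X) * (psi c + d * psi 1) + \<bar>a * c\<^sup>2 - d * a\<bar>"
  have "((\<lambda>q. K * (q\<^sup>2 / psi q)) \<longlongrightarrow> K * 0) (at_right 0)" by (intro tendsto_intros square_over_psi)
  then have "eventually (\<lambda>q. K * (q\<^sup>2 / psi q) < e / 2) (at_right 0)"
    using e by (intro order_tendstoD(2)[where a="e / 2"]) auto
  then show "eventually (\<lambda>q. dist (Psi 0 \<sigma> \<pi> (c * q) / Psi 0 \<sigma> \<pi> q) (c powr (1 + \<alpha>)) < e) (at_right 0)"
    using eventually_at_right_less[of 0]
  proof eventually_elim
    case (elim q)
    have p: "psi q > 0" using elim by (intro psi_pos) auto
    have Pp: "Psi 0 \<sigma> \<pi> q \<ge> psi q" using a by (simp add: Psi)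
    have "Psi 0 \<sigma> \<pi> (c * q) - d * Psi 0 \<sigma> \<pi> q = (psi (c * q) - d * psi q) + (a * c\<^sup>2 - d * a) * q\<^sup>2"
      by (simp add: Psi algebra_simps power_mult_distrib)
    also have "\<bar>\<dots>\<bar> \<le> \<bar>psi (c * q) - d * psi q\<bar> + \<bar>a * c\<^sup>2 - d * a\<bar> * q\<^sup>2"
      by (rule order_trans[OF abs_triangle_ineq]) (simp add: abs_mult)
    also have "\<dots> \<le> e / 2 * psi q + K * q\<^sup>2"
      using psi_scale_approx[OF elim(2) c X _ _ approx] e d by (simp add: K_def algebra_simps)
    also have "\<dots> < e * psi q" using elim(1) p by (simp add: field_simps)
    also have "\<dots> \<le> e * Psi 0 \<sigma> \<pi> q" using Pp e by (intro mult_left_mono) auto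
    finally have *: "\<bar>Psi 0 \<sigma> \<pi> (c * q) - d * Psi 0 \<sigma> \<pi> q\<bar> < e * Psi 0 \<sigma> \<pi> q" .
    have "Psi 0 \<sigma> \<pi> (c * q) / Psi 0 \<sigma> \<pi> q - d = (Psi 0 \<sigma> \<pi> (c * q) - d * Psi 0 \<sigma> \<pi> q) / Psi 0 \<sigma> \<pi> q"
      using p Pp by (simp add: field_simps)
    then have "\<bar>Psi 0 \<sigma> \<pi> (c * q) / Psi 0 \<sigma> \<pi> q - d\<bar> < e"
      using * p Pp by (simp add: abs_divide pos_divide_less_eq)
    then show ?case by (simp add: dist_real_def d_def)
  qed
qed

end

section \<open>Immigration mechanism: continuity and strict monotonicity\<close>

locale immigration_measure =
  fixes \<beta> :: real and \<nu> :: "real measure"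
  assumes \<beta>: "\<beta> \<ge> 0"
    and sets_nu[measurable_cong, simp]: "sets \<nu> = sets borel"
    and supp_nu: "emeasure \<nu> {..0} = 0"
    and int_nu: "(\<integral>\<^sup>+ z. ennreal (min 1 z) \<partial>\<nu>) < \<infinity>"
    and Phi_pos: "\<And>q. q > 0 \<Longrightarrow> Phi \<beta> \<nu> q > 0"
begin

lemma AE_pos: "AE u in \<nu>. u > 0"
  by (rule AE_I[where N="{..0}"]) (auto simp: supp_nu)

lemma integrable_min: "integrable \<nu> (\<lambda>u. min 1 u)"
proof (rule integrableI_nonneg)
  show "AE u in \<nu>. 0 \<le> min 1 u" using AE_pos by eventually_elim auto
qed (use int_nu in auto)

lemma kernel_le_min:
  fixes q u :: real
  assumes "0 \<le> q" "q \<le> Q" "0 \<le> u"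
  shows "\<bar>1 - exp (- q * u)\<bar> \<le> max 1 Q * min 1 u"
proof -
  have "0 \<le> q * u" using assms by (intro mult_nonneg_nonneg)
  note b = exp_kernel_bounds(4,5)[OF this]
  have "q * u \<le> max 1 Q * u" using assms by (intro mult_right_mono) auto
  moreover have "1 - exp (- q * u) \<le> max 1 Q * 1" by (simp add: le_max_iff_disj)
  ultimately show ?thesis using b by (auto simp: min_def)
qed

lemma integrable_kernel:
  assumes "0 \<le> q" shows "integrable \<nu> (\<lambda>u. 1 - exp (- q * u))"
proof (rule Bochner_Integration.integrable_bound[OF integrable_mult_right[OF integrable_min, of "max 1 q"]])
  show "AE u in \<nu>. norm (1 - exp (- q * u)) \<le> norm (max 1 q * min 1 u)"
    using AE_pos
  proof eventually_elim
    case (elim u)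
    have "0 \<le> max 1 q * min 1 u" using elim by (intro mult_nonneg_nonneg) auto
    then show ?case using kernel_le_min[OF assms order_refl, of u] elim by simp
  qed
qed auto

lemma continuous_Phi: "continuous_on {0..} (Phi \<beta> \<nu>)"
proof -
  have "continuous_on {0..} (\<lambda>q. \<integral>u. (1 - exp (- q * u)) \<partial>\<nu>)"
  proof (rule integral_dominated_continuous_on[where w="\<lambda>Q u. max 1 Q * min 1 u"])
    show "AE u in \<nu>. \<forall>q\<in>{0..Q}. \<bar>1 - exp (- q * u)\<bar> \<le> max 1 Q * min 1 u" for Q
      using AE_pos by eventually_elim (use kernel_le_min in auto)
  qed (auto intro!: continuous_intros integrable_min)
  then show ?thesis unfolding Phi_def[abs_def] by (intro continuous_intros)
qed

lemma Phi_zero: "Phi \<beta> \<nu> 0 = 0"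
  by (simp add: Phi_def)

text \<open>Equality would kill the drift and make a strictly positive integrand vanish almost
  everywhere, so \<open>\<nu>\<close> would be null and \<Phi> identically 0, against
  \<open>Phi_pos\<close>.\<close>

lemma Phi_strict_mono:
  assumes "0 \<le> p" "p < q" shows "Phi \<beta> \<nu> p < Phi \<beta> \<nu> q"
proof -
  let ?d = "\<lambda>u. (1 - exp (- q * u)) - (1 - exp (- p * u))"
  have int: "integrable \<nu> ?d"
    using assms by (intro Bochner_Integration.integrable_diff integrable_kernel) auto
  have diff: "Phi \<beta> \<nu> q - Phi \<beta> \<nu> p = \<beta> * (q - p) + (\<integral>u. ?d u \<partial>\<nu>)"
    unfolding Phi_def using assms
    by (subst Bochner_Integration.integral_diff[OF integrable_kernel integrable_kernel]) (auto simp: right_diff_distrib)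
  have nonneg: "AE u in \<nu>. 0 \<le> ?d u"
    using AE_pos by eventually_elim (use assms in auto)
  have ge: "0 \<le> (\<integral>u. ?d u \<partial>\<nu>)" by (rule integral_nonneg_AE[OF nonneg])
  have "0 \<noteq> Phi \<beta> \<nu> q - Phi \<beta> \<nu> p"
  proof
    assume "0 = Phi \<beta> \<nu> q - Phi \<beta> \<nu> p"
    moreover have "0 \<le> \<beta> * (q - p)" using \<beta> assms by simp
    ultimately have z: "\<beta> * (q - p) = 0" "(\<integral>u. ?d u \<partial>\<nu>) = 0" using diff ge by linarith+
    have "AE u in \<nu>. ?d u = 0"
      using z(2) integral_nonneg_eq_0_iff_AE[OF int nonneg] by simp
    \<comment> \<open>For u > 0 the difference \<open>?d u\<close> is strictly positive, so its
      vanishing almost everywhere means that \<open>\<nu>\<close> is the zero measure.\<close>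
    then have "AE u in \<nu>. False"
      using AE_pos by eventually_elim (use assms in auto)
    then have "AE u in \<nu>. 1 - exp (- 1 * u) = 0" by eventually_elim simp
    then have "(\<integral>u. 1 - exp (- 1 * u) \<partial>\<nu>) = 0"
      by (rule integral_eq_zero_AE)
    then have "Phi \<beta> \<nu> 1 = 0" using z(1) assms by (simp add: Phi_def)
    then show False using Phi_pos[of 1] by simp
  qed
  moreover have "0 \<le> Phi \<beta> \<nu> q - Phi \<beta> \<nu> p" using diff ge \<beta> assms by simp
  ultimately show ?thesis by simp
qed

end

section \<open>The flow and the function H\<close>

text \<open>A single antiderivative on the whole half-line turns integrals with moving end points,
  on either side of \<open>l0\<close> or 1, into differences.\<close>

lemma real_antiderivative_pos:
  fixes f :: "real \<Rightarrow> real"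
  assumes "continuous_on {0<..} f"
  obtains F where "\<And>x. x > 0 \<Longrightarrow> (F has_real_derivative f x) (at x)"
    "\<And>a b. 0 < a \<Longrightarrow> a \<le> b \<Longrightarrow> integral {a..b} f = F b - F a"
proof -
  have "isCont f x" if "x > 0" for x
    using assms that by (auto simp: continuous_on_eq_continuous_at)
  then have "\<exists>F. \<forall>x :: real. ereal 0 < ereal x \<longrightarrow> ereal x < \<infinity> \<longrightarrow> (F has_vector_derivative f x) (at x)"
    by (intro einterval_antiderivative) auto
  then obtain F where F: "\<And>x. x > 0 \<Longrightarrow> (F has_vector_derivative f x) (at x)" by auto
  show ?thesis
  proof
    show "(F has_real_derivative f x) (at x)" if "x > 0" for x
      using F[OF that] by (simp add: has_real_derivative_iff_has_vector_derivative)
    show "integral {a..b} f = F b - F a" if "0 < a" "a \<le> b" for a b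
      by (rule integral_unique, rule fundamental_theorem_of_calculus)
         (use that F in \<open>auto intro: has_vector_derivative_at_within\<close>)
  qed
qed

text \<open>Isolates the analytic facts about \<Psi> and \<Phi> on which the limit laws rest. The
  linear bound \<open>Ps_le\<close> serves twice: it makes \<open>varphi\<close> diverge at 0, and
  it keeps the flow from reaching 0 in finite time.\<close>

locale cbi_mechanisms =
  fixes Ps Ph :: "real \<Rightarrow> real" and l0 \<alpha> C :: real
  assumes l0: "l0 > 0" and \<alpha>: "\<alpha> > 0"
    and Ps_cont: "continuous_on {0<..} Ps"
    and Ps_pos: "\<And>u. u > 0 \<Longrightarrow> Ps u > 0"
    and Ps_zero: "Ps 0 = 0"
    and Ps_le: "\<And>u. 0 \<le> u \<Longrightarrow> u \<le> l0 \<Longrightarrow> Ps u \<le> C * u"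
    and Ps_rv: "\<And>c. c > 0 \<Longrightarrow> ((\<lambda>q. Ps (c * q) / Ps q) \<longlongrightarrow> c powr (1 + \<alpha>)) (at_right 0)"
    and Ph_cont: "continuous_on {0..} Ph"
    and Ph_zero: "Ph 0 = 0"
    and Ph_strict: "\<And>p q. 0 \<le> p \<Longrightarrow> p < q \<Longrightarrow> Ph p < Ph q"
begin

abbreviation "\<phi> \<equiv> varphi Ps l0"
abbreviation "g \<equiv> ginv Ps l0"
abbreviation "H \<equiv> Hfun Ps Ph l0"

lemma Ph_pos: "q > 0 \<Longrightarrow> Ph q > 0"
  using Ph_strict[of 0 q] Ph_zero by simp

lemma Ph_mono: "0 \<le> p \<Longrightarrow> p \<le> q \<Longrightarrow> Ph p \<le> Ph q"
  using Ph_strict[of p q] by (cases "p = q") auto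

lemma C_pos: "C > 0"
proof -
  have "0 < C * l0" using Ps_le[of l0] Ps_pos[of l0] l0 by simp
  then show ?thesis using l0 by (simp add: zero_less_mult_iff)
qed

lemma varphi_eq:
  obtains F where "\<And>u. u > 0 \<Longrightarrow> (F has_real_derivative 1 / Ps u) (at u)"
    "\<And>u. 0 < u \<Longrightarrow> u \<le> l0 \<Longrightarrow> \<phi> u = F l0 - F u"
proof -
  have "continuous_on {0<..} (\<lambda>u. 1 / \<bar>Ps u\<bar>)"
    using Ps_pos by (intro continuous_intros Ps_cont) (fastforce simp: less_imp_neq)
  then obtain F where F: "\<And>x. x > 0 \<Longrightarrow> (F has_real_derivative 1 / \<bar>Ps x\<bar>) (at x)"
    "\<And>a b. 0 < a \<Longrightarrow> a \<le> b \<Longrightarrow> integral {a..b} (\<lambda>u. 1 / \<bar>Ps u\<bar>) = F b - F a"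
    using real_antiderivative_pos by blast
  show ?thesis
  proof (rule that[of F])
    show "(F has_real_derivative 1 / Ps u) (at u)" if "u > 0" for u
      using F(1)[OF that] Ps_pos[OF that] by simp
    show "\<phi> u = F l0 - F u" if "0 < u" "u \<le> l0" for u
      using F(2)[OF that] by (simp add: varphi_def)
  qed
qed

lemma varphi_deriv:
  assumes "0 < u" "u < l0" shows "(\<phi> has_real_derivative - 1 / Ps u) (at u)"
proof (rule varphi_eq)
  fix F assume F: "\<And>u. u > 0 \<Longrightarrow> (F has_real_derivative 1 / Ps u) (at u)"
    "\<And>u. 0 < u \<Longrightarrow> u \<le> l0 \<Longrightarrow> \<phi> u = F l0 - F u"
  have "((\<lambda>u. F l0 - F u) has_real_derivative 0 - 1 / Ps u) (at u)"
    by (intro derivative_intros F assms)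
  then have "((\<lambda>u. F l0 - F u) has_real_derivative - 1 / Ps u) (at u)" by simp
  then show ?thesis
    by (rule has_field_derivative_transform_within_open[where S="{0<..<l0}"]) (use assms F(2) in auto)
qed

lemma varphi_isCont: "0 < u \<Longrightarrow> u < l0 \<Longrightarrow> isCont \<phi> u"
  using varphi_deriv DERIV_isCont by blast

lemma varphi_strict_antimono:
  assumes "0 < u" "u < w" "w \<le> l0" shows "\<phi> w < \<phi> u"
proof (rule varphi_eq)
  fix F assume F: "\<And>u. u > 0 \<Longrightarrow> (F has_real_derivative 1 / Ps u) (at u)"
    "\<And>u. 0 < u \<Longrightarrow> u \<le> l0 \<Longrightarrow> \<phi> u = F l0 - F u"
  have "F u < F w"
  proof (rule DERIV_pos_imp_increasing[OF assms(2)])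
    fix y assume "u \<le> y" "y \<le> w"
    then show "\<exists>D. (F has_real_derivative D) (at y) \<and> 0 < D"
      using F(1)[of y] Ps_pos[of y] assms(1) by (intro exI[of _ "1 / Ps y"]) auto
  qed
  then show ?thesis using F(2) assms by simp
qed

lemma varphi_l0: "\<phi> l0 = 0"
  by (simp add: varphi_def)

lemma varphi_pos: "0 < u \<Longrightarrow> u < l0 \<Longrightarrow> \<phi> u > 0"
  using varphi_strict_antimono[of u l0] varphi_l0 by simp

lemma eventually_Ioo_l0: "eventually (\<lambda>u. 0 < u \<and> u < l0) (at_right 0)"
  using l0 by (intro eventually_at_rightI[of 0 l0]) auto

text \<open>Comparison with the linear case: 1/\<Psi>(u) \<ge> 1/(C u) integrates to a
  logarithm.\<close>

lemma varphi_at_top: "filterlim \<phi> at_top (at_right 0)"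
proof (rule filterlim_at_top_mono)
  have "filterlim (\<lambda>u. - ln u) at_top (at_right (0::real))"
    using ln_at_0 by (simp add: filterlim_uminus_at_top)
  then have "filterlim (\<lambda>u. ln l0 + - ln u) at_top (at_right 0)"
    by (rule filterlim_tendsto_add_at_top[OF tendsto_const])
  then show "filterlim (\<lambda>u. 1 / C * (ln l0 + - ln u)) at_top (at_right 0)"
    using C_pos by (intro filterlim_tendsto_pos_mult_at_top[OF tendsto_const]) auto
  show "eventually (\<lambda>u. 1 / C * (ln l0 + - ln u) \<le> \<phi> u) (at_right 0)"
    using eventually_Ioo_l0
  proof eventually_elim
    case (elim u)
    show ?case
    proof (rule varphi_eq)
      fix F assume F: "\<And>u. u > 0 \<Longrightarrow> (F has_real_derivative 1 / Ps u) (at u)"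
        "\<And>u. 0 < u \<Longrightarrow> u \<le> l0 \<Longrightarrow> \<phi> u = F l0 - F u"
      have "F u - 1 / C * ln u \<le> F l0 - 1 / C * ln l0"
      proof (rule DERIV_nonneg_imp_nondecreasing[of u l0 "\<lambda>w. F w - 1 / C * ln w"])
        fix w assume w: "u \<le> w" "w \<le> l0"
        have "w > 0" using w elim by simp
        have "((\<lambda>w. F w - 1 / C * ln w) has_real_derivative 1 / Ps w - 1 / C * (1 / w)) (at w)"
          using \<open>w > 0\<close> C_pos by (auto intro!: derivative_eq_intros F(1))
        moreover have "1 / C * (1 / w) \<le> 1 / Ps w"
          using Ps_le[of w] Ps_pos[of w] \<open>w > 0\<close> w C_pos by (simp add: frac_le)
        ultimately show "\<exists>y. ((\<lambda>w. F w - 1 / C * ln w) has_real_derivative y) (at w) \<and> 0 \<le> y"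
          by (intro exI conjI) auto
      qed (use elim in auto)
      then show ?thesis using F(2)[of u] elim by (simp add: algebra_simps)
    qed
  qed
qed

lemma ginv_unique:
  assumes "0 < u" "u < l0" shows "g (\<phi> u) = u"
  unfolding ginv_def
proof (rule the_equality)
  fix w assume w: "0 < w \<and> w < l0 \<and> \<phi> w = \<phi> u"
  show "w = u" using varphi_strict_antimono[of w u] varphi_strict_antimono[of u w] assms w
    by (cases w u rule: linorder_cases) auto
qed (use assms in auto)

lemma ginv:
  assumes "x > 0" shows "0 < g x" "g x < l0" "\<phi> (g x) = x"
proof -
  have "eventually (\<lambda>u. x \<le> \<phi> u) (at_right 0)" using varphi_at_top by (simp add: filterlim_at_top)
  then obtain a where a: "0 < a" "a < l0" "x \<le> \<phi> a"
    using eventually_happens[OF eventually_conj[OF eventually_Ioo_l0]] by auto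
  have "\<exists>u\<ge>a. u \<le> l0 \<and> \<phi> u = x"
  proof (rule varphi_eq)
    fix F assume F: "\<And>u. u > 0 \<Longrightarrow> (F has_real_derivative 1 / Ps u) (at u)"
      "\<And>u. 0 < u \<Longrightarrow> u \<le> l0 \<Longrightarrow> \<phi> u = F l0 - F u"
    have "\<exists>u\<ge>a. u \<le> l0 \<and> F l0 - F u = x"
    proof (rule IVT2')
      show "continuous_on {a..l0} (\<lambda>u. F l0 - F u)"
        using F(1) a by (intro continuous_intros DERIV_continuous_on[where D="\<lambda>u. 1 / Ps u"])
          (auto intro!: DERIV_subset[OF F(1)])
    qed (use a F(2)[of a] assms in auto)
    then show ?thesis using F(2) a by force
  qed
  then obtain u where u: "a \<le> u" "u \<le> l0" "\<phi> u = x" by blast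
  then have "u \<noteq> l0" using varphi_l0 assms by auto
  then have "0 < u" "u < l0" using u a by auto
  then show "0 < g x" "g x < l0" "\<phi> (g x) = x" using ginv_unique[of u] u by auto
qed

lemma ginv_strict_antimono:
  assumes "0 < x" "x < y" shows "g y < g x"
  using varphi_strict_antimono[of "g x" "g y"] ginv[of x] ginv[of y] assms
  by (cases "g x" "g y" rule: linorder_cases) auto

lemma ginv_at_top: "filterlim g (at_right 0) at_top"
proof -
  have "(g \<longlongrightarrow> 0) at_top"
  proof (rule order_tendstoI)
    fix a :: real assume "a < 0"
    show "eventually (\<lambda>x. a < g x) at_top"
      using eventually_gt_at_top[of 0]
      by eventually_elim (use ginv(1) \<open>a < 0\<close> in \<open>blast intro: less_trans\<close>)
  next
    fix a :: real assume "0 < a"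
    define b where "b = min a (l0 / 2)"
    have b: "0 < b" "b < l0" "b \<le> a" using \<open>0 < a\<close> l0 by (auto simp: b_def)
    show "eventually (\<lambda>x. g x < a) at_top"
      using eventually_gt_at_top[of "\<phi> b"]
    proof eventually_elim
      case (elim x)
      then have "g x < g (\<phi> b)" using varphi_pos[of b] b by (intro ginv_strict_antimono) auto
      then show ?case using ginv_unique[of b] b by simp
    qed
  qed
  then show ?thesis
    by (rule tendsto_imp_filterlim_at_right)
       (rule eventually_mono[OF eventually_gt_at_top[of 0]], rule ginv(1))
qed

lemma ginv_deriv:
  assumes "x > 0" shows "(g has_real_derivative - Ps (g x)) (at x)"
proof -
  note gx = ginv[OF assms]
  have "(\<phi> has_real_derivative - 1 / Ps (g x)) (at (g x))" by (rule varphi_deriv) (use gx in auto)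
  moreover have "isCont g (\<phi> (g x))"
  \<comment> \<open>The midpoints towards 0 and towards \<open>l0\<close> bound a compact interval
    around \<open>g x\<close> inside (0, l0).\<close>
  proof (rule isCont_inverse_function2[where f=\<phi> and g=g and x="g x" and a="g x / 2" and b="(g x + l0) / 2"])
    show "g (\<phi> z) = z" if "g x / 2 \<le> z" "z \<le> (g x + l0) / 2" for z
      by (rule ginv_unique) (use gx that in auto)
    show "isCont \<phi> z" if "g x / 2 \<le> z" "z \<le> (g x + l0) / 2" for z
      by (rule varphi_isCont) (use gx that in auto)
  qed (use gx in auto)
  ultimately have "(g has_real_derivative inverse (- 1 / Ps (g x))) (at x)"
    using gx Ps_pos[of "g x"] assms ginv(3)
    by (intro DERIV_inverse_function[where a=0 and b="x + 1"]) auto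
  then show ?thesis by (simp add: divide_inverse)
qed

text \<open>The same antiderivative expresses \<open>H\<close> and the exponent of the scale
  function m in (S); this is why m(1/g) turns out to be a constant multiple of exp(H). Oriented
  integration allows u on either side of 1.\<close>

lemma Hfun_eq:
  obtains F where "\<And>u. u > 0 \<Longrightarrow> (F has_real_derivative Ph u / Ps u) (at u)"
    "\<And>x. x > 0 \<Longrightarrow> H x = F l0 - F (g x)"
    "\<And>u. u > 0 \<Longrightarrow> oint (\<lambda>u. Ph u / Ps u) u 1 = F 1 - F u"
proof -
  have "continuous_on {0<..} (\<lambda>u. Ph u / Ps u)"
    using Ps_pos by (intro continuous_intros Ps_cont continuous_on_subset[OF Ph_cont])
      (fastforce simp: less_imp_neq)+
  then obtain F where F: "\<And>x. x > 0 \<Longrightarrow> (F has_real_derivative Ph x / Ps x) (at x)"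
    "\<And>a b. 0 < a \<Longrightarrow> a \<le> b \<Longrightarrow> integral {a..b} (\<lambda>u. Ph u / Ps u) = F b - F a"
    using real_antiderivative_pos by blast
  show ?thesis
  proof (rule that[OF F(1)])
    show "H x = F l0 - F (g x)" if "x > 0" for x
    proof -
      have "H x = integral {g x..l0} (\<lambda>u. Ph u / \<bar>Ps u\<bar>)" using that by (simp add: Hfun_def)
      also have "\<dots> = integral {g x..l0} (\<lambda>u. Ph u / Ps u)"
        using ginv[OF that] Ps_pos
        by (intro Henstock_Kurzweil_Integration.integral_cong) (auto simp: abs_of_pos)
      finally show ?thesis using F(2)[of "g x" l0] ginv[OF that] by simp
    qed
    show "oint (\<lambda>u. Ph u / Ps u) u 1 = F 1 - F u" if "u > 0" for u
      using F(2)[of u 1] F(2)[of 1 u] that by (simp add: oint_def)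
  qed
qed

lemma Hfun_deriv:
  assumes "x > 0" shows "(H has_real_derivative Ph (g x)) (at x)"
proof (rule Hfun_eq)
  fix F assume F: "\<And>u. u > 0 \<Longrightarrow> (F has_real_derivative Ph u / Ps u) (at u)"
    "\<And>x. x > 0 \<Longrightarrow> H x = F l0 - F (g x)"
  note gx = ginv[OF assms]
  have "((\<lambda>x. F l0 - F (g x)) has_real_derivative 0 - Ph (g x) / Ps (g x) * - Ps (g x)) (at x)"
    by (intro derivative_intros DERIV_chain2[where f=F and g=g] F(1)[OF gx(1)] ginv_deriv assms)
  then have "((\<lambda>x. F l0 - F (g x)) has_real_derivative Ph (g x)) (at x)"
    using Ps_pos[OF gx(1)] by simp
  then show ?thesis
    by (rule has_field_derivative_transform_within_open[where S="{0<..}"]) (use assms F(2) in auto)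
qed

lemma deriv_Hfun: "x > 0 \<Longrightarrow> deriv H x = Ph (g x)"
  by (rule DERIV_imp_deriv[OF Hfun_deriv])

lemma Hfun_strict_mono:
  assumes "0 < x" "x < y" shows "H x < H y"
proof (rule DERIV_pos_imp_increasing[OF assms(2)])
  fix z assume "x \<le> z" "z \<le> y"
  then show "\<exists>D. (H has_real_derivative D) (at z) \<and> 0 < D"
    using assms(1) Hfun_deriv[of z] Ph_pos[OF ginv(1), of z] by (intro exI[of _ "Ph (g z)"]) auto
qed

lemma varphi_regularly_varying:
  assumes c: "c > 0"
  shows "((\<lambda>u. \<phi> (c * u) / \<phi> u) \<longlongrightarrow> c powr (- \<alpha>)) (at_right 0)"
proof (rule lhopital_right_0_at_top[OF varphi_at_top])
  have ev: "eventually (\<lambda>u. 0 < u \<and> u < l0 / c) (at_right 0)"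
    using l0 c by (intro eventually_at_rightI[of 0 "l0 / c"]) auto
  show "eventually (\<lambda>u. - 1 / Ps u \<noteq> 0) (at_right 0)"
    using eventually_Ioo_l0 by eventually_elim (use Ps_pos in force)
  show "eventually (\<lambda>u. ((\<lambda>u. \<phi> (c * u)) has_real_derivative - 1 / Ps (c * u) * c) (at u)) (at_right 0)"
    using ev
  proof eventually_elim
    case (elim u)
    then have "0 < c * u" "c * u < l0" using c by (auto simp: field_simps)
    then show ?case by (intro DERIV_chain2[OF varphi_deriv]) (auto intro!: derivative_eq_intros)
  qed
  show "eventually (\<lambda>u. (\<phi> has_real_derivative - 1 / Ps u) (at u)) (at_right 0)"
    using eventually_Ioo_l0 by eventually_elim (use varphi_deriv in auto)
  have "((\<lambda>u. c / (Ps (c * u) / Ps u)) \<longlongrightarrow> c / c powr (1 + \<alpha>)) (at_right 0)"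
    using c by (intro tendsto_intros Ps_rv) auto
  also have "c / c powr (1 + \<alpha>) = c powr (- \<alpha>)"
    using c by (simp add: powr_add powr_minus field_simps)
  finally have "((\<lambda>u. c / (Ps (c * u) / Ps u)) \<longlongrightarrow> c powr (- \<alpha>)) (at_right 0)" .
  moreover have "- 1 / Ps (c * u) * c / (- 1 / Ps u) = c / (Ps (c * u) / Ps u)" for u
    by simp
  ultimately show "((\<lambda>u. - 1 / Ps (c * u) * c / (- 1 / Ps u)) \<longlongrightarrow> c powr (- \<alpha>)) (at_right 0)"
    by (simp only:)
qed

text \<open>Separation of variables instead of a uniqueness theorem: \<open>\<phi> (w s) - s\<close>
  has derivative 0 once \<open>w\<close> is confined to (0, l], where \<open>\<phi>\<close> is
  differentiable and invertible.\<close>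

lemma flow_eq:
  assumes nonneg: "\<And>t. t \<ge> 0 \<Longrightarrow> w t \<ge> 0" and init: "w 0 = l"
    and ode: "\<And>t. t \<ge> 0 \<Longrightarrow> (w has_real_derivative - Ps (w t)) (at t within {0..})"
    and l: "0 < l" "l < l0" and t: "t \<ge> 0"
  shows "w t = g (\<phi> l + t)"
proof -
  have der: "(w has_real_derivative - Ps (w s)) (at s)" if "s > 0" for s
  proof -
    have "at s within {0..} = at s" by (rule at_within_interior) (use that in simp)
    then show ?thesis using ode[of s] that by (simp only: less_imp_le)
  qed
  have cont: "continuous_on {0..b} w" for b
    by (rule DERIV_continuous_on[where D="\<lambda>s. - Ps (w s)"]) (auto intro: DERIV_subset[OF ode])
  have Ps_nonneg: "Ps u \<ge> 0" if "u \<ge> 0" for u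
    using Ps_pos[of u] Ps_zero that by (cases "u = 0") auto
  have le: "w s \<le> l" if "s \<ge> 0" for s
    unfolding init[symmetric]
  proof (rule DERIV_nonpos_imp_decreasing_open[OF that _ cont])
    show "\<exists>y. (w has_real_derivative y) (at r) \<and> y \<le> 0" if "0 < r" "r < s" for r
      using der[OF that(1)] Ps_nonneg[OF nonneg, of r] that by auto
  qed
  \<comment> \<open>Gronwall: \<open>Ps u \<le> C * u\<close> prevents the flow from reaching \<open>0\<close>.\<close>
  have pos: "w s > 0" if "s \<ge> 0" for s
  proof -
    have "exp (C * 0) * w 0 \<le> exp (C * s) * w s"
    proof (rule DERIV_nonneg_imp_increasing_open[OF that])
      fix r assume r: "0 < r" "r < s"
      have "((\<lambda>s. exp (C * s) * w s) has_real_derivative exp (C * r) * (C * w r - Ps (w r))) (at r)"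
        using der[OF r(1)] by (auto intro!: derivative_eq_intros simp: algebra_simps)
      moreover have "0 \<le> exp (C * r) * (C * w r - Ps (w r))"
        using Ps_le[of "w r"] nonneg[of r] le[of r] l r by simp
      ultimately show "\<exists>y. ((\<lambda>s. exp (C * s) * w s) has_real_derivative y) (at r) \<and> 0 \<le> y" by blast
    qed (intro continuous_intros cont)
    then have "0 < exp (C * s) * w s" using init l by simp
    then show ?thesis by (simp add: zero_less_mult_iff)
  qed
  have "\<phi> (w t) = \<phi> l + t"
  proof (cases "t = 0")
    case False
    then have "0 < t" using t by simp
    have "\<phi> (w t) - t = \<phi> (w 0) - 0"
    proof (rule DERIV_isconst_end[OF \<open>0 < t\<close>, of "\<lambda>s. \<phi> (w s) - s"])
      show "continuous_on {0..t} (\<lambda>s. \<phi> (w s) - s)"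
      proof (intro continuous_intros continuous_on_compose2[of "{0<..<l0}" \<phi>, OF _ cont])
        show "continuous_on {0<..<l0} \<phi>"
          by (rule continuous_at_imp_continuous_on) (auto intro: varphi_isCont)
      qed (use pos le l in force)
      fix s assume s: "0 < s" "s < t"
      have ws: "0 < w s" "w s < l0" using pos[of s] le[of s] s l by auto
      have "((\<lambda>s. \<phi> (w s) - s) has_real_derivative - 1 / Ps (w s) * - Ps (w s) - 1) (at s)"
        by (intro derivative_intros DERIV_chain2[OF varphi_deriv] ws der s)
      then show "((\<lambda>s. \<phi> (w s) - s) has_real_derivative 0) (at s)"
        using Ps_pos[OF ws(1)] by simp
    qed
    then show ?thesis using init by simp
  qed (use init in simp)
  then show ?thesis using ginv_unique[of "w t"] pos[OF t] le[OF t] l by simp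
qed

lemma flow_integral:
  assumes "\<And>s. s \<ge> 0 \<Longrightarrow> w s = g (\<phi> l + s)" "0 < l" "l < l0" "t \<ge> 0"
  shows "integral {0..t} (\<lambda>s. Ph (w s)) = H (\<phi> l + t) - H (\<phi> l)"
proof -
  have "((\<lambda>s. Ph (w s)) has_integral H (\<phi> l + t) - H (\<phi> l + 0)) {0..t}"
  proof (rule fundamental_theorem_of_calculus[OF assms(4)])
    fix s assume s: "s \<in> {0..t}"
    have "((\<lambda>s. H (\<phi> l + s)) has_real_derivative Ph (g (\<phi> l + s)) * 1) (at s)"
      using varphi_pos[of l] assms s
      by (intro DERIV_chain2[OF Hfun_deriv]) (auto intro!: derivative_eq_intros)
    then show "((\<lambda>s. H (\<phi> l + s)) has_vector_derivative Ph (w s)) (at s within {0..t})"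
      using assms(1)[of s] s
      by (auto simp: has_real_derivative_iff_has_vector_derivative[symmetric] intro: DERIV_subset)
  qed
  then show ?thesis by (simp add: integral_unique)
qed

end

section \<open>Limit laws under (L) and (S)\<close>

context cbi_mechanisms
begin

lemma inv_nonneg_unique: "q \<ge> 0 \<Longrightarrow> inv_nonneg Ph (Ph q) = q"
  unfolding inv_nonneg_def
proof (rule the_equality)
  fix p assume "q \<ge> 0" "p \<ge> 0 \<and> Ph p = Ph q"
  then show "p = q" using Ph_strict[of p q] Ph_strict[of q p] by (cases p q rule: linorder_cases) auto
qed auto

text \<open>\<Phi> may be bounded, so a preimage is claimed only below the threshold
  \<open>Ph 1\<close>, which \<kappa>/t passes for large t.\<close>

lemma inv_nonneg:
  assumes "0 < y" "y \<le> Ph 1" shows "0 < inv_nonneg Ph y" "Ph (inv_nonneg Ph y) = y"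
proof -
  have "\<exists>q\<ge>0. q \<le> 1 \<and> Ph q = y"
    by (rule IVT') (use assms Ph_zero in \<open>auto intro: continuous_on_subset[OF Ph_cont]\<close>)
  then obtain q where q: "q \<ge> 0" "Ph q = y" by blast
  then have "q \<noteq> 0" using assms Ph_zero by auto
  then show "0 < inv_nonneg Ph y" "Ph (inv_nonneg Ph y) = y" using inv_nonneg_unique[of q] q by auto
qed

lemma Ph_less_iff: "0 \<le> p \<Longrightarrow> 0 \<le> q \<Longrightarrow> Ph p < Ph q \<longleftrightarrow> p < q"
  using Ph_strict[of p q] Ph_mono[of q p] by force

lemma inv_nonneg_mono:
  assumes "0 < y" "y \<le> z" "z \<le> Ph 1" shows "inv_nonneg Ph y \<le> inv_nonneg Ph z"
proof (rule ccontr)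
  assume "\<not> ?thesis"
  then have "Ph (inv_nonneg Ph z) < Ph (inv_nonneg Ph y)"
    using inv_nonneg[of z] assms by (intro Ph_strict) auto
  then show False using inv_nonneg[of y] inv_nonneg[of z] assms by simp
qed

lemma eventually_small_over_t:
  assumes "\<kappa> > 0" shows "eventually (\<lambda>t. t > 0 \<and> 0 < \<kappa> / t \<and> \<kappa> / t \<le> Ph 1) at_top"
  using eventually_gt_at_top[of 0] eventually_ge_at_top[of "\<kappa> / Ph 1"]
proof eventually_elim
  case (elim t)
  then show ?case using Ph_pos[of 1] assms by (simp add: field_simps)
qed

lemma inv_nonneg_at_right:
  assumes "\<kappa> > 0" shows "filterlim (\<lambda>t. inv_nonneg Ph (\<kappa> / t)) (at_right 0) at_top"
proof -
  have pos: "eventually (\<lambda>t. 0 < inv_nonneg Ph (\<kappa> / t)) at_top"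
    using eventually_small_over_t[OF assms] by eventually_elim (use inv_nonneg(1) in auto)
  have "((\<lambda>t. inv_nonneg Ph (\<kappa> / t)) \<longlongrightarrow> 0) at_top"
  proof (rule order_tendstoI)
    fix a :: real assume "0 < a"
    have "((\<lambda>t. \<kappa> / t) \<longlongrightarrow> 0) at_top"
      by (intro real_tendsto_divide_at_top[OF tendsto_const] filterlim_ident)
    from order_tendstoD(2)[OF this Ph_pos[OF \<open>0 < a\<close>]] eventually_small_over_t[OF assms]
    show "eventually (\<lambda>t. inv_nonneg Ph (\<kappa> / t) < a) at_top"
    proof eventually_elim
      case (elim t)
      then have "Ph (inv_nonneg Ph (\<kappa> / t)) < Ph a" using inv_nonneg(2)[of "\<kappa> / t"] by simp
      then show ?case using Ph_less_iff[of "inv_nonneg Ph (\<kappa> / t)" a] inv_nonneg(1)[of "\<kappa> / t"] elim \<open>0 < a\<close> by simp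
    qed
  qed (use pos in \<open>auto elim!: eventually_mono\<close>)
  then show ?thesis by (rule tendsto_imp_filterlim_at_right) (use pos in auto)
qed

end

section \<open>Laplace transforms of the process and their limits\<close>

text \<open>The transform is recorded for 0 < l < l0, the range of the explicit flow; arguments
  tending to 0 eventually lie in it.\<close>

locale cbi_process = cbi_mechanisms Ps Ph l0 \<alpha> C + prob_space M
  for Ps Ph l0 \<alpha> C and M :: "'a measure" +
  fixes Y :: "real \<Rightarrow> 'a \<Rightarrow> real" and x :: real
  assumes Y_meas: "\<And>t. t \<ge> 0 \<Longrightarrow> Y t \<in> borel_measurable M"
    and Y_nonneg: "\<And>t \<omega>. t \<ge> 0 \<Longrightarrow> \<omega> \<in> space M \<Longrightarrow> Y t \<omega> \<ge> 0"
    and laplace: "\<And>t l. t \<ge> 0 \<Longrightarrow> 0 < l \<Longrightarrow> l < l0 \<Longrightarrow>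
      (\<integral>\<omega>. exp (- l * Y t \<omega>) \<partial>M) = exp (- x * g (\<phi> l + t) - (H (\<phi> l + t) - H (\<phi> l)))"
begin

text \<open>Reduces every case to the increment of \<open>H\<close>: the term with \<open>x\<close>
  vanishes since \<open>\<phi> (l t) + t\<close> tends to infinity and \<open>g\<close> tends to 0
  there.\<close>

lemma laplace_tendsto:
  assumes l: "filterlim l (at_right 0) at_top"
    and lim: "((\<lambda>t. H (\<phi> (l t) + t) - H (\<phi> (l t))) \<longlongrightarrow> \<kappa>) at_top"
  shows "((\<lambda>t. \<integral>\<omega>. exp (- l t * Y t \<omega>) \<partial>M) \<longlongrightarrow> exp (- \<kappa>)) at_top"
proof -
  have ev: "eventually (\<lambda>t. 0 < l t \<and> l t < l0) at_top"
    by (rule eventually_compose_filterlim[OF eventually_Ioo_l0 l])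
  have "filterlim (\<lambda>t. \<phi> (l t) + t) at_top at_top"
    by (intro filterlim_at_top_add_at_top filterlim_compose[OF varphi_at_top l] filterlim_ident)
  from filterlim_compose[OF ginv_at_top this]
  have "((\<lambda>t. g (\<phi> (l t) + t)) \<longlongrightarrow> 0) at_top" by (simp add: filterlim_at)
  then have "((\<lambda>t. exp (- x * g (\<phi> (l t) + t) - (H (\<phi> (l t) + t) - H (\<phi> (l t))))) \<longlongrightarrow> exp (- x * 0 - \<kappa>)) at_top"
    by (intro tendsto_intros lim)
  then have "((\<lambda>t. exp (- x * g (\<phi> (l t) + t) - (H (\<phi> (l t) + t) - H (\<phi> (l t))))) \<longlongrightarrow> exp (- \<kappa>)) at_top"
    by simp
  then show ?thesis
  proof (rule Lim_transform_eventually)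
    show "eventually (\<lambda>t. exp (- x * g (\<phi> (l t) + t) - (H (\<phi> (l t) + t) - H (\<phi> (l t)))) =
        (\<integral>\<omega>. exp (- l t * Y t \<omega>) \<partial>M)) at_top"
      using ev eventually_ge_at_top[of 0] by eventually_elim (use laplace in auto)
  qed
qed

text \<open>Since \<open>\<phi> (g t) = t\<close>, regular variation gives the quotient of
  \<open>\<phi> (l * g t) + t\<close> and \<open>\<phi> (l * g t)\<close> the limit
  \<open>1 + l powr \<alpha>\<close>; an increment of \<open>H\<close> over that ratio tends to
  \<open>a\<close> times its logarithm.\<close>

lemma log_limit_law:
  assumes "condL H a"
  shows "\<exists>\<mu>. prob_space \<mu> \<and> sets \<mu> = sets borel \<and> (AE y in \<mu>. y \<ge> 0) \<and>
    (\<forall>l>0. (\<integral>y. exp (- l * y) \<partial>\<mu>) = (1 + l powr \<alpha>) powr (- a)) \<and>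
    conv_law_at_top M (\<lambda>t \<omega>. g t * Y t \<omega>) \<mu>"
proof (rule laplace_continuity[where T=1])
  show "prob_space M" by unfold_locales
  show "(\<lambda>\<omega>. g t * Y t \<omega>) \<in> borel_measurable M" if "t \<ge> 1" for t
    using Y_meas[of t] that by auto
  show "0 \<le> g t * Y t \<omega>" if "t \<ge> 1" "\<omega> \<in> space M" for t \<omega>
    using Y_nonneg[of t \<omega>] ginv(1)[of t] that by simp
  show "((\<lambda>l. (1 + l powr \<alpha>) powr - a) \<longlongrightarrow> 1) (at_right 0)"
  proof -
    have "((\<lambda>l. (1 + l powr \<alpha>) powr - a) \<longlongrightarrow> (1 + 0 powr \<alpha>) powr - a) (at_right 0)"
      using \<alpha> by (intro tendsto_intros tendsto_powr') (auto simp: eventually_at_right_less less_imp_le eventually_mono[OF eventually_at_right_less])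
    then show ?thesis by simp
  qed
  fix l :: real assume l: "l > 0"
  have la: "l powr (- \<alpha>) > 0" using l by simp
  have lg: "filterlim (\<lambda>t. l * g t) (at_right 0) at_top"
    by (rule filterlim_mult_at_right_0[OF ginv_at_top l])
  have \<phi>top: "filterlim (\<lambda>t. \<phi> (l * g t)) at_top at_top" by (rule filterlim_compose[OF varphi_at_top lg])
  have \<phi>ev: "eventually (\<lambda>t. \<phi> (l * g t) > 0) at_top" using \<phi>top by (simp add: filterlim_at_top_dense)
  have "((\<lambda>t. \<phi> (l * g t) / \<phi> (g t)) \<longlongrightarrow> l powr (- \<alpha>)) at_top"
    by (rule filterlim_compose[OF varphi_regularly_varying[OF l] ginv_at_top])
  then have ratio: "((\<lambda>t. \<phi> (l * g t) / t) \<longlongrightarrow> l powr (- \<alpha>)) at_top"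
    by (rule Lim_transform_eventually)
       (rule eventually_mono[OF eventually_gt_at_top[of 0]], simp add: ginv(3))
  have "((\<lambda>t. 1 + 1 / (\<phi> (l * g t) / t)) \<longlongrightarrow> 1 + 1 / l powr (- \<alpha>)) at_top"
    using la by (intro tendsto_intros ratio) auto
  moreover have "eventually (\<lambda>t. 1 + 1 / (\<phi> (l * g t) / t) = (\<phi> (l * g t) + t) / \<phi> (l * g t)) at_top"
    using \<phi>ev by eventually_elim (simp add: field_simps)
  ultimately have "((\<lambda>t. (\<phi> (l * g t) + t) / \<phi> (l * g t)) \<longlongrightarrow> 1 + 1 / l powr (- \<alpha>)) at_top"
    by (rule Lim_transform_eventually)
  then have r: "((\<lambda>t. (\<phi> (l * g t) + t) / \<phi> (l * g t)) \<longlongrightarrow> 1 + l powr \<alpha>) at_top"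
    by (simp add: powr_minus divide_inverse)
  have "((\<lambda>x. x * Ph (g x)) \<longlongrightarrow> a) at_top"
  proof (rule Lim_transform_eventually)
    show "((\<lambda>x. x * deriv H x) \<longlongrightarrow> a) at_top" using assms by (simp add: condL_def)
    show "eventually (\<lambda>x. x * deriv H x = x * Ph (g x)) at_top"
      by (rule eventually_mono[OF eventually_gt_at_top[of 0]]) (simp add: deriv_Hfun)
  qed
  from log_slope_diff[OF Hfun_deriv this filterlim_at_top_add_at_top[OF \<phi>top filterlim_ident] \<phi>top r]
  have "((\<lambda>t. H (\<phi> (l * g t) + t) - H (\<phi> (l * g t))) \<longlongrightarrow> a * ln (1 + l powr \<alpha>)) at_top"
    using l by (simp add: add_pos_pos)
  from laplace_tendsto[OF lg this]
  have "((\<lambda>t. \<integral>\<omega>. exp (- (l * g t) * Y t \<omega>) \<partial>M) \<longlongrightarrow> exp (- (a * ln (1 + l powr \<alpha>)))) at_top" .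
  moreover have "exp (- (a * ln (1 + l powr \<alpha>))) = (1 + l powr \<alpha>) powr - a"
    using l by (simp add: powr_def add_nonneg_eq_0_iff)
  ultimately show "((\<lambda>t. \<integral>\<omega>. exp (- l * (g t * Y t \<omega>)) \<partial>M) \<longlongrightarrow> (1 + l powr \<alpha>) powr - a) at_top"
    by (simp add: mult.assoc)
qed

text \<open>As \<open>m (1 / g s) = c * exp (H s)\<close> and \<open>m\<close> is increasing, the
  rescaled variable is at most \<open>u\<close> exactly when \<open>g s * Y t \<le> 1\<close>, where
  H(s) = H(t) + ln u. Replacing \<open>g s\<close> by a multiple changes \<open>H\<close> by o(1),
  so the Laplace limit is \<open>u\<close> for every multiple.\<close>

lemma slow_limit_law:
  assumes "condS H"
  defines "m \<equiv> (\<lambda>y. if y > 0 then exp (oint (\<lambda>u. Ph u / Ps u) (1 / y) 1) else 0)"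
  shows "conv_law_at_top M (\<lambda>t \<omega>. m (Y t \<omega>) / m (1 / g t)) (uniform_measure lborel {0..1})"
proof (rule Hfun_eq)
  fix F assume F: "\<And>u. u > 0 \<Longrightarrow> (F has_real_derivative Ph u / Ps u) (at u)"
    "\<And>x. x > 0 \<Longrightarrow> H x = F l0 - F (g x)"
    "\<And>u. u > 0 \<Longrightarrow> oint (\<lambda>u. Ph u / Ps u) u 1 = F 1 - F u"
  have F_mono: "F u < F w" if "0 < u" "u < w" for u w
  proof (rule DERIV_pos_imp_increasing[OF that(2)])
    fix y assume "u \<le> y" "y \<le> w"
    then show "\<exists>D. (F has_real_derivative D) (at y) \<and> 0 < D"
      using F(1)[of y] Ps_pos[of y] Ph_pos[of y] that(1) by (intro exI[of _ "Ph y / Ps y"]) auto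
  qed
  have m_pos_eq: "m y = exp (F 1 - F (1 / y))" if "y > 0" for y
    using F(3)[of "1 / y"] that by (simp add: m_def)
  have m_less: "m y < m z" if "0 < y" "y < z" for y z
    using F_mono[of "1 / z" "1 / y"] that by (simp add: m_pos_eq frac_less2)
  \<comment> \<open>At y = 0 the convention \<open>m 0 = 0\<close> lies below all positive values of
    \<open>m\<close>, which keeps the equivalence valid.\<close>
  have m_le_iff: "m y \<le> m z \<longleftrightarrow> y \<le> z" if "0 \<le> y" "0 < z" for y z
  proof (cases "y = 0")
    case True then show ?thesis using that by (simp add: m_def)
  next
    case False
    then show ?thesis using that m_less[of y z] m_less[of z y] by (cases y z rule: linorder_cases) auto
  qed
  have "mono m"
  proof
    fix y z :: real assume "y \<le> z"
    then show "m y \<le> m z"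
      using m_less[of y z] by (cases "y > 0"; cases "y = z") (auto simp: m_def)
  qed
  then have m_meas[measurable]: "m \<in> borel_measurable borel" by (rule borel_measurable_mono)
  define c where "c = exp (F 1 - F l0)"
  have c: "c > 0" by (simp add: c_def)
  have m_g: "m (1 / g s) = c * exp (H s)" if "s > 0" for s
    using ginv(1)[OF that] F(2)[OF that] by (simp add: m_pos_eq c_def exp_add[symmetric])
  have H_top: "filterlim H at_top at_top" and H_slope: "((\<lambda>x. x * Ph (g x)) \<longlongrightarrow> 0) at_top"
  proof -
    show "filterlim H at_top at_top" using assms(1) by (simp add: condS_def)
    show "((\<lambda>x. x * Ph (g x)) \<longlongrightarrow> 0) at_top"
    proof (rule Lim_transform_eventually)
      show "((\<lambda>x. x * deriv H x) \<longlongrightarrow> 0) at_top" using assms(1) by (simp add: condS_def)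
      show "eventually (\<lambda>x. x * deriv H x = x * Ph (g x)) at_top"
        by (rule eventually_mono[OF eventually_gt_at_top[of 0]]) (simp add: deriv_Hfun)
    qed
  qed
  let ?X = "\<lambda>t \<omega>. m (Y t \<omega>) / m (1 / g t)"
  have meas: "?X t \<in> borel_measurable M" if "t \<ge> 1" for t
    using Y_meas[of t] that by (intro borel_measurable_divide measurable_compose[OF _ m_meas]) auto
  have cdf01: "((\<lambda>t. measure M {\<omega> \<in> space M. ?X t \<omega> \<le> u}) \<longlongrightarrow> u) at_top" if u: "0 < u" "u < 1" for u
  proof -
    have "eventually (\<lambda>t. H 1 - ln u \<le> H t) at_top" using H_top by (simp add: filterlim_at_top)
    then obtain T0 where T0: "\<And>t. t \<ge> T0 \<Longrightarrow> H 1 - ln u \<le> H t"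
      by (auto simp: eventually_at_top_linorder)
    \<comment> \<open>Beyond \<open>T\<close> the level \<open>H t + ln u\<close> lies between
      \<open>H 1\<close> and \<open>H t\<close>, so it is attained at some s in [1, t].\<close>
    define T where "T = max T0 1"
    have "\<exists>s\<ge>1. s \<le> t \<and> H s = H t + ln u" if "t \<ge> T" for t
    proof (rule IVT')
      show "H 1 \<le> H t + ln u" using T0[of t] that by (simp add: T_def)
      show "H t + ln u \<le> H t" using u by simp
      show "continuous_on {1..t} H"
        by (rule DERIV_continuous_on[where D="\<lambda>x. Ph (g x)"]) (auto intro!: DERIV_subset[OF Hfun_deriv])
    qed (use that in \<open>simp add: T_def\<close>)
    then obtain s where s: "\<And>t. t \<ge> T \<Longrightarrow> 1 \<le> s t \<and> s t \<le> t \<and> H (s t) = H t + ln u"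
      by metis
    have s_top: "filterlim s at_top at_top"
      unfolding filterlim_at_top
    proof
      fix Z :: real
      define Z' where "Z' = max Z 1"
      have "eventually (\<lambda>t. H Z' - ln u < H t) at_top" using H_top by (simp add: filterlim_at_top_dense)
      then show "eventually (\<lambda>t. Z \<le> s t) at_top"
        using eventually_ge_at_top[of T]
      proof eventually_elim
        case (elim t)
        have "Z' < s t"
        proof (rule ccontr)
          assume "\<not> Z' < s t"
          then have "H (s t) \<le> H Z'"
            using Hfun_strict_mono[of "s t" Z'] s[OF elim(2)] by (cases "s t = Z'") auto
          then show False using s[OF elim(2)] elim(1) by simp
        qed
        then show ?case by (simp add: Z'_def)
      qed
    qed
    define l where "l t = g (s t)" for t
    have l_lim: "filterlim l (at_right 0) at_top"
      unfolding l_def by (rule filterlim_compose[OF ginv_at_top s_top])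
    have l_pos: "l t > 0" if "t \<ge> T" for t using s[OF that] ginv(1)[of "s t"] by (simp add: l_def)
    have \<phi>l: "\<phi> (l t) = s t" if "t \<ge> T" for t using s[OF that] ginv(3)[of "s t"] by (simp add: l_def)
    show ?thesis
    proof (rule measure_tendsto_of_constant_laplace_limit[where T=T and Z="\<lambda>t \<omega>. l t * Y t \<omega>"])
      have T1: "T \<ge> 1" by (simp add: T_def)
      show "prob_space M" by unfold_locales
      show "(\<lambda>\<omega>. l t * Y t \<omega>) \<in> borel_measurable M" if "t \<ge> T" for t
        using Y_meas[of t] that T1 by auto
      show "0 \<le> l t * Y t \<omega>" if "t \<ge> T" "\<omega> \<in> space M" for t \<omega>
        using Y_nonneg[of t \<omega>] l_pos[OF that(1)] that T1 by simp
      show "{\<omega> \<in> space M. ?X t \<omega> \<le> u} \<in> events" if "t \<ge> T" for t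
        using meas[of t] that T1 by auto
      have key: "?X t \<omega> \<le> u \<longleftrightarrow> l t * Y t \<omega> \<le> 1" if "t \<ge> T" "\<omega> \<in> space M" for t \<omega>
      proof -
        have mg: "m (1 / g t) > 0" using m_g[of t] that T1 c by simp
        have "u * m (1 / g t) = m (1 / l t)"
          using m_g[of t] m_g[of "s t"] s[OF that(1)] that T1 u by (simp add: l_def exp_add)
        then have "?X t \<omega> \<le> u \<longleftrightarrow> m (Y t \<omega>) \<le> m (1 / l t)"
          using mg by (simp add: pos_divide_le_eq)
        also have "\<dots> \<longleftrightarrow> Y t \<omega> \<le> 1 / l t"
          using Y_nonneg[of t \<omega>] l_pos[OF that(1)] that T1 by (intro m_le_iff) auto
        also have "\<dots> \<longleftrightarrow> l t * Y t \<omega> \<le> 1"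
          using l_pos[OF that(1)] by (simp add: field_simps)
        finally show ?thesis .
      qed
      show "\<omega> \<in> {\<omega> \<in> space M. ?X t \<omega> \<le> u}" if "t \<ge> T" "\<omega> \<in> space M" "l t * Y t \<omega> < 1" for t \<omega>
        using key[OF that(1,2)] that by simp
      show "l t * Y t \<omega> \<le> 1" if "t \<ge> T" "\<omega> \<in> {\<omega> \<in> space M. ?X t \<omega> \<le> u}" for t \<omega>
        using key[OF that(1), of \<omega>] that by simp
      fix \<theta> :: real assume \<theta>: "\<theta> > 0"
      have \<theta>l: "filterlim (\<lambda>t. \<theta> * l t) (at_right 0) at_top"
        by (rule filterlim_mult_at_right_0[OF l_lim \<theta>])
      have \<phi>top: "filterlim (\<lambda>t. \<phi> (\<theta> * l t)) at_top at_top" by (rule filterlim_compose[OF varphi_at_top \<theta>l])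
      have "((\<lambda>t. \<phi> (\<theta> * l t) / \<phi> (l t)) \<longlongrightarrow> \<theta> powr (- \<alpha>)) at_top"
        by (rule filterlim_compose[OF varphi_regularly_varying[OF \<theta>] l_lim])
      then have ratio: "((\<lambda>t. \<phi> (\<theta> * l t) / s t) \<longlongrightarrow> \<theta> powr (- \<alpha>)) at_top"
        by (rule Lim_transform_eventually)
           (rule eventually_mono[OF eventually_ge_at_top[of T]], simp add: \<phi>l)
      have d1: "((\<lambda>t. H (\<phi> (\<theta> * l t)) - H (s t)) \<longlongrightarrow> 0) at_top"
        using log_slope_diff[OF Hfun_deriv H_slope \<phi>top s_top ratio] \<theta> by simp
      \<comment> \<open>Because u < 1 gives \<open>s t \<le> t\<close>, the quotient of
        \<open>\<phi> (\<theta> * l t) + t\<close> and t lies between 1 and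
        \<open>\<theta> powr (- \<alpha>) + 2\<close>; a bounded logarithm is enough at slope
        0.\<close>
      have d2: "((\<lambda>t. H (\<phi> (\<theta> * l t) + t) - H t) \<longlongrightarrow> 0) at_top"
      proof (rule log_slope_zero_diff[OF Hfun_deriv H_slope
            filterlim_at_top_add_at_top[OF \<phi>top filterlim_ident] filterlim_ident])
        have "eventually (\<lambda>t. \<phi> (\<theta> * l t) / s t < \<theta> powr (- \<alpha>) + 1) at_top"
          by (rule order_tendstoD(2)[OF ratio]) simp
        moreover have "eventually (\<lambda>t. \<phi> (\<theta> * l t) > 0) at_top" using \<phi>top by (simp add: filterlim_at_top_dense)
        ultimately show "eventually (\<lambda>t. \<bar>ln (\<phi> (\<theta> * l t) + t) - ln t\<bar> \<le> ln (\<theta> powr (- \<alpha>) + 2)) at_top"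
          using eventually_ge_at_top[of T]
        proof eventually_elim
          case (elim t)
          have t: "t > 0" "s t > 0" "s t \<le> t" using s[OF elim(3)] elim T1 by auto
          have "\<phi> (\<theta> * l t) \<le> (\<theta> powr (- \<alpha>) + 1) * s t" using elim t by (simp add: field_simps)
          also have "\<dots> \<le> (\<theta> powr (- \<alpha>) + 1) * t" using t by (intro mult_left_mono) (auto simp: add_nonneg_nonneg)
          finally have "\<phi> (\<theta> * l t) + t \<le> (\<theta> powr (- \<alpha>) + 2) * t" by (simp add: algebra_simps)
          then have "ln (\<phi> (\<theta> * l t) + t) \<le> ln ((\<theta> powr (- \<alpha>) + 2) * t)"
            using elim t by (subst ln_le_cancel_iff) (auto intro!: mult_pos_pos add_nonneg_pos)
          also have "\<dots> = ln (\<theta> powr (- \<alpha>) + 2) + ln t"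
            using t by (intro ln_mult_pos) (auto intro: add_nonneg_pos)
          finally have "ln (\<phi> (\<theta> * l t) + t) - ln t \<le> ln (\<theta> powr (- \<alpha>) + 2)" by simp
          moreover have "ln t \<le> ln (\<phi> (\<theta> * l t) + t)" using elim t by simp
          ultimately show ?case by simp
        qed
      qed
      have "((\<lambda>t. (H (\<phi> (\<theta> * l t) + t) - H t) - (H (\<phi> (\<theta> * l t)) - H (s t)) + - ln u) \<longlongrightarrow> 0 - 0 + - ln u) at_top"
        by (intro tendsto_intros d1 d2)
      then have "((\<lambda>t. H (\<phi> (\<theta> * l t) + t) - H (\<phi> (\<theta> * l t))) \<longlongrightarrow> 0 - 0 + - ln u) at_top"
        by (rule Lim_transform_eventually)
           (rule eventually_mono[OF eventually_ge_at_top[of T]], use s in simp)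
      from laplace_tendsto[OF \<theta>l this] u
      show "((\<lambda>t. \<integral>\<omega>. exp (- \<theta> * (l t * Y t \<omega>)) \<partial>M) \<longlongrightarrow> u) at_top"
        by (simp add: mult.assoc)
    qed
  qed
  show ?thesis
  proof (rule conv_law_at_top_cdfI[where T=1])
    show "prob_space M" by unfold_locales
    interpret U: prob_space "uniform_measure lborel {0..1::real}"
      by (rule prob_space_uniform_measure) auto
    show "real_distribution (uniform_measure lborel {0..1::real})"
      by unfold_locales auto
    have cdf: "cdf (uniform_measure lborel {0..1}) y = max 0 (min 1 y)" for y :: real
    proof -
      have "{0..1} \<inter> {..y} = {0..min 1 y}" by auto
      then show ?thesis unfolding cdf_def
        by (subst measure_uniform_measure) (auto simp: max_def min_def)
    qed
    fix y :: real
    show "?X t \<in> borel_measurable M" if "t \<ge> 1" for t by (rule meas[OF that])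
    have mono: "measure M {\<omega> \<in> space M. ?X t \<omega> \<le> y} \<le> measure M {\<omega> \<in> space M. ?X t \<omega> \<le> z}"
      if "t \<ge> 1" "y \<le> z" for t y z
      using meas[OF that(1)] that(2) by (intro finite_measure_mono) auto
    \<comment> \<open>The cases outside (0, 1) follow by monotonicity from levels \<open>u\<close>
      close to 0 or to 1.\<close>
    consider "y \<le> 0" | "0 < y" "y < 1" | "1 \<le> y" by linarith
    then show "((\<lambda>t. measure M {\<omega> \<in> space M. ?X t \<omega> \<le> y}) \<longlongrightarrow> cdf (uniform_measure lborel {0..1}) y) at_top"
    proof cases
      case 1
      have "((\<lambda>t. measure M {\<omega> \<in> space M. ?X t \<omega> \<le> y}) \<longlongrightarrow> 0) at_top"
      proof (rule order_tendstoI)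
        fix a :: real assume "0 < a"
        define u where "u = min a 1 / 2"
        have u: "0 < u" "u < 1" "u < a" using \<open>0 < a\<close> by (auto simp: u_def)
        show "eventually (\<lambda>t. measure M {\<omega> \<in> space M. ?X t \<omega> \<le> y} < a) at_top"
          using order_tendstoD(2)[OF cdf01[OF u(1,2)] u(3)] eventually_ge_at_top[of 1]
          by eventually_elim (use mono[of _ y u] 1 u in force)
      qed (auto intro!: always_eventually less_le_trans[OF _ measure_nonneg])
      then show ?thesis using 1 by (simp add: cdf)
    next
      case 2 then show ?thesis using cdf01[of y] by (simp add: cdf)
    next
      case 3
      have "((\<lambda>t. measure M {\<omega> \<in> space M. ?X t \<omega> \<le> y}) \<longlongrightarrow> 1) at_top"
      proof (rule order_tendstoI)
        fix a :: real assume "a < 1"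
        define u where "u = (max a 0 + 1) / 2"
        have u: "0 < u" "u < 1" "a < u" using \<open>a < 1\<close> by (auto simp: u_def)
        show "eventually (\<lambda>t. a < measure M {\<omega> \<in> space M. ?X t \<omega> \<le> y}) at_top"
          using order_tendstoD(1)[OF cdf01[OF u(1,2)] u(3)] eventually_ge_at_top[of 1]
          by eventually_elim (use mono[of _ u y] 3 u in force)
      qed (auto intro!: always_eventually le_less_trans[OF prob_le_1])
      then show ?thesis using 3 by (simp add: cdf)
    qed
  qed
qed

end

section \<open>Limit laws under (F)\<close>

context cbi_mechanisms
begin

context
  fixes \<delta> :: real and L :: "real \<Rightarrow> real"
  assumes F: "condF H \<delta> L"
begin

lemma deriv_regularly_varying:
  assumes c: "c > 0"
  shows "((\<lambda>x. Ph (g (c * x)) / Ph (g x)) \<longlongrightarrow> c powr (- \<delta>)) at_top"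
proof -
  have Lpos: "eventually (\<lambda>x. L x > 0) at_top" and Lsv: "((\<lambda>x. L (c * x) / L x) \<longlongrightarrow> 1) at_top"
    using F c by (auto simp: condF_def slowly_varying_def)
  have top: "filterlim (\<lambda>x. c * x) at_top at_top"
    using c by (intro filterlim_tendsto_pos_mult_at_top[OF tendsto_const] filterlim_ident) auto
  have h: "Ph (g x) = x powr (- \<delta>) / L x" if "x > 0" for x
    using F deriv_Hfun[OF that] that by (simp add: condF_def)
  have "((\<lambda>x. c powr (- \<delta>) / (L (c * x) / L x)) \<longlongrightarrow> c powr (- \<delta>) / 1) at_top"
    by (intro tendsto_intros Lsv) auto
  then have "((\<lambda>x. c powr (- \<delta>) / (L (c * x) / L x)) \<longlongrightarrow> c powr (- \<delta>)) at_top" by simp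
  then show ?thesis
  proof (rule Lim_transform_eventually)
    show "eventually (\<lambda>x. c powr (- \<delta>) / (L (c * x) / L x) = Ph (g (c * x)) / Ph (g x)) at_top"
      using Lpos eventually_compose_filterlim[OF Lpos top] eventually_gt_at_top[of 0]
      by eventually_elim (use c in \<open>simp add: h powr_mult\<close>)
  qed
qed

text \<open>\<Phi> increases and \<open>g\<close> decreases, so the derivative of \<open>H\<close>
  is antimonotone and moving arguments are allowed.\<close>

lemma deriv_ratio:
  assumes "filterlim B at_top G" "((\<lambda>t. A t / B t) \<longlongrightarrow> r) G" "r > 0"
  shows "((\<lambda>t. Ph (g (A t)) / Ph (g (B t))) \<longlongrightarrow> r powr (- \<delta>)) G"
proof (rule antimono_regular_variation_ratio[where f="\<lambda>x. Ph (g x)"])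
  show "Ph (g y) \<le> Ph (g x)" if "0 < x" "x \<le> y" for x y
    using ginv_strict_antimono[of x y] ginv(1)[of y] that by (cases "x = y") (auto intro!: Ph_mono)
qed (use assms deriv_regularly_varying Ph_pos ginv(1) in auto)

lemma Ph_regularly_varying:
  assumes c: "c > 0"
  shows "((\<lambda>q. Ph (c * q) / Ph q) \<longlongrightarrow> c powr (\<delta> * \<alpha>)) (at_right 0)"
proof -
  have ev: "eventually (\<lambda>q. 0 < c * q \<and> c * q < l0) (at_right 0)"
    by (rule eventually_compose_filterlim[OF eventually_Ioo_l0])
       (rule filterlim_mult_at_right_0[OF filterlim_ident c])
  have "((\<lambda>q. Ph (g (\<phi> (c * q))) / Ph (g (\<phi> q))) \<longlongrightarrow> (c powr (- \<alpha>)) powr (- \<delta>)) (at_right 0)"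
    by (rule deriv_ratio[OF varphi_at_top varphi_regularly_varying[OF c]]) (use c in simp)
  moreover have "(c powr (- \<alpha>)) powr (- \<delta>) = c powr (\<delta> * \<alpha>)"
    by (simp add: powr_powr mult.commute)
  ultimately have "((\<lambda>q. Ph (g (\<phi> (c * q))) / Ph (g (\<phi> q))) \<longlongrightarrow> c powr (\<delta> * \<alpha>)) (at_right 0)"
    by simp
  then show ?thesis
    by (rule Lim_transform_eventually)
       (use ev eventually_Ioo_l0 in eventually_elim, simp add: ginv_unique)
qed

text \<open>The growth part of (F) read at \<open>\<phi> q\<close>. It makes t negligible against
  \<open>\<phi> (l t)\<close> whenever \<open>t * Ph (l t)\<close> stays bounded.\<close>

lemma varphi_mult_Ph_at_top: "filterlim (\<lambda>q. \<phi> q * Ph q) at_top (at_right 0)"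
proof -
  have "filterlim (\<lambda>x. x * deriv H x) at_top at_top" using F by (simp add: condF_def)
  from filterlim_compose[OF this varphi_at_top]
  have "filterlim (\<lambda>q. \<phi> q * deriv H (\<phi> q)) at_top (at_right 0)" .
  then show ?thesis
    by (rule filterlim_mono_eventually[OF _ order_refl order_refl])
       (use eventually_Ioo_l0 in eventually_elim, simp add: deriv_Hfun varphi_pos ginv_unique)
qed

lemma Ph_inverse_scaled:
  assumes \<kappa>: "\<kappa> > 0" and \<theta>: "\<theta> > 0"
  shows "((\<lambda>t. t * Ph (\<theta> * inv_nonneg Ph (\<kappa> / t))) \<longlongrightarrow> \<kappa> * \<theta> powr (\<delta> * \<alpha>)) at_top"
proof -
  have "((\<lambda>t. Ph (\<theta> * inv_nonneg Ph (\<kappa> / t)) / Ph (inv_nonneg Ph (\<kappa> / t))) \<longlongrightarrow> \<theta> powr (\<delta> * \<alpha>)) at_top"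
    by (rule filterlim_compose[OF Ph_regularly_varying[OF \<theta>] inv_nonneg_at_right[OF \<kappa>]])
  then have "((\<lambda>t. \<kappa> * (Ph (\<theta> * inv_nonneg Ph (\<kappa> / t)) / Ph (inv_nonneg Ph (\<kappa> / t)))) \<longlongrightarrow> \<kappa> * \<theta> powr (\<delta> * \<alpha>)) at_top"
    by (intro tendsto_intros)
  then show ?thesis
    by (rule Lim_transform_eventually)
       (use eventually_small_over_t[OF \<kappa>] in eventually_elim, use inv_nonneg(2) \<kappa> in simp)
qed

lemma Hfun_increment_tendsto:
  assumes \<kappa>: "\<kappa> > 0" and \<theta>: "\<theta> > 0"
  defines "l \<equiv> \<lambda>t. \<theta> * inv_nonneg Ph (\<kappa> / t)"
  shows "((\<lambda>t. H (\<phi> (l t) + t) - H (\<phi> (l t))) \<longlongrightarrow> \<kappa> * \<theta> powr (\<delta> * \<alpha>)) at_top"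
proof -
  have l_lim: "filterlim l (at_right 0) at_top"
    unfolding l_def by (rule filterlim_mult_at_right_0[OF inv_nonneg_at_right[OF \<kappa>] \<theta>])
  have ev: "eventually (\<lambda>t. 0 < l t \<and> l t < l0) at_top"
    by (rule eventually_compose_filterlim[OF eventually_Ioo_l0 l_lim])
  have \<phi>top: "filterlim (\<lambda>t. \<phi> (l t)) at_top at_top" by (rule filterlim_compose[OF varphi_at_top l_lim])
  have tPh: "((\<lambda>t. t * Ph (l t)) \<longlongrightarrow> \<kappa> * \<theta> powr (\<delta> * \<alpha>)) at_top"
    unfolding l_def by (rule Ph_inverse_scaled[OF \<kappa> \<theta>])
  \<comment> \<open>Multiplying t and \<open>\<phi> (l t)\<close> by \<open>Ph (l t)\<close> gives a
    convergent numerator and a denominator tending to infinity.\<close>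
  have "((\<lambda>t. (t * Ph (l t)) / (\<phi> (l t) * Ph (l t))) \<longlongrightarrow> 0) at_top"
    by (rule real_tendsto_divide_at_top[OF tPh filterlim_compose[OF varphi_mult_Ph_at_top l_lim]])
  then have "((\<lambda>t. t / \<phi> (l t)) \<longlongrightarrow> 0) at_top"
  proof (rule Lim_transform_eventually)
    show "eventually (\<lambda>t. (t * Ph (l t)) / (\<phi> (l t) * Ph (l t)) = t / \<phi> (l t)) at_top"
      using ev
    proof eventually_elim
      case (elim t)
      then have "Ph (l t) \<noteq> 0" using Ph_pos[of "l t"] by simp
      then show ?case by simp
    qed
  qed
  from tendsto_add[OF tendsto_const[of 1] this]
  have "((\<lambda>t. 1 + t / \<phi> (l t)) \<longlongrightarrow> 1) at_top" by simp
  then have "((\<lambda>t. (\<phi> (l t) + t) / \<phi> (l t)) \<longlongrightarrow> 1) at_top"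
  proof (rule Lim_transform_eventually)
    show "eventually (\<lambda>t. 1 + t / \<phi> (l t) = (\<phi> (l t) + t) / \<phi> (l t)) at_top"
      using ev
    proof eventually_elim
      case (elim t)
      then have "\<phi> (l t) \<noteq> 0" using varphi_pos[of "l t"] by simp
      then show ?case by (simp add: field_simps)
    qed
  qed
  from deriv_ratio[OF \<phi>top this]
  have "((\<lambda>t. Ph (g (\<phi> (l t) + t)) / Ph (g (\<phi> (l t)))) \<longlongrightarrow> 1) at_top" by simp
  from tendsto_mult[OF tPh this]
  have "((\<lambda>t. t * Ph (l t) * (Ph (g (\<phi> (l t) + t)) / Ph (g (\<phi> (l t))))) \<longlongrightarrow> \<kappa> * \<theta> powr (\<delta> * \<alpha>)) at_top"
    by simp
  moreover have "eventually (\<lambda>t. t * Ph (l t) * (Ph (g (\<phi> (l t) + t)) / Ph (g (\<phi> (l t))))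
      = t * Ph (g (\<phi> (l t) + t))) at_top"
    using ev
  proof eventually_elim
    case (elim t)
    then have "Ph (l t) \<noteq> 0" using Ph_pos[of "l t"] by simp
    then show ?case using ginv_unique[of "l t"] elim by simp
  qed
  ultimately have lower: "((\<lambda>t. t * Ph (g (\<phi> (l t) + t))) \<longlongrightarrow> \<kappa> * \<theta> powr (\<delta> * \<alpha>)) at_top"
    by (rule Lim_transform_eventually)
  \<comment> \<open>The mean value theorem gives t times the derivative of \<open>H\<close> at an
    intermediate point; as this derivative is decreasing, its values at the two end points enclose
    the increment, and both have the same limit after multiplication by t.\<close>
  have mvt: "t * Ph (g (\<phi> (l t) + t)) \<le> H (\<phi> (l t) + t) - H (\<phi> (l t)) \<and>
      H (\<phi> (l t) + t) - H (\<phi> (l t)) \<le> t * Ph (l t)" if "0 < l t" "l t < l0" "t > 0" for t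
  proof -
    have \<phi>: "\<phi> (l t) > 0" using that varphi_pos by simp
    have "\<exists>z>\<phi> (l t). z < \<phi> (l t) + t \<and>
        H (\<phi> (l t) + t) - H (\<phi> (l t)) = (\<phi> (l t) + t - \<phi> (l t)) * Ph (g z)"
      by (rule MVT2) (use that \<phi> in \<open>auto intro!: Hfun_deriv\<close>)
    then obtain z where z: "\<phi> (l t) < z" "z < \<phi> (l t) + t"
      "H (\<phi> (l t) + t) - H (\<phi> (l t)) = t * Ph (g z)" by auto
    have "g (\<phi> (l t) + t) < g z" "g z < l t" "0 < g (\<phi> (l t) + t)" "0 < g z"
      using ginv_strict_antimono[of z "\<phi> (l t) + t"] ginv_strict_antimono[of "\<phi> (l t)" z]
        ginv_unique[of "l t"] ginv(1)[of z] ginv(1)[of "\<phi> (l t) + t"] z \<phi> that by auto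
    then have "Ph (g (\<phi> (l t) + t)) \<le> Ph (g z)" "Ph (g z) \<le> Ph (l t)" by (auto intro!: Ph_mono)
    then show ?thesis unfolding z(3) using that by simp
  qed
  show ?thesis
    by (rule tendsto_sandwich[OF _ _ lower tPh])
       (use ev eventually_gt_at_top[of 0] in eventually_elim, use mvt in blast)+
qed

text \<open>Inverts regular variation by monotonicity: the quotient is below \<open>k\<close>
  exactly when 1/c is below t \<Phi>(k q), q being the solution of \<Phi>(q) = 1/t. This tends to
  \<open>k powr (\<delta> * \<alpha>)\<close>, so the critical \<open>k\<close> is the claimed
  limit.\<close>

lemma inv_nonneg_regularly_varying:
  assumes \<delta>: "\<delta> > 0" and c: "c > 0"
  shows "((\<lambda>t. inv_nonneg Ph (1 / (c * t)) / inv_nonneg Ph (1 / t)) \<longlongrightarrow> c powr (- 1 / (\<delta> * \<alpha>))) at_top"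
proof -
  define p where "p = \<delta> * \<alpha>"
  have p: "p > 0" using \<delta> \<alpha> by (simp add: p_def)
  have top: "filterlim (\<lambda>x. c * x) at_top at_top"
    using c by (intro filterlim_tendsto_pos_mult_at_top[OF tendsto_const] filterlim_ident) auto
  have cp: "(c powr (- 1 / p)) powr p = 1 / c"
    unfolding powr_powr using c p by (simp add: powr_minus_divide)
  note small = eventually_small_over_t[OF zero_less_one]
  note small_c = eventually_compose_filterlim[OF small top]
  have lim: "((\<lambda>t. t * Ph (k * inv_nonneg Ph (1 / t))) \<longlongrightarrow> k powr p) at_top" if "k > 0" for k
    using Ph_inverse_scaled[OF zero_less_one that] by (simp add: p_def)
  show ?thesis
    unfolding p_def[symmetric]
  proof (rule order_tendstoI)
    fix k assume k: "c powr (- 1 / p) < k"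
    have "c powr (- 1 / p) > 0" using c by simp
    then have "k > 0" using k by linarith
    have "1 / c < k powr p"
      using powr_less_mono2[OF p _ k] cp c by simp
    from order_tendstoD(1)[OF lim[OF \<open>k > 0\<close>] this] small small_c
    show "eventually (\<lambda>t. inv_nonneg Ph (1 / (c * t)) / inv_nonneg Ph (1 / t) < k) at_top"
    proof eventually_elim
      case (elim t)
      note r = inv_nonneg[of "1 / t"] inv_nonneg[of "1 / (c * t)"]
      have "1 / (c * t) < Ph (k * inv_nonneg Ph (1 / t))"
        using elim c by (simp add: field_simps)
      then have "Ph (inv_nonneg Ph (1 / (c * t))) < Ph (k * inv_nonneg Ph (1 / t))"
        using r elim by simp
      then have "inv_nonneg Ph (1 / (c * t)) < k * inv_nonneg Ph (1 / t)"
        using r elim \<open>k > 0\<close> by (subst (asm) Ph_less_iff) auto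
      then show ?case using r elim by (simp add: pos_divide_less_eq)
    qed
  next
    fix k assume k: "k < c powr (- 1 / p)"
    show "eventually (\<lambda>t. k < inv_nonneg Ph (1 / (c * t)) / inv_nonneg Ph (1 / t)) at_top"
    proof (cases "k > 0")
      case True
      have "k powr p < 1 / c"
        using powr_less_mono2[OF p _ k] cp True by simp
      from order_tendstoD(2)[OF lim[OF True] this] small small_c
      show ?thesis
      proof eventually_elim
        case (elim t)
        note r = inv_nonneg[of "1 / t"] inv_nonneg[of "1 / (c * t)"]
        have "Ph (k * inv_nonneg Ph (1 / t)) < 1 / (c * t)"
          using elim c by (simp add: field_simps)
        then have "Ph (k * inv_nonneg Ph (1 / t)) < Ph (inv_nonneg Ph (1 / (c * t)))"
          using r elim by simp
        then have "k * inv_nonneg Ph (1 / t) < inv_nonneg Ph (1 / (c * t))"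
          using r elim True by (subst (asm) Ph_less_iff) auto
        then show ?case using r elim by (simp add: pos_less_divide_eq)
      qed
    next
      case False
      show ?thesis using small small_c
      proof eventually_elim
        case (elim t)
        have "0 < inv_nonneg Ph (1 / (c * t)) / inv_nonneg Ph (1 / t)"
          using inv_nonneg(1)[of "1 / t"] inv_nonneg(1)[of "1 / (c * t)"] elim by simp
        then show ?case using False by simp
      qed
    qed
  qed
qed

lemma inv_nonneg_eq_powr_slowly_varying:
  assumes \<delta>: "\<delta> > 0"
  shows "\<exists>lbar. slowly_varying lbar \<and>
    (\<forall>\<^sub>F t in at_top. inv_nonneg Ph (1 / t) = t powr (- 1 / (\<delta> * \<alpha>)) * lbar t)"
proof -
  define p where "p = 1 / (\<delta> * \<alpha>)"
  define T where "T = 1 / Ph 1"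
  \<comment> \<open>Freezing the argument below \<open>T\<close> keeps 1/t in the range where the
    inverse exists. The result is monotone on the whole line, hence Borel measurable, as
    \<open>slowly_varying\<close> demands globally.\<close>
  define r where "r t = inv_nonneg Ph (1 / max T t)" for t
  define lbar where "lbar t = (if t \<ge> T then t powr p * r t else 1)" for t
  have T: "T > 0" using Ph_pos[of 1] by (simp add: T_def)
  have small: "0 < 1 / max T t" "1 / max T t \<le> Ph 1" for t
  proof -
    show "0 < 1 / max T t" using T by (simp add: less_max_iff_disj)
    have "1 / max T t \<le> 1 / T" using T by (intro divide_left_mono) (auto simp: less_max_iff_disj)
    then show "1 / max T t \<le> Ph 1" by (simp add: T_def)
  qed
  have r_eq: "r t = inv_nonneg Ph (1 / t)" if "t \<ge> T" for t using that by (simp add: r_def)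
  have r_pos: "r t > 0" for t unfolding r_def by (rule inv_nonneg(1)[OF small])
  have "mono (\<lambda>t. - r t)"
  proof
    fix s t :: real assume "s \<le> t"
    then have "1 / max T t \<le> 1 / max T s" using T by (intro divide_left_mono) (auto simp: less_max_iff_disj)
    then show "- r s \<le> - r t"
      unfolding r_def using small by (simp add: inv_nonneg_mono)
  qed
  from borel_measurable_uminus[OF borel_measurable_mono[OF this]]
  have [measurable]: "r \<in> borel_measurable borel" by simp
  have "slowly_varying lbar"
    unfolding slowly_varying_def
  proof (intro conjI allI impI)
    show "lbar \<in> borel_measurable borel" unfolding lbar_def[abs_def] by measurable
    show "eventually (\<lambda>t. 0 < lbar t) at_top"
      using eventually_ge_at_top[of T]
      by eventually_elim (use T r_pos in \<open>auto simp: lbar_def\<close>)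
    fix c :: real assume c: "c > 0"
    have top: "filterlim (\<lambda>x. c * x) at_top at_top"
      using c by (intro filterlim_tendsto_pos_mult_at_top[OF tendsto_const] filterlim_ident) auto
    have "((\<lambda>t. c powr p * (inv_nonneg Ph (1 / (c * t)) / inv_nonneg Ph (1 / t)))
        \<longlongrightarrow> c powr p * c powr (- 1 / (\<delta> * \<alpha>))) at_top"
      by (intro tendsto_intros inv_nonneg_regularly_varying \<delta> c)
    moreover have "c powr p * c powr (- 1 / (\<delta> * \<alpha>)) = 1"
      using c by (simp add: p_def powr_add[symmetric])
    ultimately have "((\<lambda>t. c powr p * (inv_nonneg Ph (1 / (c * t)) / inv_nonneg Ph (1 / t))) \<longlongrightarrow> 1) at_top"
      by simp
    then show "((\<lambda>t. lbar (c * t) / lbar t) \<longlongrightarrow> 1) at_top"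
    proof (rule Lim_transform_eventually)
      have "eventually (\<lambda>t. c * t \<ge> T) at_top" using top by (simp add: filterlim_at_top)
      with eventually_ge_at_top[of T]
      show "eventually (\<lambda>t. c powr p * (inv_nonneg Ph (1 / (c * t)) / inv_nonneg Ph (1 / t))
          = lbar (c * t) / lbar t) at_top"
      proof eventually_elim
        case (elim t)
        then show ?case using T c by (simp add: lbar_def r_eq powr_mult)
      qed
    qed
  qed
  moreover have "eventually (\<lambda>t. inv_nonneg Ph (1 / t) = t powr (- 1 / (\<delta> * \<alpha>)) * lbar t) at_top"
    using eventually_ge_at_top[of T]
  proof eventually_elim
    case (elim t)
    then have "t powr (- 1 / (\<delta> * \<alpha>)) * t powr p = 1"
      using T by (simp add: p_def powr_add[symmetric])
    then show ?case using elim by (simp add: lbar_def r_eq mult.assoc[symmetric])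
  qed
  ultimately show ?thesis by blast
qed

end

end

section \<open>The laws of the process under (F)\<close>

context cbi_process
begin

context
  fixes \<delta> :: real and L :: "real \<Rightarrow> real"
  assumes F: "condF H \<delta> L"
begin

lemma laplace_inverse_tendsto:
  assumes "\<kappa> > 0" "\<theta> > 0"
  shows "((\<lambda>t. \<integral>\<omega>. exp (- \<theta> * (inv_nonneg Ph (\<kappa> / t) * Y t \<omega>)) \<partial>M) \<longlongrightarrow> exp (- (\<kappa> * \<theta> powr (\<delta> * \<alpha>)))) at_top"
  using laplace_tendsto[OF filterlim_mult_at_right_0[OF inv_nonneg_at_right[OF assms(1)] assms(2)]
      Hfun_increment_tendsto[OF F assms]]
  by (simp add: mult.assoc)

lemma fast_limit_law:
  assumes \<delta>: "\<delta> > 0"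
  shows "\<exists>\<mu>. prob_space \<mu> \<and> sets \<mu> = sets borel \<and> (AE y in \<mu>. y \<ge> 0) \<and>
    (\<forall>\<theta>>0. (\<integral>y. exp (- \<theta> * y) \<partial>\<mu>) = exp (- (\<theta> powr (\<delta> * \<alpha>)))) \<and>
    conv_law_at_top M (\<lambda>t \<omega>. inv_nonneg Ph (1 / t) * Y t \<omega>) \<mu>"
proof -
  obtain T where T: "\<And>t. t \<ge> T \<Longrightarrow> t > 0 \<and> 0 < 1 / t \<and> 1 / t \<le> Ph 1"
    using eventually_small_over_t[OF zero_less_one] unfolding eventually_at_top_linorder by blast
  show ?thesis
  proof (rule laplace_continuity[where T=T])
    show "prob_space M" by unfold_locales
    show "(\<lambda>\<omega>. inv_nonneg Ph (1 / t) * Y t \<omega>) \<in> borel_measurable M" if "t \<ge> T" for t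
      using Y_meas[of t] T[OF that] by auto
    show "0 \<le> inv_nonneg Ph (1 / t) * Y t \<omega>" if "t \<ge> T" "\<omega> \<in> space M" for t \<omega>
      using Y_nonneg[of t \<omega>] inv_nonneg(1)[of "1 / t"] T[OF that(1)] that by simp
    \<comment> \<open>Here \<delta> > 0 is essential: for \<delta> = 0 the limit transform is the
      constant exp(-1) and mass escapes to infinity.\<close>
    have "\<delta> * \<alpha> > 0" using \<delta> \<alpha> by simp
    then have "((\<lambda>l. exp (- (l powr (\<delta> * \<alpha>)))) \<longlongrightarrow> exp (- (0 powr (\<delta> * \<alpha>)))) (at_right 0)"
      by (intro tendsto_intros tendsto_powr') (auto simp: less_imp_le eventually_mono[OF eventually_at_right_less])
    then show "((\<lambda>l. exp (- (l powr (\<delta> * \<alpha>)))) \<longlongrightarrow> 1) (at_right 0)" by simp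
    show "((\<lambda>t. \<integral>\<omega>. exp (- l * (inv_nonneg Ph (1 / t) * Y t \<omega>)) \<partial>M) \<longlongrightarrow> exp (- (l powr (\<delta> * \<alpha>)))) at_top"
      if "l > 0" for l using laplace_inverse_tendsto[OF zero_less_one that] by simp
  qed
qed

text \<open>On \<open>Y t = 0\<close> the junk value \<open>1 / 0 = 0\<close> gives \<open>0\<close> instead of the intended \<open>\<infinity>\<close>, but this event
  has vanishing probability.\<close>

lemma fastest_limit_law:
  assumes \<delta>: "\<delta> = 0"
  shows "conv_law_at_top M (\<lambda>t \<omega>. t * Ph (1 / Y t \<omega>)) (density lborel (exponential_density 1))"
proof -
  let ?X = "\<lambda>t \<omega>. t * Ph (1 / Y t \<omega>)"
  \<comment> \<open>\<Phi> is known to be monotone only on [0, \<infinity>); the truncation gives a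
    function monotone everywhere that agrees with it at \<open>1 / Y t \<omega>\<close>.\<close>
  have "mono (\<lambda>q. Ph (max 0 q))" by (auto intro!: monoI Ph_mono)
  then have Ph_meas: "(\<lambda>q. Ph (max 0 q)) \<in> borel_measurable borel" by (rule borel_measurable_mono)
  have meas: "?X t \<in> borel_measurable M" if "t \<ge> 1" for t
  proof -
    have [measurable]: "Y t \<in> borel_measurable M" using Y_meas that by simp
    have "(\<lambda>\<omega>. t * Ph (max 0 (1 / Y t \<omega>))) \<in> borel_measurable M"
      by (intro borel_measurable_times measurable_compose[OF _ Ph_meas]) auto
    moreover have "?X t \<omega> = t * Ph (max 0 (1 / Y t \<omega>))" if "\<omega> \<in> space M" for \<omega>
      using Y_nonneg[of t \<omega>] \<open>t \<ge> 1\<close> that by simp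
    ultimately show ?thesis by (subst measurable_cong) auto
  qed
  \<comment> \<open>With \<delta> = 0 the factor \<open>\<theta> powr (\<delta> * \<alpha>)\<close>
    is 1, so the Laplace limit is the same for every scale \<theta>.\<close>
  have small_ball: "((\<lambda>t. measure M {\<omega> \<in> space M. inv_nonneg Ph (\<kappa> / t) * Y t \<omega> < 1}) \<longlongrightarrow> exp (- \<kappa>)) at_top"
    if \<kappa>: "\<kappa> > 0" for \<kappa>
  proof -
    obtain T where T: "\<And>t. t \<ge> T \<Longrightarrow> t > 0 \<and> 0 < \<kappa> / t \<and> \<kappa> / t \<le> Ph 1"
      using eventually_small_over_t[OF \<kappa>] unfolding eventually_at_top_linorder by blast
    show ?thesis
    proof (rule measure_tendsto_of_constant_laplace_limit[where T=T
          and Z="\<lambda>t \<omega>. inv_nonneg Ph (\<kappa> / t) * Y t \<omega>"])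
      show "prob_space M" by unfold_locales
      show Zm: "(\<lambda>\<omega>. inv_nonneg Ph (\<kappa> / t) * Y t \<omega>) \<in> borel_measurable M" if "t \<ge> T" for t
        using Y_meas[of t] T[OF that] by auto
      show "0 \<le> inv_nonneg Ph (\<kappa> / t) * Y t \<omega>" if "t \<ge> T" "\<omega> \<in> space M" for t \<omega>
        using Y_nonneg[of t \<omega>] inv_nonneg(1)[of "\<kappa> / t"] T[OF that(1)] that by simp
      show "{\<omega> \<in> space M. inv_nonneg Ph (\<kappa> / t) * Y t \<omega> < 1} \<in> events" if "t \<ge> T" for t
        using Zm[OF that] by measurable
      show "((\<lambda>t. \<integral>\<omega>. exp (- \<theta> * (inv_nonneg Ph (\<kappa> / t) * Y t \<omega>)) \<partial>M) \<longlongrightarrow> exp (- \<kappa>)) at_top"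
        if "\<theta> > 0" for \<theta> using laplace_inverse_tendsto[OF \<kappa> that] \<delta> that by simp
    qed auto
  qed
  \<comment> \<open>The event \<open>Y t = 0\<close> is contained in the small ball event for every
    \<kappa>, whose limit \<open>exp (- \<kappa>)\<close> is arbitrarily small.\<close>
  have zero: "((\<lambda>t. measure M {\<omega> \<in> space M. Y t \<omega> = 0}) \<longlongrightarrow> 0) at_top"
  proof (rule order_tendstoI)
    fix a :: real assume "0 < a"
    define \<kappa> where "\<kappa> = max 1 (1 - ln a)"
    have \<kappa>: "\<kappa> > 0" "exp (- \<kappa>) < a"
    proof -
      have "exp (- \<kappa>) < exp (ln a)" by (subst exp_less_cancel_iff) (simp add: \<kappa>_def)
      then show "exp (- \<kappa>) < a" using \<open>0 < a\<close> by simp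
    qed (simp add: \<kappa>_def less_max_iff_disj)
    show "eventually (\<lambda>t. measure M {\<omega> \<in> space M. Y t \<omega> = 0} < a) at_top"
      using order_tendstoD(2)[OF small_ball[OF \<kappa>(1)] \<kappa>(2)] eventually_ge_at_top[of 0]
    proof eventually_elim
      case (elim t)
      note [measurable] = Y_meas[OF elim(2)]
      have "measure M {\<omega> \<in> space M. Y t \<omega> = 0} \<le> measure M {\<omega> \<in> space M. inv_nonneg Ph (\<kappa> / t) * Y t \<omega> < 1}"
        by (intro finite_measure_mono) auto
      then show ?case using elim(1) by simp
    qed
  qed (auto intro!: always_eventually less_le_trans[OF _ measure_nonneg])
  have cdf_pos: "((\<lambda>t. measure M {\<omega> \<in> space M. ?X t \<omega> \<le> y}) \<longlongrightarrow> 1 - exp (- y)) at_top"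
    if y: "y > 0" for y
  proof -
    have "((\<lambda>t. 1 - (measure M {\<omega> \<in> space M. inv_nonneg Ph (y / t) * Y t \<omega> < 1}
        - measure M {\<omega> \<in> space M. Y t \<omega> = 0})) \<longlongrightarrow> 1 - (exp (- y) - 0)) at_top"
      by (intro tendsto_intros small_ball[OF y] zero)
    then have "((\<lambda>t. 1 - (measure M {\<omega> \<in> space M. inv_nonneg Ph (y / t) * Y t \<omega> < 1}
        - measure M {\<omega> \<in> space M. Y t \<omega> = 0})) \<longlongrightarrow> 1 - exp (- y)) at_top" by simp
    then show ?thesis
    proof (rule Lim_transform_eventually)
      show "eventually (\<lambda>t. 1 - (measure M {\<omega> \<in> space M. inv_nonneg Ph (y / t) * Y t \<omega> < 1}
          - measure M {\<omega> \<in> space M. Y t \<omega> = 0}) = measure M {\<omega> \<in> space M. ?X t \<omega> \<le> y}) at_top"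
        using eventually_small_over_t[OF y] eventually_ge_at_top[of 1]
      proof eventually_elim
        case (elim t)
        define \<rho> where "\<rho> = inv_nonneg Ph (y / t)"
        have \<rho>: "\<rho> > 0" "Ph \<rho> = y / t" using inv_nonneg[of "y / t"] elim by (auto simp: \<rho>_def)
        have [measurable]: "Y t \<in> borel_measurable M" "?X t \<in> borel_measurable M"
          using Y_meas[of t] meas[of t] elim by auto
        \<comment> \<open>Since \<open>Y t \<omega> = 0\<close> satisfies the left side through the
          junk value, it has to be excluded from the small ball event on the right.\<close>
        have key: "?X t \<omega> \<le> y \<longleftrightarrow> \<not> (\<rho> * Y t \<omega> < 1 \<and> Y t \<omega> \<noteq> 0)" if "\<omega> \<in> space M" for \<omega>
        proof (cases "Y t \<omega> = 0")
          case True then show ?thesis using y by (simp add: Ph_zero)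
        next
          case False
          then have Y: "Y t \<omega> > 0" using Y_nonneg[of t \<omega>] elim that by auto
          have "?X t \<omega> \<le> y \<longleftrightarrow> \<not> Ph \<rho> < Ph (1 / Y t \<omega>)"
          proof -
            have "y = t * Ph \<rho>" using elim \<rho>(2) by simp
            then show ?thesis using elim by (simp add: not_less)
          qed
          also have "\<dots> \<longleftrightarrow> \<not> \<rho> < 1 / Y t \<omega>" using Y \<rho>(1) by (subst Ph_less_iff) auto
          also have "\<dots> \<longleftrightarrow> \<not> \<rho> * Y t \<omega> < 1" using Y by (simp add: field_simps)
          finally show ?thesis using False by simp
        qed
        have "{\<omega> \<in> space M. ?X t \<omega> \<le> y}
            = space M - ({\<omega> \<in> space M. \<rho> * Y t \<omega> < 1} - {\<omega> \<in> space M. Y t \<omega> = 0})"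
          using key by auto
        also have "measure M \<dots> = 1 - measure M ({\<omega> \<in> space M. \<rho> * Y t \<omega> < 1} - {\<omega> \<in> space M. Y t \<omega> = 0})"
          by (rule prob_compl) measurable
        also have "measure M ({\<omega> \<in> space M. \<rho> * Y t \<omega> < 1} - {\<omega> \<in> space M. Y t \<omega> = 0})
            = measure M {\<omega> \<in> space M. \<rho> * Y t \<omega> < 1} - measure M {\<omega> \<in> space M. Y t \<omega> = 0}"
          by (rule finite_measure_Diff) auto
        finally show ?case by (simp add: \<rho>_def)
      qed
    qed
  qed
  interpret E: prob_space "density lborel (exponential_density 1)"
    by (rule prob_space_exponential_density) simp
  have cdf: "cdf (density lborel (exponential_density 1)) y = (if y < 0 then 0 else 1 - exp (- y))" for y
    using emeasure_erlang_density[of 1 0 y] by (simp add: cdf_def measure_def erlang_CDF_0)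
  show ?thesis
  proof (rule conv_law_at_top_cdfI[where T=1])
    show "prob_space M" by unfold_locales
    show "real_distribution (density lborel (exponential_density 1))" by unfold_locales auto
    show "?X t \<in> borel_measurable M" if "t \<ge> 1" for t by (rule meas[OF that])
    fix y :: real
    show "((\<lambda>t. measure M {\<omega> \<in> space M. ?X t \<omega> \<le> y}) \<longlongrightarrow> cdf (density lborel (exponential_density 1)) y) at_top"
    proof (cases "y > 0")
      case True then show ?thesis using cdf_pos[OF True] by (simp add: cdf)
    next
      case False
      have "((\<lambda>t. measure M {\<omega> \<in> space M. ?X t \<omega> \<le> y}) \<longlongrightarrow> 0) at_top"
      proof (rule order_tendstoI)
        fix a :: real assume "0 < a"
        \<comment> \<open>Chosen so that \<open>1 - exp (- z)\<close> equals
          \<open>min a (1 / 2) / 2\<close>, which is below \<open>a\<close>.\<close>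
        define z where "z = - ln (1 - min a (1 / 2) / 2)"
        have z: "z > 0" "1 - exp (- z) < a"
          using \<open>0 < a\<close> by (auto simp: z_def min_def)
        show "eventually (\<lambda>t. measure M {\<omega> \<in> space M. ?X t \<omega> \<le> y} < a) at_top"
          using order_tendstoD(2)[OF cdf_pos[OF z(1)] z(2)] eventually_ge_at_top[of 1]
        proof eventually_elim
          case (elim t)
          note [measurable] = meas[OF elim(2)]
          have "measure M {\<omega> \<in> space M. ?X t \<omega> \<le> y} \<le> measure M {\<omega> \<in> space M. ?X t \<omega> \<le> z}"
            using False z(1) by (intro finite_measure_mono) auto
          then show ?case using elim(1) by simp
        qed
      qed (auto intro!: always_eventually less_le_trans[OF _ measure_nonneg])
      moreover have "cdf (density lborel (exponential_density 1)) y = 0" using False by (simp add: cdf)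
      ultimately show ?thesis by (simp only:)
    qed
  qed
qed

end

end

section \<open>Verification of the analytic hypotheses and assembly of the limit laws\<close>

theorem theorem6:
  fixes \<sigma> b \<beta> l0 \<alpha> x :: real
    and \<pi> \<nu> :: "real measure"
    and ell :: "real \<Rightarrow> real"
    and v :: "real \<Rightarrow> real \<Rightarrow> real"
    and M :: "'a measure"
    and Y :: "real \<Rightarrow> 'a \<Rightarrow> real"
  assumes \<sigma>: "\<sigma> \<ge> 0" and b0: "b = 0" and \<beta>: "\<beta> \<ge> 0"
    and \<pi>_sets: "sets \<pi> = sets borel" and \<pi>_sf: "sigma_finite_measure \<pi>"
    and \<pi>_supp: "emeasure \<pi> {..0} = 0"
    and \<pi>_int: "(\<integral>\<^sup>+ z. ennreal (min z (z\<^sup>2)) \<partial>\<pi>) < \<infinity>"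
    and \<nu>_sets: "sets \<nu> = sets borel" and \<nu>_sf: "sigma_finite_measure \<nu>"
    and \<nu>_supp: "emeasure \<nu> {..0} = 0"
    and \<nu>_int: "(\<integral>\<^sup>+ z. ennreal (min 1 z) \<partial>\<nu>) < \<infinity>"
    and Phi_pos: "\<And>q. q > 0 \<Longrightarrow> Phi \<beta> \<nu> q > 0"
    and l0: "l0 > 0"
    and \<alpha>: "0 < \<alpha>" "\<alpha> < 1" and ell: "slowly_varying ell"
    and tail: "(\<lambda>u. measure \<pi> {u<..}) \<sim>[at_top]
                 (\<lambda>u. - (1 / Gamma (- \<alpha>)) * u powr (- 1 - \<alpha>) * ell u)"
    and v_nonneg: "\<And>t lam. t \<ge> 0 \<Longrightarrow> lam \<ge> 0 \<Longrightarrow> v t lam \<ge> 0"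
    and v_init: "\<And>lam. lam \<ge> 0 \<Longrightarrow> v 0 lam = lam"
    and v_ode: "\<And>t lam. t \<ge> 0 \<Longrightarrow> lam \<ge> 0 \<Longrightarrow>
                 ((\<lambda>s. v s lam) has_real_derivative (- Psi b \<sigma> \<pi> (v t lam))) (at t within {0..})"
    and x: "x \<ge> 0"
    and M: "prob_space M"
    and Y_meas: "\<And>t. t \<ge> 0 \<Longrightarrow> Y t \<in> borel_measurable M"
    and Y_nonneg: "\<And>t \<omega>. t \<ge> 0 \<Longrightarrow> \<omega> \<in> space M \<Longrightarrow> Y t \<omega> \<ge> 0"
    and Y_laplace: "\<And>t lam. t \<ge> 0 \<Longrightarrow> lam \<ge> 0 \<Longrightarrow>
          (\<integral>\<omega>. exp (- lam * Y t \<omega>) \<partial>M)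
            = exp (- x * v t lam - integral {0..t} (\<lambda>s. Phi \<beta> \<nu> (v s lam)))"
  shows
    "(condS (Hfun (Psi b \<sigma> \<pi>) (Phi \<beta> \<nu>) l0) \<longrightarrow>
       (let m = (\<lambda>y. if y > 0 then exp (oint (\<lambda>u. Phi \<beta> \<nu> u / Psi b \<sigma> \<pi> u) (1 / y) 1) else 0)
        in conv_law_at_top M
             (\<lambda>t \<omega>. m (Y t \<omega>) / m (1 / ginv (Psi b \<sigma> \<pi>) l0 t))
             (uniform_measure lborel {0..1})))
     \<and> (\<forall>a. condL (Hfun (Psi b \<sigma> \<pi>) (Phi \<beta> \<nu>) l0) a \<longrightarrow>
         (\<exists>\<mu>. prob_space \<mu> \<and> sets \<mu> = sets borel \<and> (AE y in \<mu>. y \<ge> 0) \<and>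
            (\<forall>lam\<ge>0. (\<integral>y. exp (- lam * y) \<partial>\<mu>) = (1 + lam powr \<alpha>) powr (- a)) \<and>
            conv_law_at_top M (\<lambda>t \<omega>. ginv (Psi b \<sigma> \<pi>) l0 t * Y t \<omega>) \<mu>))
     \<and> (\<forall>\<delta> L. condF (Hfun (Psi b \<sigma> \<pi>) (Phi \<beta> \<nu>) l0) \<delta> L \<longrightarrow>
         (\<delta> > 0 \<longrightarrow>
            (\<exists>lbar. slowly_varying lbar \<and>
               (\<forall>\<^sub>F t in at_top. inv_nonneg (Phi \<beta> \<nu>) (1 / t) = t powr (- 1 / (\<delta> * \<alpha>)) * lbar t)) \<and>
            (\<exists>\<mu>. prob_space \<mu> \<and> sets \<mu> = sets borel \<and> (AE y in \<mu>. y \<ge> 0) \<and>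
               (\<forall>\<theta>\<ge>0. (\<integral>y. exp (- \<theta> * y) \<partial>\<mu>) = exp (- (\<theta> powr (\<delta> * \<alpha>)))) \<and>
               conv_law_at_top M (\<lambda>t \<omega>. inv_nonneg (Phi \<beta> \<nu>) (1 / t) * Y t \<omega>) \<mu>)) \<and>
         (\<delta> = 0 \<longrightarrow>
            conv_law_at_top M (\<lambda>t \<omega>. t * Phi \<beta> \<nu> (1 / Y t \<omega>))
              (density lborel (exponential_density 1))))"
proof -
  interpret B: branching_measure \<pi>
    by (rule branching_measure.intro) fact+
  \<comment> \<open>The prefactor is positive because Gamma(1 - \<alpha>) = - \<alpha>
    Gamma(-\<alpha>) is positive, so Gamma(-\<alpha>) is negative.\<close>
  have K: "- (1 / Gamma (- \<alpha>)) > 0"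
  proof -
    have "- \<alpha> \<notin> \<int>\<^sub>\<le>\<^sub>0"
    proof
      assume "- \<alpha> \<in> \<int>\<^sub>\<le>\<^sub>0"
      then obtain n :: int where "- \<alpha> = of_int n" by (auto elim: nonpos_Ints_cases)
      then have "- 1 < n" "n < 0" using \<alpha> by linarith+
      then show False by simp
    qed
    then have "Gamma (- \<alpha> + 1) = - \<alpha> * Gamma (- \<alpha>)" by (rule Gamma_plus1)
    moreover have "Gamma (- \<alpha> + 1) > 0" using \<alpha> by (intro Gamma_real_pos) auto
    ultimately have "Gamma (- \<alpha>) < 0" using \<alpha> by (simp add: mult_less_0_iff zero_less_mult_iff)
    then show ?thesis by simp
  qed
  have tail': "B.tail \<sim>[at_top] (\<lambda>u. - (1 / Gamma (- \<alpha>)) * u powr (- 1 - \<alpha>) * ell u)"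
    using tail by (simp add: B.tail_def[abs_def])
  interpret S: stable_tail \<pi> \<alpha>
    by unfold_locales
       (fact \<alpha> tendsto_ratio_of_equivalent_powr_slowly_varying(1)[OF tail' K ell]
          tendsto_ratio_of_equivalent_powr_slowly_varying(2)[OF tail' K ell zero_less_one])+
  interpret I: immigration_measure \<beta> \<nu>
    by (rule immigration_measure.intro) fact+
  have Psi_eq: "Psi b \<sigma> \<pi> q = \<sigma>\<^sup>2 / 2 * q\<^sup>2 + B.psi q" for q
    by (simp add: Psi_def B.psi_def b0)
  \<comment> \<open>On [0, l0] both \<open>u\<^sup>2\<close> and \<open>max u (u\<^sup>2)\<close>
    are linear in u up to the factors \<open>l0\<close> and \<open>max 1 l0\<close>.\<close>
  define C where "C = \<sigma>\<^sup>2 / 2 * l0 + max 1 l0 * (\<integral>u. min u (u\<^sup>2) \<partial>\<pi>)"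
  interpret P: prob_space M by fact
  interpret m: cbi_mechanisms "Psi b \<sigma> \<pi>" "Phi \<beta> \<nu>" l0 \<alpha> C
  proof unfold_locales
    show "continuous_on {0<..} (Psi b \<sigma> \<pi>)"
      unfolding Psi_eq[abs_def] by (intro continuous_intros continuous_on_subset[OF B.continuous_psi]) auto
    show "Psi b \<sigma> \<pi> u > 0" if "u > 0" for u
      using S.psi_pos[OF that] by (simp add: Psi_eq add_nonneg_pos)
    show "Psi b \<sigma> \<pi> 0 = 0" by (simp add: Psi_def)
    show "Psi b \<sigma> \<pi> u \<le> C * u" if "0 \<le> u" "u \<le> l0" for u
    proof -
      have I: "0 \<le> (\<integral>z. min z (z\<^sup>2) \<partial>\<pi>)"
        using B.AE_pos by (intro integral_nonneg_AE) (auto elim!: eventually_mono)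
      have u2: "u\<^sup>2 \<le> l0 * u" using that by (simp add: power2_eq_square mult_right_mono)
      have "max u (u\<^sup>2) \<le> max 1 l0 * u"
        using that u2 mult_right_mono[of 1 "max 1 l0" u] mult_right_mono[of l0 "max 1 l0" u] by auto
      then have "max u (u\<^sup>2) * (\<integral>z. min z (z\<^sup>2) \<partial>\<pi>) \<le> max 1 l0 * u * (\<integral>z. min z (z\<^sup>2) \<partial>\<pi>)"
        using I by (intro mult_right_mono)
      moreover have "\<sigma>\<^sup>2 / 2 * u\<^sup>2 \<le> \<sigma>\<^sup>2 / 2 * (l0 * u)" using u2 by (intro mult_left_mono) auto
      moreover have "C * u = \<sigma>\<^sup>2 / 2 * (l0 * u) + max 1 l0 * u * (\<integral>z. min z (z\<^sup>2) \<partial>\<pi>)"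
        unfolding C_def by (simp only: distrib_left distrib_right mult_ac)
      ultimately show ?thesis
        using B.psi_le[OF that(1)] unfolding Psi_eq by linarith
    qed
    show "((\<lambda>q. Psi b \<sigma> \<pi> (c * q) / Psi b \<sigma> \<pi> q) \<longlongrightarrow> c powr (1 + \<alpha>)) (at_right 0)" if "c > 0" for c
      using S.Psi_regularly_varying[OF that] b0 by simp
  qed (fact l0 \<alpha> I.continuous_Phi I.Phi_zero I.Phi_strict_mono)+
  interpret p: cbi_process "Psi b \<sigma> \<pi>" "Phi \<beta> \<nu>" l0 \<alpha> C M Y x
  proof unfold_locales
    show "(\<integral>\<omega>. exp (- l * Y t \<omega>) \<partial>M) = exp (- x * m.g (m.\<phi> l + t) - (m.H (m.\<phi> l + t) - m.H (m.\<phi> l)))"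
      if "t \<ge> 0" "0 < l" "l < l0" for t l
    proof -
      have v: "v s l = m.g (m.\<phi> l + s)" if "s \<ge> 0" for s
        using v_nonneg v_init v_ode \<open>0 < l\<close> \<open>l < l0\<close> that by (intro m.flow_eq) auto
      then show ?thesis
        using Y_laplace[of t l] m.flow_integral[of "\<lambda>s. v s l" l t] that by simp
    qed
  qed (fact Y_meas Y_nonneg)+
  \<comment> \<open>The continuity theorem speaks of positive arguments; at 0 both sides are 1
    because the limit is a probability measure.\<close>
  have ext0: "(\<forall>l\<ge>0. (\<integral>y. exp (- l * y) \<partial>\<mu>) = f l)"
    if "prob_space \<mu>" "\<forall>l>0. (\<integral>y. exp (- l * y) \<partial>\<mu>) = f l" "f 0 = 1" for \<mu> and f :: "real \<Rightarrow> real"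
  proof (intro allI impI)
    interpret \<mu>: prob_space \<mu> by fact
    fix l :: real assume "l \<ge> 0"
    then show "(\<integral>y. exp (- l * y) \<partial>\<mu>) = f l"
      using that(2,3) by (cases "l = 0") (auto simp: \<mu>.prob_space)
  qed
  show ?thesis
  proof (intro conjI allI impI)
    show "let m = \<lambda>y. if y > 0 then exp (oint (\<lambda>u. Phi \<beta> \<nu> u / Psi b \<sigma> \<pi> u) (1 / y) 1) else 0
        in conv_law_at_top M (\<lambda>t \<omega>. m (Y t \<omega>) / m (1 / m.g t)) (uniform_measure lborel {0..1})"
      if "condS m.H"
      unfolding Let_def by (rule p.slow_limit_law[OF that])
  next
    fix a assume "condL m.H a"
    from p.log_limit_law[OF this] obtain \<mu> where \<mu>: "prob_space \<mu>" "sets \<mu> = sets borel" "AE y in \<mu>. y \<ge> 0"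
      "\<forall>l>0. (\<integral>y. exp (- l * y) \<partial>\<mu>) = (1 + l powr \<alpha>) powr (- a)"
      "conv_law_at_top M (\<lambda>t \<omega>. m.g t * Y t \<omega>) \<mu>" by blast
    then show "\<exists>\<mu>. prob_space \<mu> \<and> sets \<mu> = sets borel \<and> (AE y in \<mu>. y \<ge> 0) \<and>
        (\<forall>lam\<ge>0. (\<integral>y. exp (- lam * y) \<partial>\<mu>) = (1 + lam powr \<alpha>) powr (- a)) \<and>
        conv_law_at_top M (\<lambda>t \<omega>. m.g t * Y t \<omega>) \<mu>"
      using ext0[OF \<mu>(1,4)] by auto
  next
    fix \<delta> L assume F: "condF m.H \<delta> L" and \<delta>: "\<delta> > 0"
    show "\<exists>lbar. slowly_varying lbar \<and>
        (\<forall>\<^sub>F t in at_top. inv_nonneg (Phi \<beta> \<nu>) (1 / t) = t powr (- 1 / (\<delta> * \<alpha>)) * lbar t)"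
      by (rule m.inv_nonneg_eq_powr_slowly_varying[OF F \<delta>])
    from p.fast_limit_law[OF F \<delta>] obtain \<mu> where \<mu>: "prob_space \<mu>" "sets \<mu> = sets borel" "AE y in \<mu>. y \<ge> 0"
      "\<forall>\<theta>>0. (\<integral>y. exp (- \<theta> * y) \<partial>\<mu>) = exp (- (\<theta> powr (\<delta> * \<alpha>)))"
      "conv_law_at_top M (\<lambda>t \<omega>. inv_nonneg (Phi \<beta> \<nu>) (1 / t) * Y t \<omega>) \<mu>" by blast
    then show "\<exists>\<mu>. prob_space \<mu> \<and> sets \<mu> = sets borel \<and> (AE y in \<mu>. y \<ge> 0) \<and>
        (\<forall>\<theta>\<ge>0. (\<integral>y. exp (- \<theta> * y) \<partial>\<mu>) = exp (- (\<theta> powr (\<delta> * \<alpha>)))) \<and>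
        conv_law_at_top M (\<lambda>t \<omega>. inv_nonneg (Phi \<beta> \<nu>) (1 / t) * Y t \<omega>) \<mu>"
      using ext0[OF \<mu>(1,4)] by auto
  next
    fix \<delta> L assume F: "condF m.H \<delta> L" and \<delta>: "\<delta> = 0"
    show "conv_law_at_top M (\<lambda>t \<omega>. t * Phi \<beta> \<nu> (1 / Y t \<omega>)) (density lborel (exponential_density 1))"
      by (rule p.fastest_limit_law[OF F \<delta>])
  qed
qed

end
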